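(* Let $q\in(0,1]$. (i) $\mathcal{M}(\overline{\mathcal{R}}_\infty(q))=\{f(\pm z): f\in\overline{\mathcal{PN}}_\infty(q)\}$. (ii) $\mathcal{M}(\overline{\mathcal{N}}_\infty(q))=\overline{\mathcal{PN}}_\infty(q)$. (iii) If $r\in(0,q)$ and $f$ belongs to $\overline{\mathcal{PR}}_\infty(q)$ or $\overline{\mathcal{PN}}_\infty(q)$, then, respectively, $f$ belongs to $\overline{\mathcal{PR}}_\infty(r)$ or $\overline{\mathcal{PN}}_\infty(r)$. (iv) $\bigcup_{q\in(0,1]}\overline{\mathcal{PR}}_\infty(q)\subset\overline{\mathcal{LC}}_\infty$ and $\bigcup_{q\in(0,1]}\overline{\mathcal{PN}}_\infty(q)\subset\overline{\mathcal{LC}^{+}}_\infty$.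
   Context: Zeros are counted with multiplicity; entire functions are identified with their Taylor series at $0$. For $f=\sum a_kz^k$, $g=\sum b_kz^k$ in $\mathbb{C}[[z]]$ put $f*g=\sum a_kb_kz^k$; a power series that is not a polynomial has degree $+\infty$. For $\mathcal{X}\subset\mathbb{C}[[z]]$, $\mathcal{M}(\mathcal{X})$ is the set of $g\in\mathbb{C}[[z]]$ with $\deg g\le\max\{\deg h:h\in\mathcal{X}\}$ such that $f*g\in\mathcal{X}$ for all $f\in\mathcal{X}$. For $h\in\mathbb{C}[[z]]$, $\mathcal{P}(\mathcal{X};h)$ is the set of $f\in\mathbb{C}[[z]]$ with $\deg f\le\deg h$ and $f*h\in\mathcal{X}$. $\{f(\pm z):f\in\mathcal{Y}\}$ means the set of all $f(z)$ and all $f(-z)$ with $f\in\mathcal{Y}$. A finite or infinite sequence $\{x_k\}$ of real numbers is $q$-separated if $x_k/x_l\le q$ for all indices $k\ne l$ with $x_l\le x_k<0$ or $0<x_k\le x_l$. For $q\in(0,1)$, $\overline{\mathcal{R}}_\infty(q)$ is the set of entire functions $F(z)=az^m\prod_{j=1}^{n}(1-z/x_j)$ with $a\in\mathbb{R}$, $m\in\mathbb{N}_0$, $n\in\mathbb{N}_0\cup\{\infty\}$ and $\{x_j\}_{j=1}^n$ a $q$-separated sequence of non-zero reals with $\inf_j|x_j|>0$; $\overline{\mathcal{N}}_\infty(q)$ is the set of those $F\in\overline{\mathcal{R}}_\infty(q)$ having only non-positive zeros (including $F\equiv0$). For $q=1$, $\overline{\mathcal{R}}_\infty(1)$ (resp.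 $\overline{\mathcal{N}}_\infty(1)$) is the closure, in the topology of uniform convergence on compact subsets of $\mathbb{C}$, of the set of real polynomials having only real zeros (resp. only zeros in $(-\infty,0]$), the zero polynomial included. $R_\infty(q;z)=\prod_{j=1}^\infty(1+q^{j-1}z)=\sum_{k=0}^\infty\Big(\prod_{j=1}^k\frac{q^{j-1}}{1-q^j}\Big)z^k$ for $q\in(0,1)$ and $R_\infty(1;z)=e^z$. For $q\in(0,1]$: $\overline{\mathcal{PR}}_\infty(q)=\mathcal{P}(\overline{\mathcal{R}}_\infty(q);R_\infty(q;z))$ and $\overline{\mathcal{PN}}_\infty(q)=\mathcal{P}(\overline{\mathcal{N}}_\infty(q);R_\infty(q;z))$. $\overline{\mathcal{LC}}_\infty$ is the set of all real formal power series $\sum_{k\ge0}a_kz^k$ with $a_k^2\ge a_{k-1}a_{k+1}$ for all $k\ge0$ (with $a_{-1}=0$). $\mathcal{LC}^{+}_\infty$ is the set of real formal power series $\sum_{k\ge 0} a_kz^k$ with either all $a_k\ge0$ or all $a_k\le0$, and with $a_k^2>a_{k-1}a_{k+1}$ for all $k\ge0$ for which there are $l\le k$ and $m\ge k$ with $a_l\ne0$, $a_m\neq0$; $\overline{\mathcal{LC}^{+}}_\infty$ is its closure with respect to coefficientwise convergence. *)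

theory Defs
  imports "HOL-Complex_Analysis.Complex_Analysis"
begin

text \<open>The value is \<open>\<infinity>\<close> exactly if the series is not a polynomial, and \<open>-\<infinity>\<close> for
  the zero series.\<close>

definition fps_deg :: "complex fps \<Rightarrow> ereal" where
  "fps_deg f = (SUP k\<in>{k. fps_nth f k \<noteq> 0}. ereal (real k))"

definition hadamard :: "complex fps \<Rightarrow> complex fps \<Rightarrow> complex fps" where
  "hadamard f g = Abs_fps (\<lambda>k. fps_nth f k * fps_nth g k)"

text \<open>The supremum in \<open>ereal\<close> plays the role of a maximum of degrees, whether or not it is
  attained.\<close>

definition multipliers :: "complex fps set \<Rightarrow> complex fps set" where
  "multipliers X =
    {g. fps_deg g \<le> (SUP h\<in>X. fps_deg h) \<and> (\<forall>f\<in>X. hadamard f g \<in> X)}"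

definition pre_class :: "complex fps set \<Rightarrow> complex fps \<Rightarrow> complex fps set" where
  "pre_class X h = {f. fps_deg f \<le> fps_deg h \<and> hadamard f h \<in> X}"

definition plus_minus :: "complex fps set \<Rightarrow> complex fps set" where
  "plus_minus Y = Y \<union> (\<lambda>f. fps_compose f (- fps_X)) ` Y"

text \<open>Entire functions are identified with their Taylor series at \<open>0\<close>.\<close>

abbreviation taylor :: "(complex \<Rightarrow> complex) \<Rightarrow> complex fps" where
  "taylor F \<equiv> fps_expansion F 0"

text \<open>A sequence of length \<open>n \<le> \<infinity>\<close> is given by the values \<open>x j\<close> with \<open>j < n\<close>, indexed from \<open>0\<close>;
  the remaining values of \<open>x\<close> are ignored.\<close>

definition q_separated :: "real \<Rightarrow> enat \<Rightarrow> (nat \<Rightarrow> real) \<Rightarrow> bool" where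
  "q_separated q n x \<longleftrightarrow>
    (\<forall>k l. enat k < n \<and> enat l < n \<and> k \<noteq> l \<and>
           (x l \<le> x k \<and> x k < 0 \<or> 0 < x k \<and> x k \<le> x l) \<longrightarrow> x k / x l \<le> q)"

text \<open>For \<open>n = \<infinity>\<close> and \<open>0 < q < 1\<close> the product below converges absolutely, since the \<open>x j\<close> of
  either sign grow at least geometrically. For finite \<open>n\<close> it is a finite product.\<close>

definition sep_entire :: "real \<Rightarrow> (complex \<Rightarrow> complex) set" where
  "sep_entire q =
    {F. F holomorphic_on UNIV \<and>
        (\<exists>(a::real) (m::nat) (n::enat) (x::nat \<Rightarrow> real).
           q_separated q n x \<and>
           (\<forall>j. enat j < n \<longrightarrow> x j \<noteq> 0) \<and>
           (\<exists>\<delta>>0. \<forall>j. enat j < n \<longrightarrow> \<delta> \<le> \<bar>x j\<bar>) \<and>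
           (\<forall>z. F z = of_real a * z ^ m *
                  (\<Prod>j. if enat j < n then 1 - z / of_real (x j) else 1)))}"

definition sep_entire_nonpos :: "real \<Rightarrow> (complex \<Rightarrow> complex) set" where
  "sep_entire_nonpos q =
    {F \<in> sep_entire q. F = (\<lambda>z. 0) \<or> (\<forall>z. F z = 0 \<longrightarrow> z \<in> \<real>\<^sub>\<le>\<^sub>0)}"

text \<open>Closure of a set of functions, inside the space of entire functions, for uniform convergence
  on compact sets.\<close>

definition compact_closure :: "(complex \<Rightarrow> complex) set \<Rightarrow> (complex \<Rightarrow> complex) set" where
  "compact_closure S =
    {F. F holomorphic_on UNIV \<and>
        (\<forall>K e. compact K \<and> e > 0 \<longrightarrow> (\<exists>G\<in>S. \<forall>z\<in>K. dist (G z) (F z) < e))}"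

definition real_poly_zeros_in :: "complex set \<Rightarrow> (complex \<Rightarrow> complex) set" where
  "real_poly_zeros_in A =
    {poly P | P. \<exists>p::real poly. P = map_poly of_real p \<and>
       (p = 0 \<or> (\<forall>z. poly P z = 0 \<longrightarrow> z \<in> A))}"

definition R_class :: "real \<Rightarrow> complex fps set" where
  "R_class q = taylor ` (if q = 1 then compact_closure (real_poly_zeros_in \<real>) else sep_entire q)"

definition N_class :: "real \<Rightarrow> complex fps set" where
  "N_class q =
    taylor ` (if q = 1 then compact_closure (real_poly_zeros_in \<real>\<^sub>\<le>\<^sub>0) else sep_entire_nonpos q)"

definition R_inf :: "real \<Rightarrow> complex fps" where
  "R_inf q = taylor (if q = 1 then exp else (\<lambda>z. \<Prod>j. 1 + of_real q ^ j * z))"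

definition PR_class :: "real \<Rightarrow> complex fps set" where
  "PR_class q = pre_class (R_class q) (R_inf q)"

definition PN_class :: "real \<Rightarrow> complex fps set" where
  "PN_class q = pre_class (N_class q) (R_inf q)"

text \<open>Real power series are regarded as elements of \<open>complex fps\<close>.\<close>

definition fps_of_real_seq :: "(nat \<Rightarrow> real) \<Rightarrow> complex fps" where
  "fps_of_real_seq a = Abs_fps (\<lambda>k. of_real (a k))"

text \<open>The coefficient with index \<open>k - 1\<close>, where the one with index \<open>-1\<close> is \<open>0\<close>.\<close>

definition prev_coeff :: "(nat \<Rightarrow> real) \<Rightarrow> nat \<Rightarrow> real" where
  "prev_coeff a k = (if k = 0 then 0 else a (k - 1))"

definition LC_bar :: "complex fps set" where
  "LC_bar = {fps_of_real_seq a | a. \<forall>k. (a k)\<^sup>2 \<ge> prev_coeff a k * a (k + 1)}"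

definition LC_plus :: "complex fps set" where
  "LC_plus = {fps_of_real_seq a | a.
     ((\<forall>k. a k \<ge> 0) \<or> (\<forall>k. a k \<le> 0)) \<and>
     (\<forall>k. (\<exists>l\<le>k. a l \<noteq> 0) \<and> (\<exists>m\<ge>k. a m \<noteq> 0) \<longrightarrow> (a k)\<^sup>2 > prev_coeff a k * a (k + 1))}"

text \<open>The topology on \<open>complex fps\<close> provided by the library is the \<open>X\<close>-adic one. Coefficientwise
  convergence is the product topology on \<open>nat \<Rightarrow> complex\<close>.\<close>

definition coeff_closure :: "complex fps set \<Rightarrow> complex fps set" where
  "coeff_closure S = {f. fps_nth f \<in> closure (fps_nth ` S)}"

definition LC_plus_bar :: "complex fps set" where
  "LC_plus_bar = coeff_closure LC_plus"

end

theory Submission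
  imports Defs "HOL-Computational_Algebra.Fundamental_Theorem_Algebra"
begin

text \<open>Dividing by the coefficients of \<open>R_inf q\<close> turns the Hadamard product into the convolution
  \<open>star q\<close>, with weights \<open>cw q k\<close>, and everything rests on one closure property: the convolution of
  a polynomial with \<open>q\<close>-separated real zeros and one with \<open>q\<close>-separated negative zeros again has
  \<open>q\<close>-separated real zeros. To prove it, expand \<open>pd q L\<close>, the \<open>q\<close>-derivative, in the products of all but
  one factor of \<open>L\<close> -- separation makes the coefficients have the right signs -- and deduce by induction
  on the number of zeros that \<open>star q (pd q L) K / star q L K\<close> maps the upper half-plane to the closed
  lower one. For \<open>H = star q L K\<close> this yields \<open>Im (z H(z) / H(z / q)) \<ge> 0\<close> there. By the
  open mapping theorem, a non-real zero of \<open>H\<close> of largest modulus would contradict this, so the zeros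
  are real, and following the argument of \<open>H(z) / H(z / q)\<close> shows that they are \<open>q\<close>-separated.

  Passing to limits gives the multiplier theorem in one direction. Conversely, a multiplier \<open>g\<close> acts
  on \<open>z ^ m * (1 - z\<^sup>2)\<close> and on truncations of \<open>z ^ m * R_inf q\<close>; were its signs neither constant nor
  alternating, one of the results would have two terms only and a non-real zero. The inclusion for
  \<open>r < q\<close> is the convolution with \<open>R_inf r\<close>, and log-concavity is Newton's inequality for \<open>star\<close>.\<close>

subsection \<open>The \<open>q\<close>-derivative and the convolution of polynomials\<close>

text \<open>The case q = 1 shares the convolution and the half-plane inequalities, but not the step
  to real zeros: comparing H(z) with H(z / q) says nothing there. Its place is taken by a direct
  non-vanishing result for factors with constant term 1, by Hurwitz's theorem, and by the Jensen
  polynomials, which describe the class through its coefficients and so avoid factoring entire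
  functions. For q < 1 the obstacle is the passage to the limit. The lowest coefficient of the
  convolution of two partial products may tend to 0; zeros then run into the origin and their
  reciprocals are unbounded. Limits are therefore taken only along polynomials with a fixed order of
  vanishing at the origin. Where partial products do not have it, other approximants are used: a
  zero of the second factor at the origin is traded for a \<open>q\<close>-derivative of the first,
  and one zero is altered when an unwanted coefficient must be 0. Closed inequalities stand in for
  properties that limits can destroy: the power form of log-concavity keeps the support free of
  gaps.\<close>

definition ev :: "complex \<Rightarrow> real poly \<Rightarrow> complex" where
  "ev z p = poly (map_poly of_real p) z"

lemma ev_0 [simp]: "ev z 0 = 0"
  by (simp add: ev_def)

lemma ev_1 [simp]: "ev z 1 = 1"
  by (simp add: ev_def)

lemma ev_pCons [simp]: "ev z (pCons a p) = of_real a + z * ev z p"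
  by (cases "p = 0 \<and> a = 0") (auto simp: ev_def map_poly_pCons)

lemma ev_add [simp]: "ev z (p + r) = ev z p + ev z r"
  by (induction p r rule: poly_induct2) (auto simp: algebra_simps)

lemma ev_smult [simp]: "ev z (smult a p) = of_real a * ev z p"
  by (induction p) (auto simp: algebra_simps)

lemma ev_minus [simp]: "ev z (- p) = - ev z p"
  using ev_smult[of z "-1" p] by simp

lemma ev_diff [simp]: "ev z (p - r) = ev z p - ev z r"
  using ev_add[of z p "- r"] by simp

lemma ev_mult [simp]: "ev z (p * r) = ev z p * ev z r"
  by (induction p) (auto simp: algebra_simps)

lemma ev_sum: "ev z (sum f I) = (\<Sum>i\<in>I. ev z (f i))"
  by (induction I rule: infinite_finite_induct) auto

lemma ev_prod: "ev z (prod f I) = (\<Prod>i\<in>I. ev z (f i))"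
  by (induction I rule: infinite_finite_induct) auto

lemma ev_power [simp]: "ev z (p ^ n) = ev z p ^ n"
  by (induction n) auto

lemma ev_monom [simp]: "ev z (monom a n) = of_real a * z ^ n"
  by (induction n) (auto simp: monom_0 monom_Suc algebra_simps)

lemma ev_altdef: "degree p \<le> n \<Longrightarrow> ev z p = (\<Sum>k\<le>n. of_real (coeff p k) * z ^ k)"
proof -
  assume "degree p \<le> n"
  then have "p = (\<Sum>k\<le>n. monom (coeff p k) k)"
    by (simp add: poly_as_sum_of_monoms')
  then have "ev z p = ev z (\<Sum>k\<le>n. monom (coeff p k) k)"
    by simp
  then show ?thesis
    by (simp add: ev_sum)
qed

lemma ev_cnj: "ev (cnj z) p = cnj (ev z p)"
  by (induction p) auto

lemma ev_of_real: "ev (of_real x) p = of_real (poly p x)"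
  by (induction p) auto

lemma ev_continuous [continuous_intros]:
  "continuous_on S f \<Longrightarrow> continuous_on S (\<lambda>z. ev (f z) p)"
  unfolding ev_def by (intro continuous_intros)

lemma ev_holomorphic [holomorphic_intros]:
  "f holomorphic_on S \<Longrightarrow> (\<lambda>z. ev (f z) p) holomorphic_on S"
  unfolding ev_def by (intro holomorphic_intros)

lemma map_poly_of_real_eq_0 [simp]:
  "map_poly of_real p = (0 :: complex poly) \<longleftrightarrow> p = 0"
  by (simp add: map_poly_eq_0_iff)

lemma finite_ev_roots: "p \<noteq> 0 \<Longrightarrow> finite {z. ev z p = 0}"
  unfolding ev_def by (intro poly_roots_finite) auto

text \<open>The reciprocals of the coefficients of \<open>R_inf q\<close> are the products of the weights \<open>wt q\<close>, so the
  operator below is the \<open>q\<close>-derivative that fixes \<open>R_inf q\<close>.\<close>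

definition tau :: "real \<Rightarrow> real" where
  "tau q = (if q = 1 then 1 else 1 - q)"

definition wt :: "real \<Rightarrow> nat \<Rightarrow> real" where
  "wt q k = tau q * (\<Sum>i<k. (1 / q) ^ i)"

definition cw :: "real \<Rightarrow> nat \<Rightarrow> real" where
  "cw q k = (\<Prod>i<k. wt q (Suc i))"

lemma tau_pos: "0 < q \<Longrightarrow> q \<le> 1 \<Longrightarrow> tau q > 0"
  by (auto simp: tau_def)

lemma wt_0 [simp]: "wt q 0 = 0"
  by (simp add: wt_def)

lemma wt_Suc: "wt q (Suc k) = tau q + wt q k / q"
  unfolding wt_def sum.lessThan_Suc_shift
  by (simp add: algebra_simps sum_distrib_left sum_divide_distrib)

lemma wt_pos: "0 < q \<Longrightarrow> q \<le> 1 \<Longrightarrow> k > 0 \<Longrightarrow> wt q k > 0"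
  unfolding wt_def using tau_pos[of q]
  by (intro mult_pos_pos sum_pos) (auto simp: lessThan_empty_iff)

lemma cw_0 [simp]: "cw q 0 = 1"
  by (simp add: cw_def)

lemma cw_Suc: "cw q (Suc k) = cw q k * wt q (Suc k)"
  by (simp add: cw_def)

lemma cw_pos: "0 < q \<Longrightarrow> q \<le> 1 \<Longrightarrow> cw q k > 0"
  unfolding cw_def by (intro prod_pos) (auto intro: wt_pos)

lemma wt_closed: "0 < q \<Longrightarrow> q < 1 \<Longrightarrow> wt q k = q * ((1 / q) ^ k - 1)"
  by (induction k) (auto simp: wt_Suc tau_def field_simps)

lemma wt_one: "wt 1 k = real k"
  by (simp add: wt_def tau_def)

lemma cw_one: "cw 1 k = fact k"
  by (induction k) (auto simp: cw_Suc wt_one)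

text \<open>For q < 1 this is q (P(z/q) - P(z)) / z, for q = 1 the derivative.\<close>

definition pd :: "real \<Rightarrow> real poly \<Rightarrow> real poly" where
  "pd q p = (\<Sum>k<degree p. monom (wt q (Suc k) * coeff p (Suc k)) k)"

text \<open>The weights are the reciprocals of the coefficients of \<open>R_inf q\<close>, which is
  therefore the unit when the same product is formed for power series. At q = 1 it is Schur's
  composition, with coefficients k! a_k b_k.\<close>

definition star :: "real \<Rightarrow> real poly \<Rightarrow> real poly \<Rightarrow> real poly" where
  "star q p r = (\<Sum>k\<le>degree p. monom (cw q k * coeff p k * coeff r k) k)"

lemma coeff_pd [simp]: "coeff (pd q p) k = wt q (Suc k) * coeff p (Suc k)"
proof -
  have "coeff (pd q p) k = (\<Sum>j<degree p. if j = k then wt q (Suc j) * coeff p (Suc j) else 0)"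
    by (simp add: pd_def coeff_sum)
  then show ?thesis
    by (auto simp: sum.delta coeff_eq_0 not_less)
qed

lemma coeff_star [simp]: "coeff (star q p r) k = cw q k * coeff p k * coeff r k"
proof -
  have "coeff (star q p r) k =
      (\<Sum>j\<le>degree p. if j = k then cw q j * coeff p j * coeff r j else 0)"
    by (simp add: star_def coeff_sum)
  then show ?thesis
    by (auto simp: sum.delta coeff_eq_0 not_le)
qed

lemma pd_linear [simp]:
  "pd q 0 = 0" "pd q (p + r) = pd q p + pd q r" "pd q (p - r) = pd q p - pd q r"
  "pd q (smult a p) = smult a (pd q p)"
  by (rule poly_eqI; simp add: algebra_simps)+

text \<open>The Leibniz rule for the factor z, read off from the recursion
  \<open>wt_Suc\<close>.\<close>

lemma pd_pCons: "pd q (pCons 0 p) = smult (tau q) p + smult (1 / q) (pCons 0 (pd q p))"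
proof (rule poly_eqI)
  fix n show "coeff (pd q (pCons 0 p)) n =
      coeff (smult (tau q) p + smult (1 / q) (pCons 0 (pd q p))) n"
    by (cases n) (auto simp: wt_Suc[of q "Suc _"] wt_Suc[of q 0] algebra_simps)
qed

lemma star_linear [simp]:
  "star q 0 r = 0" "star q p 0 = 0"
  "star q (p + p') r = star q p r + star q p' r" "star q p (r + r') = star q p r + star q p r'"
  "star q (p - p') r = star q p r - star q p' r" "star q p (r - r') = star q p r - star q p r'"
  "star q (smult a p) r = smult a (star q p r)" "star q p (smult a r) = smult a (star q p r)"
  by (rule poly_eqI; simp add: algebra_simps)+

lemma star_commute: "star q p r = star q r p"
  by (rule poly_eqI) simp

lemma star_sum: "star q (sum f I) r = (\<Sum>i\<in>I. star q (f i) r)"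
  by (induction I rule: infinite_finite_induct) auto

text \<open>Multiplication by z and \<open>pd q\<close> are adjoint to each other, since
  \<open>cw q (Suc k) = cw q k * wt q (Suc k)\<close>. This is what allows a factor 1 - x z to be
  split off inside a convolution.\<close>

lemma star_pCons: "star q (pCons 0 p) r = pCons 0 (star q p (pd q r))"
proof (rule poly_eqI)
  fix n show "coeff (star q (pCons 0 p) r) n = coeff (pCons 0 (star q p (pd q r))) n"
    by (cases n) (auto simp: cw_Suc)
qed

text \<open>Here x and y are reciprocals of zeros; the condition on quotients is written without
  division. Opposite signs or a value 0 satisfy it automatically, and so does every pair when q =
  1.\<close>

definition sep :: "real \<Rightarrow> real \<Rightarrow> real \<Rightarrow> bool" where
  "sep q x y \<longleftrightarrow> x * y \<le> 0 \<or> \<bar>x\<bar> \<le> q * \<bar>y\<bar> \<or> \<bar>y\<bar> \<le> q * \<bar>x\<bar>"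

lemma sep_commute: "sep q x y \<longleftrightarrow> sep q y x"
  by (auto simp: sep_def mult.commute)

definition psep :: "real \<Rightarrow> ('i \<Rightarrow> real) \<Rightarrow> 'i set \<Rightarrow> bool" where
  "psep q \<xi> I \<longleftrightarrow> (\<forall>i\<in>I. \<forall>j\<in>I. i \<noteq> j \<longrightarrow> sep q (\<xi> i) (\<xi> j))"

lemma psep_subset: "psep q \<xi> I \<Longrightarrow> J \<subseteq> I \<Longrightarrow> psep q \<xi> J"
  unfolding psep_def by blast

text \<open>Zeros are given by their reciprocals, so that \<open>\<xi> i = 0\<close> stands for an absent zero and zeros may
  run off to infinity in limits.\<close>

definition rp :: "nat \<Rightarrow> ('i \<Rightarrow> real) \<Rightarrow> 'i set \<Rightarrow> real poly" where
  "rp m \<xi> I = monom 1 m * (\<Prod>i\<in>I. [:1, - \<xi> i:])"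

lemma rp_Suc: "rp (Suc m) \<xi> I = pCons 0 (rp m \<xi> I)"
  by (simp add: rp_def monom_Suc)

lemma rp_insert:
  "finite I \<Longrightarrow> i \<notin> I \<Longrightarrow> rp m \<xi> (insert i I) = rp m \<xi> I - smult (\<xi> i) (pCons 0 (rp m \<xi> I))"
  by (simp add: rp_def algebra_simps)

lemma rp_remove:
  assumes "finite I" "i \<in> I"
  shows "rp m \<xi> I = rp m \<xi> (I - {i}) - smult (\<xi> i) (pCons 0 (rp m \<xi> (I - {i})))"
  using rp_insert[of "I - {i}" i m \<xi>] assms by (simp add: insert_absorb)

lemma rp_empty_0 [simp]: "rp 0 \<xi> {} = 1"
  by (simp add: rp_def)

lemma pd_1 [simp]: "pd q 1 = 0"
  by (rule poly_eqI) simp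

text \<open>The identity \<open>1 - x z / q = \<alpha> (1 - x z) + \<beta> (1 - y z)\<close> behind the expansion of the
  \<open>q\<close>-derivative of a product.\<close>

lemma pd_rp_step:
  fixes x y :: real
  assumes q: "0 < q" "q \<le> 1" and xy: "x * y \<le> 0 \<or> \<bar>x\<bar> \<le> q * \<bar>y\<bar>"
  shows "\<exists>\<alpha> \<beta>. \<alpha> \<ge> 0 \<and> \<beta> \<ge> 0 \<and>
    (\<forall>P. smult y (P - smult (x / q) (pCons 0 P)) =
       smult (\<alpha> * y) (P - smult x (pCons 0 P)) + smult (\<beta> * x) (P - smult y (pCons 0 P)))"
proof (cases "x = y \<or> x = 0")
  case True
  show ?thesis
  proof (cases "q = 1 \<or> x = 0")
    case True
    then show ?thesis
      by (intro exI[of _ 1] exI[of _ 0]) auto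
  next
    case False
    with True xy have "0 < x * x" "\<bar>x\<bar> \<le> q * \<bar>x\<bar>"
      by (auto simp: zero_less_mult_iff mult_le_0_iff)
    moreover have "q * \<bar>x\<bar> < \<bar>x\<bar>"
      using False q by auto
    ultimately show ?thesis by linarith
  qed
next
  case False
  then have ne: "x \<noteq> y" "x \<noteq> 0" by auto
  \<comment> \<open>Comparing coefficients gives the linear system
    \<open>\<alpha> * y + \<beta> * x = y\<close> and \<open>\<alpha> + \<beta> = 1 / q\<close>,
    solved here. Separation makes x - y and x / q - y agree in sign, whence
    \<open>\<alpha> \<ge> 0\<close>.\<close>
  define \<alpha> where "\<alpha> = (x / q - y) / (x - y)"
  define \<beta> where "\<beta> = - y * (1 - q) / (q * (x - y))"
  have \<alpha>\<beta>: "\<alpha> \<ge> 0 \<and> \<beta> \<ge> 0"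
  proof -
    consider "y = 0" | "y > 0" "x < 0" | "y < 0" "x > 0" | "y > 0" "x > 0" | "y < 0" "x < 0"
      using ne by linarith
    then show ?thesis
    proof cases
      case 1
      then show ?thesis using ne q by (auto simp: \<alpha>_def \<beta>_def)
    next
      case 2
      then have "x / q < 0" using q by (simp add: divide_neg_pos)
      with 2 show ?thesis using q
        by (auto simp: \<alpha>_def \<beta>_def intro!: divide_nonpos_neg divide_nonneg_neg mult_pos_neg mult_nonneg_nonneg)
    next
      case 3
      then have "x / q > 0" "x / q - y \<ge> 0" using q by (simp, smt (verit) divide_pos_pos)
      with 3 show ?thesis using q
        by (auto simp: \<alpha>_def \<beta>_def simp del: diff_ge_0_iff_ge
            intro!: divide_nonneg_pos divide_nonpos_pos mult_nonpos_nonneg mult_pos_pos)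
    next
      case 4
      then have "x \<le> q * y" using xy by (auto simp: mult_le_0_iff)
      moreover have "q * y \<le> y" using 4 q by auto
      ultimately have "x / q - y \<le> 0" "x - y < 0"
        using ne q by (auto simp: field_simps)
      with 4 show ?thesis using q
        by (auto simp: \<alpha>_def \<beta>_def intro!: divide_nonpos_neg divide_nonneg_neg mult_pos_neg mult_nonneg_nonneg)
    next
      case 5
      then have "- x \<le> q * - y" using xy by (auto simp: mult_le_0_iff)
      moreover have "q * - y \<le> - y" using 5 q mult_right_mono[of q 1 "-y"] by simp
      ultimately have "x / q - y \<ge> 0" "x - y > 0"
        using ne q by (auto simp: field_simps)
      with 5 show ?thesis using q
        by (auto simp: \<alpha>_def \<beta>_def simp del: diff_ge_0_iff_ge
            intro!: divide_nonneg_pos divide_nonpos_pos mult_nonpos_nonneg mult_pos_pos)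
    qed
  qed
  have 1: "\<alpha> * y + \<beta> * x = y" and 2: "y * (x / q) = \<alpha> * y * x + \<beta> * x * y"
  proof -
    have d: "\<alpha> * (x - y) = x / q - y" "\<beta> * (x - y) = - y * (1 / q - 1)"
      using ne q by (simp_all add: \<alpha>_def \<beta>_def field_simps)
    have "(\<alpha> * y + \<beta> * x) * (x - y) = y * (\<alpha> * (x - y)) + x * (\<beta> * (x - y))"
      by (simp add: algebra_simps)
    also have "\<dots> = y * (x - y)"
      unfolding d by (simp add: algebra_simps)
    finally show "\<alpha> * y + \<beta> * x = y" using ne by simp
    have "(\<alpha> + \<beta>) * (x - y) = (1 / q) * (x - y)"
      unfolding distrib_right[of \<alpha> \<beta>] d by (simp add: diff_divide_distrib right_diff_distrib)
    then have "\<alpha> + \<beta> = 1 / q" using ne(1) by (metis mult_right_cancel right_minus_eq)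
    then have "y * (x / q) = (\<alpha> + \<beta>) * (x * y)" by simp
    also have "\<dots> = \<alpha> * y * x + \<beta> * x * y" by (simp add: algebra_simps)
    finally show "y * (x / q) = \<alpha> * y * x + \<beta> * x * y" .
  qed
  have "smult y (P - smult (x / q) (pCons 0 P)) =
       smult (\<alpha> * y) (P - smult x (pCons 0 P)) + smult (\<beta> * x) (P - smult y (pCons 0 P))" for P
  proof (rule poly_eqI)
    fix n
    have "y * (coeff P n - (x / q) * coeff (pCons 0 P) n) =
      \<alpha> * y * (coeff P n - x * coeff (pCons 0 P) n) + \<beta> * x * (coeff P n - y * coeff (pCons 0 P) n)"
      using arg_cong[OF 1, of "\<lambda>t. t * coeff P n"] arg_cong[OF 2, of "\<lambda>t. t * coeff (pCons 0 P) n"]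
      by (simp add: algebra_simps)
    then show "coeff (smult y (P - smult (x / q) (pCons 0 P))) n =
       coeff (smult (\<alpha> * y) (P - smult x (pCons 0 P)) + smult (\<beta> * x) (P - smult y (pCons 0 P))) n"
      by (simp del: smult_pCons)
  qed
  with \<alpha>\<beta> show ?thesis by blast
qed

text \<open>At q = 1 this is the partial fraction expansion of the logarithmic derivative,
  multiplied out. In general, adjoining a factor 1 - x z multiplies the old
  \<open>q\<close>-derivative by 1 - x z / q and subtracts tau x times the old product;
  \<open>pd_rp_step\<close> redistributes 1 - x z / q over the terms already present.\<close>

lemma pd_rp:
  assumes q: "0 < q" "q \<le> 1"
  shows "finite I \<Longrightarrow> psep q \<xi> I \<Longrightarrow>
    \<exists>e0 e. e0 \<ge> 0 \<and> (\<forall>i\<in>I. e i \<ge> 0) \<and>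
      pd q (rp m \<xi> I) = (if m = 0 then 0 else smult e0 (rp (m - 1) \<xi> I)) -
        (\<Sum>i\<in>I. smult (e i * \<xi> i) (rp m \<xi> (I - {i})))"
proof (induction "card I" arbitrary: I)
  case 0
  then have I: "I = {}" by simp
  show ?case
  proof (cases m)
    case 0
    then show ?thesis using I by (intro exI[of _ 0]) auto
  next
    case (Suc k)
    then show ?thesis using I wt_pos[OF q, of m]
      by (intro exI[of _ "wt q m"]) (auto intro!: poly_eqI simp: rp_def monom_Suc coeff_pCons split: nat.splits)
  qed
next
  case (Suc n)
  then have "I \<noteq> {}" by auto
  \<comment> \<open>The factor adjoined last has the smallest reciprocal zero in modulus. Then
    separation takes the form \<open>\<bar>x\<bar> \<le> q * \<bar>y\<bar>\<close> against every
    remaining y of the same sign, as \<open>pd_rp_step\<close> demands.\<close>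
  then obtain a where a: "a \<in> I" "\<And>i. i \<in> I \<Longrightarrow> \<bar>\<xi> a\<bar> \<le> \<bar>\<xi> i\<bar>"
    using ex_is_arg_min_if_finite[OF Suc.prems(1), of "\<lambda>i. \<bar>\<xi> i\<bar>"]
    by (auto simp: is_arg_min_linorder)
  define J where "J = I - {a}"
  have J: "finite J" "a \<notin> J" "I = insert a J" "card J = n" "psep q \<xi> J"
    using Suc a psep_subset[of q \<xi> I J] by (auto simp: J_def)
  obtain e0 e where e: "e0 \<ge> 0" "\<And>i. i \<in> J \<Longrightarrow> e i \<ge> 0"
    "pd q (rp m \<xi> J) = (if m = 0 then 0 else smult e0 (rp (m - 1) \<xi> J)) -
        (\<Sum>i\<in>J. smult (e i * \<xi> i) (rp m \<xi> (J - {i})))"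
    using Suc.hyps(1)[of J] J by auto
  define x where "x = \<xi> a"
  have "\<exists>\<alpha> \<beta>. \<alpha> \<ge> 0 \<and> \<beta> \<ge> 0 \<and>
    (\<forall>P. smult (\<xi> i) (P - smult (x / q) (pCons 0 P)) =
       smult (\<alpha> * \<xi> i) (P - smult x (pCons 0 P)) + smult (\<beta> * x) (P - smult (\<xi> i) (pCons 0 P)))"
    if "i \<in> J" for i
  proof (rule pd_rp_step[OF q])
    have "sep q x (\<xi> i)" using Suc.prems(2) that J by (auto simp: psep_def x_def)
    moreover have "\<bar>x\<bar> \<le> \<bar>\<xi> i\<bar>" using a that J by (auto simp: x_def)
    moreover have "q * \<bar>x\<bar> \<le> q * \<bar>\<xi> i\<bar>" using calculation q by (intro mult_left_mono) auto
    moreover have "q * \<bar>x\<bar> \<le> \<bar>x\<bar>" using q by (auto intro: mult_left_le_one_le)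
    ultimately show "x * \<xi> i \<le> 0 \<or> \<bar>x\<bar> \<le> q * \<bar>\<xi> i\<bar>" unfolding sep_def by linarith
  qed
  then obtain \<alpha> \<beta> where \<alpha>\<beta>: "\<And>i. i \<in> J \<Longrightarrow> \<alpha> i \<ge> 0" "\<And>i. i \<in> J \<Longrightarrow> \<beta> i \<ge> 0"
    "\<And>i P. i \<in> J \<Longrightarrow> smult (\<xi> i) (P - smult (x / q) (pCons 0 P)) =
       smult (\<alpha> i * \<xi> i) (P - smult x (pCons 0 P)) + smult (\<beta> i * x) (P - smult (\<xi> i) (pCons 0 P))"
    by metis
  define s where "s = tau q + (\<Sum>i\<in>J. e i * \<beta> i)"
  have s: "s \<ge> 0" unfolding s_def using tau_pos[OF q] \<alpha>\<beta> e by (auto intro!: add_nonneg_nonneg sum_nonneg)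
  let ?T = "\<lambda>P. P - smult (x / q) (pCons 0 P)"
  have T: "?T (P + P') = ?T P + ?T P'" "?T (P - P') = ?T P - ?T P'" "?T (smult c P) = smult c (?T P)" for P P' c
    by (simp_all add: smult_diff_right smult_add_right algebra_simps)
  have Tsum: "?T (sum f A) = (\<Sum>i\<in>A. ?T (f i))" if "finite A" for f and A :: "'a set"
    using that
  proof (induction rule: finite_induct)
    case (insert i A)
    show ?case unfolding sum.insert[OF insert(1,2)] T(1) insert(3) ..
  qed simp
  have "pd q (rp m \<xi> I) = ?T (pd q (rp m \<xi> J)) - smult (x * tau q) (rp m \<xi> J)"
    using J by (simp add: rp_insert pd_pCons x_def smult_add_right algebra_simps)
  also have "?T (pd q (rp m \<xi> J)) = ?T (if m = 0 then 0 else smult e0 (rp (m - 1) \<xi> J)) -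
      (\<Sum>i\<in>J. smult (e i * \<alpha> i * \<xi> i) (rp m \<xi> (I - {i})) + smult (e i * \<beta> i * x) (rp m \<xi> J))"
  proof -
    have "?T (smult (e i * \<xi> i) (rp m \<xi> (J - {i}))) =
       smult (e i * \<alpha> i * \<xi> i) (rp m \<xi> (I - {i})) + smult (e i * \<beta> i * x) (rp m \<xi> J)"
      if i: "i \<in> J" for i
    proof -
      have I': "I - {i} = insert a (J - {i})" using J i by auto
      have "?T (smult (e i * \<xi> i) (rp m \<xi> (J - {i}))) = smult (e i) (smult (\<xi> i) (?T (rp m \<xi> (J - {i}))))"
        by (simp add: smult_diff_right mult_ac)
      also note \<alpha>\<beta>(3)[OF i]
      also have "rp m \<xi> (J - {i}) - smult (\<xi> i) (pCons 0 (rp m \<xi> (J - {i}))) = rp m \<xi> J"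
        using rp_remove[OF J(1) i] by simp
      also have "rp m \<xi> (J - {i}) - smult x (pCons 0 (rp m \<xi> (J - {i}))) = rp m \<xi> (I - {i})"
        using rp_insert[of "J - {i}" a m \<xi>] J I' by (simp add: x_def)
      finally show ?thesis by (simp add: smult_add_right mult_ac)
    qed
    then show ?thesis
      unfolding e(3) T(2) Tsum[OF J(1)] by simp
  qed
  \<comment> \<open>Since 1 - x z / q = (1 - x z) - (1 / q - 1) x z, the first part completes the
    product over \<open>I\<close>, and the factor z of the second raises \<open>m - 1\<close> to
    \<open>m\<close>.\<close>
  also have "?T (if m = 0 then 0 else smult e0 (rp (m - 1) \<xi> J)) =
     (if m = 0 then 0 else smult e0 (rp (m - 1) \<xi> I) - smult (e0 * (1 / q - 1) * x) (rp m \<xi> J))"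
  proof (cases m)
    case (Suc k)
    have "(1 / q - 1) * x = x / q - x" by (simp add: algebra_simps)
    then show ?thesis using Suc J
      by (simp add: rp_insert rp_Suc x_def[symmetric] smult_diff_right smult_diff_left[symmetric] mult.assoc)
         (simp add: algebra_simps smult_diff_left)
  qed auto
  also have "(\<Sum>i\<in>J. smult (e i * \<alpha> i * \<xi> i) (rp m \<xi> (I - {i})) + smult (e i * \<beta> i * x) (rp m \<xi> J)) =
      (\<Sum>i\<in>J. smult (e i * \<alpha> i * \<xi> i) (rp m \<xi> (I - {i}))) + smult ((\<Sum>i\<in>J. e i * \<beta> i) * x) (rp m \<xi> J)"
    by (simp add: sum.distrib smult_sum sum_distrib_right)
  finally have fin: "pd q (rp m \<xi> I) =
     (if m = 0 then 0 else smult e0 (rp (m - 1) \<xi> I)) -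
      (\<Sum>i\<in>J. smult (e i * \<alpha> i * \<xi> i) (rp m \<xi> (I - {i}))) -
      smult ((s + (if m = 0 then 0 else e0 * (1 / q - 1))) * x) (rp m \<xi> J)"
    by (auto simp: s_def smult_add_left distrib_right mult.commute[of x])
  \<comment> \<open>The new coefficient at \<open>a\<close> collects everything that landed on the
    product over \<open>J\<close>: the Leibniz term, the \<open>\<beta>\<close> parts and the
    remainder of the power of z.\<close>
  define e' where "e' = (\<lambda>i. if i = a then s + (if m = 0 then 0 else e0 * (1 / q - 1)) else e i * \<alpha> i)"
  have "\<forall>i\<in>I. e' i \<ge> 0"
    using s e \<alpha>\<beta> J q by (auto simp: e'_def)
  moreover have "(\<Sum>i\<in>I. smult (e' i * \<xi> i) (rp m \<xi> (I - {i}))) =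
     (\<Sum>i\<in>J. smult (e i * \<alpha> i * \<xi> i) (rp m \<xi> (I - {i}))) +
     smult ((s + (if m = 0 then 0 else e0 * (1 / q - 1))) * x) (rp m \<xi> J)"
  proof -
    have "(\<Sum>i\<in>J. smult (e' i * \<xi> i) (rp m \<xi> (I - {i}))) = (\<Sum>i\<in>J. smult (e i * \<alpha> i * \<xi> i) (rp m \<xi> (I - {i})))"
      using J by (intro sum.cong) (auto simp: e'_def)
    moreover have "I - {a} = J" using J by auto
    ultimately show ?thesis using J by (subst J(3)) (simp add: e'_def x_def)
  qed
  ultimately show ?case
    using e(1) fin by (intro exI[of _ e0] exI[of _ e']) (simp add: algebra_simps)
qed

subsection \<open>The half-plane inequality\<close>

abbreviation val :: "real \<Rightarrow> complex \<Rightarrow> real poly \<Rightarrow> real poly \<Rightarrow> complex" where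
  "val q z L K \<equiv> ev z (star q L K)"

lemma val_sum: "val q z (sum f I) K = (\<Sum>i\<in>I. val q z (f i) K)"
  by (simp add: star_sum ev_sum)

lemma val_sum_right: "val q z K (sum f I) = (\<Sum>i\<in>I. val q z K (f i))"
  by (simp add: star_commute[of q K] val_sum)

lemma val_pCons: "val q z (pCons 0 L) K = z * val q z L (pd q K)"
  by (simp add: star_pCons)

lemma val_pCons_right: "val q z L (pCons 0 K) = z * val q z (pd q L) K"
  by (metis star_commute val_pCons)

lemma Im_mult_cnj_swap: "Im (a * cnj b) = - Im (b * cnj a)"
  by (simp add: algebra_simps)

lemma Im_of_real_mult: "Im (of_real t * a) = t * Im a"
  by simp

lemma Im_z_mult_cnj: "Im (z * a * cnj a) = Im z * (norm a)\<^sup>2"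
  unfolding cmod_power2 by (simp add: algebra_simps power2_eq_square)

lemma Im_mult_cnj_diff: "Im (a * cnj (a - of_real t * b)) = t * Im (b * cnj a)"
  by (simp add: algebra_simps)

lemma Im_z_mult_cnj_diff:
  "Im (z * a * cnj (a - of_real t * (z * b))) =
    Im z * (norm a)\<^sup>2 + t * ((norm z)\<^sup>2 * Im (b * cnj a))"
  unfolding cmod_power2 by (simp add: algebra_simps power2_eq_square)

text \<open>Read as statements about meromorphic functions, the two inequalities say that
  \<open>- (pd L * K) / (L * K)\<close> and \<open>z (L * pd K) / (L * K)\<close> map the upper half-plane into its closure.
  Removing a factor of \<open>L\<close> reduces the first one to the second one for a smaller \<open>L\<close>, removing a
  factor of \<open>K\<close> reduces the second one to the first one for a smaller \<open>K\<close>.\<close>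

theorem val_pd_Im:
  assumes q: "0 < q" "q \<le> 1" and z: "Im z > 0"
  shows "finite I \<Longrightarrow> finite J \<Longrightarrow> psep q \<xi> I \<Longrightarrow> psep q \<eta> J \<Longrightarrow> (\<forall>j\<in>J. \<eta> j \<le> 0) \<Longrightarrow>
    Im (val q z (pd q (rp m \<xi> I)) (rp l \<eta> J) * cnj (val q z (rp m \<xi> I) (rp l \<eta> J))) \<le> 0 \<and>
    Im (z * val q z (rp m \<xi> I) (pd q (rp l \<eta> J)) * cnj (val q z (rp m \<xi> I) (rp l \<eta> J))) \<ge> 0"
proof (induction "m + card I + l + card J" arbitrary: m I l J rule: less_induct)
  case less
  note fin = less.prems(1,2)
  let ?L = "rp m \<xi> I" and ?K = "rp l \<eta> J"
  let ?H = "val q z ?L ?K"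
  have "Im (val q z (pd q ?L) ?K * cnj ?H) \<le> 0"
  proof -
    obtain e0 e where e: "e0 \<ge> 0" "\<And>i. i \<in> I \<Longrightarrow> e i \<ge> 0"
      "pd q ?L = (if m = 0 then 0 else smult e0 (rp (m - 1) \<xi> I)) -
          (\<Sum>i\<in>I. smult (e i * \<xi> i) (rp m \<xi> (I - {i})))"
      using pd_rp[OF q fin(1) less.prems(3), of m] by blast
    have 1: "Im (val q z (rp (m - 1) \<xi> I) ?K * cnj ?H) \<le> 0" if m: "m \<noteq> 0"
    proof -
      have L: "?L = pCons 0 (rp (m - 1) \<xi> I)" using m rp_Suc[of "m - 1" \<xi> I] by simp
      have "0 \<le> Im (z * val q z (rp (m - 1) \<xi> I) (pd q ?K) * cnj (val q z (rp (m - 1) \<xi> I) ?K))"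
        using less.hyps[of "m - 1" I l J] less.prems m by simp
      then show ?thesis unfolding L val_pCons
        using Im_mult_cnj_swap[of "val q z (rp (m - 1) \<xi> I) ?K"
            "z * val q z (rp (m - 1) \<xi> I) (pd q ?K)"] by linarith
    qed
    \<comment> \<open>Splitting off the factor of \<open>\<xi> i\<close> from H produces one
      \<open>\<xi> i\<close>, the expansion of \<open>pd q\<close> brings another. They combine to a
      square, which is what admits zeros of both signs in L.\<close>
    have 2: "\<xi> i * Im (val q z (rp m \<xi> (I - {i})) ?K * cnj ?H) \<ge> 0" if i: "i \<in> I" for i
    proof -
      let ?M = "rp m \<xi> (I - {i})"
      have "card (I - {i}) < card I" using i fin by (intro psubset_card_mono) auto
      then have "0 \<le> Im (z * val q z ?M (pd q ?K) * cnj (val q z ?M ?K))"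
        using less.hyps[of m "I - {i}" l J] less.prems psep_subset[of q \<xi> I "I - {i}"] by auto
      moreover have "?H = val q z ?M ?K - \<xi> i * (z * val q z ?M (pd q ?K))"
        by (subst rp_remove[OF fin(1) i]) (simp add: star_pCons)
      then have "Im (val q z ?M ?K * cnj ?H) = \<xi> i * Im (z * val q z ?M (pd q ?K) * cnj (val q z ?M ?K))"
        by (simp only: Im_mult_cnj_diff)
      ultimately have "\<xi> i * Im (val q z ?M ?K * cnj ?H) = (\<xi> i)\<^sup>2 * Im (z * val q z ?M (pd q ?K) * cnj (val q z ?M ?K))"
        by (simp only: power2_eq_square mult.assoc)
      then show ?thesis using \<open>0 \<le> Im (z * val q z ?M (pd q ?K) * cnj (val q z ?M ?K))\<close>
        by (simp only: mult_nonneg_nonneg zero_le_power2)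
    qed
    have "Im (val q z (pd q ?L) ?K * cnj ?H) =
        (if m = 0 then 0 else e0 * Im (val q z (rp (m - 1) \<xi> I) ?K * cnj ?H)) -
        (\<Sum>i\<in>I. e i * (\<xi> i * Im (val q z (rp m \<xi> (I - {i})) ?K * cnj ?H)))"
    proof -
      have "val q z (pd q ?L) ?K * cnj ?H =
        (if m = 0 then 0 else of_real e0 * (val q z (rp (m - 1) \<xi> I) ?K * cnj ?H)) -
        (\<Sum>i\<in>I. of_real (e i * \<xi> i) * (val q z (rp m \<xi> (I - {i})) ?K * cnj ?H))"
        unfolding e(3) by (simp add: val_sum sum_distrib_right left_diff_distrib mult.assoc)
      then show ?thesis
        by (simp add: Im_sum Im_of_real_mult mult.assoc if_distrib del: times_complex.sel of_real_mult cong: if_cong)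
    qed
    also have "\<dots> \<le> 0"
    proof -
      have "(\<Sum>i\<in>I. e i * (\<xi> i * Im (val q z (rp m \<xi> (I - {i})) ?K * cnj ?H))) \<ge> 0"
        by (intro sum_nonneg mult_nonneg_nonneg e 2)
      moreover have "(if m = 0 then 0 else e0 * Im (val q z (rp (m - 1) \<xi> I) ?K * cnj ?H)) \<le> 0"
        using 1 e(1) by (auto intro: mult_nonneg_nonpos)
      ultimately show ?thesis by linarith
    qed
    finally show ?thesis .
  qed
  moreover have "Im (z * val q z ?L (pd q ?K) * cnj ?H) \<ge> 0"
  proof -
    obtain e0 e where e: "e0 \<ge> 0" "\<And>i. i \<in> J \<Longrightarrow> e i \<ge> 0"
      "pd q ?K = (if l = 0 then 0 else smult e0 (rp (l - 1) \<eta> J)) -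
          (\<Sum>i\<in>J. smult (e i * \<eta> i) (rp l \<eta> (J - {i})))"
      using pd_rp[OF q fin(2) less.prems(4), of l] by blast
    have 1: "Im (z * val q z ?L (rp (l - 1) \<eta> J) * cnj ?H) \<ge> 0" if l: "l \<noteq> 0"
    proof -
      let ?M = "rp (l - 1) \<eta> J"
      have K: "?K = pCons 0 ?M" using l rp_Suc[of "l - 1" \<eta> J] by simp
      have "0 \<ge> Im (val q z (pd q ?L) ?M * cnj (val q z ?L ?M))"
        using less.hyps[of m I "l - 1" J] less.prems l by simp
      then have "0 \<ge> (norm z)\<^sup>2 * Im (val q z (pd q ?L) ?M * cnj (val q z ?L ?M))"
        by (intro mult_nonneg_nonpos) auto
      moreover have "(norm z)\<^sup>2 * Im (val q z (pd q ?L) ?M * cnj (val q z ?L ?M)) =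
          - Im (z * val q z ?L ?M * cnj ?H)"
        unfolding K val_pCons_right
        unfolding cmod_power2 by (simp add: algebra_simps power2_eq_square)
      ultimately show ?thesis by linarith
    qed
    \<comment> \<open>Here \<open>\<eta> i\<close> enters only once and must be non-positive; the
      part without it contributes the positive multiple Im z of a squared norm.\<close>
    have 2: "Im (z * val q z ?L (rp l \<eta> (J - {i})) * cnj ?H) \<ge> 0" if i: "i \<in> J" for i
    proof -
      let ?M = "rp l \<eta> (J - {i})"
      have "card (J - {i}) < card J" using i fin by (intro psubset_card_mono) auto
      then have *: "0 \<ge> Im (val q z (pd q ?L) ?M * cnj (val q z ?L ?M))"
        using less.hyps[of m I l "J - {i}"] less.prems psep_subset[of q \<eta> J "J - {i}"] by auto
      have "?H = val q z ?L ?M - \<eta> i * (z * val q z (pd q ?L) ?M)"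
        by (subst rp_remove[OF fin(2) i]) (simp add: val_pCons_right)
      then have "Im (z * val q z ?L ?M * cnj ?H) = Im z * (norm (val q z ?L ?M))\<^sup>2
         + \<eta> i * ((norm z)\<^sup>2 * Im (val q z (pd q ?L) ?M * cnj (val q z ?L ?M)))"
        by (simp only: Im_z_mult_cnj_diff)
      moreover have "\<eta> i * ((norm z)\<^sup>2 * Im (val q z (pd q ?L) ?M * cnj (val q z ?L ?M))) \<ge> 0"
        using * less.prems(5) i by (intro mult_nonpos_nonpos mult_nonneg_nonpos) auto
      ultimately show ?thesis using z by simp
    qed
    have "Im (z * val q z ?L (pd q ?K) * cnj ?H) =
        (if l = 0 then 0 else e0 * Im (z * val q z ?L (rp (l - 1) \<eta> J) * cnj ?H)) +
        (\<Sum>i\<in>J. e i * (- \<eta> i * Im (z * val q z ?L (rp l \<eta> (J - {i})) * cnj ?H)))"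
    proof -
      have "z * val q z ?L (pd q ?K) * cnj ?H =
        (if l = 0 then 0 else of_real e0 * (z * val q z ?L (rp (l - 1) \<eta> J) * cnj ?H)) +
        (\<Sum>i\<in>J. of_real (e i * - \<eta> i) * (z * val q z ?L (rp l \<eta> (J - {i})) * cnj ?H))"
        unfolding e(3) by (simp add: val_sum_right sum_distrib_right sum_distrib_left sum_negf algebra_simps)
      then show ?thesis
        by (simp add: Im_sum Im_of_real_mult mult.assoc if_distrib del: times_complex.sel of_real_mult cong: if_cong)
    qed
    also have "\<dots> \<ge> 0"
      using 1 2 e less.prems(5)
      by (intro add_nonneg_nonneg sum_nonneg mult_nonneg_nonneg) (auto intro!: mult_nonpos_nonneg)
    finally show ?thesis .
  qed
  ultimately show ?case ..
qed

lemma star_minus [simp]: "star q (- p) r = - star q p r" "star q p (- r) = - star q p r"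
  by (rule poly_eqI; simp)+

lemma coeff_rp_0 [simp]: "coeff (rp 0 \<xi> I) 0 = 1"
  by (simp add: rp_def poly_0_coeff_0[symmetric] poly_prod)

text \<open>Convolving with z^k (1 + z) isolates three consecutive weighted coefficients. At the
  point i the first half-plane inequality has imaginary part f_k f_(k+2) - f_(k+1)^2, which is
  Newton's inequality.\<close>

lemma star_rp_newton:
  assumes q: "0 < q" "q \<le> 1" and I: "finite I" "psep q \<xi> I"
  shows "(cw q k * coeff (rp m \<xi> I) k) * (cw q (k + 2) * coeff (rp m \<xi> I) (k + 2))
    \<le> (cw q (Suc k) * coeff (rp m \<xi> I) (Suc k))\<^sup>2"
proof -
  define f where "f = (\<lambda>k. cw q k * coeff (rp m \<xi> I) k)"
  let ?K = "rp k (\<lambda>_. -1) {()}"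
  have K: "?K = monom 1 k + monom 1 (Suc k)"
    by (simp add: rp_def monom_Suc algebra_simps)
  have 1: "star q (rp m \<xi> I) ?K = monom (f k) k + monom (f (Suc k)) (Suc k)"
    by (rule poly_eqI) (auto simp: K f_def)
  have 2: "star q (pd q (rp m \<xi> I)) ?K = monom (f (Suc k)) k + monom (f (Suc (Suc k))) (Suc k)"
    by (rule poly_eqI) (auto simp: K f_def cw_Suc)
  have "Im (val q \<i> (pd q (rp m \<xi> I)) ?K * cnj (val q \<i> (rp m \<xi> I) ?K)) \<le> 0"
    using val_pd_Im[OF q, of \<i> I "{()}" \<xi> "\<lambda>_. -1" m k] I by (auto simp: psep_def)
  also have "val q \<i> (pd q (rp m \<xi> I)) ?K = \<i> ^ k * (f (Suc k) + \<i> * f (Suc (Suc k)))"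
    by (simp add: 2 algebra_simps)
  also have "val q \<i> (rp m \<xi> I) ?K = \<i> ^ k * (f k + \<i> * f (Suc k))"
    by (simp add: 1 algebra_simps)
  also have "\<i> ^ k * (f (Suc k) + \<i> * f (Suc (Suc k))) * cnj (\<i> ^ k * (f k + \<i> * f (Suc k)))
     = (\<i> ^ k * cnj (\<i> ^ k)) * ((f (Suc k) + \<i> * f (Suc (Suc k))) * cnj (f k + \<i> * f (Suc k)))"
    by (simp add: algebra_simps)
  also have "\<i> ^ k * cnj (\<i> ^ k) = 1"
    unfolding complex_norm_square[symmetric] by (simp add: norm_power)
  finally show ?thesis
    by (simp add: f_def power2_eq_square algebra_simps)
qed

text \<open>Where H(z) is not 0 this says, for 0 < q < 1, that \<open>pd q H / H\<close> maps z into
  the closed lower half-plane. The lower bound by the squared norm, rather than by 0, yields strict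
  inequalities once H has no non-real zeros.\<close>

definition shrinks :: "real \<Rightarrow> real poly \<Rightarrow> bool" where
  "shrinks q H \<longleftrightarrow>
    (\<forall>z. Im z > 0 \<longrightarrow> Im (z * ev z H * cnj (ev (z / of_real q) H)) \<ge> Im z * (norm (ev z H))\<^sup>2)"

lemma ev_star_divide_q:
  assumes q: "0 < q" "q < 1"
  shows "ev (z / of_real q) (star q L K) = val q z L K + val q z L (pCons 0 (pd q K)) / of_real q"
proof -
  have deg: "degree (star q L M) \<le> degree L" for M
    by (rule degree_le) (auto simp: coeff_eq_0)
  have "ev (z / of_real q) (star q L K) =
      (\<Sum>k\<le>degree L. of_real (coeff (star q L K) k * (1 / q) ^ k) * z ^ k)"
    by (subst ev_altdef[OF deg]) (simp add: power_divide mult_ac)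
  also have "\<dots> = (\<Sum>k\<le>degree L. of_real (coeff (star q L K) k) * z ^ k +
      of_real (coeff (star q L (pCons 0 (pd q K))) k) * z ^ k / of_real q)"
  proof (intro sum.cong refl)
    fix k
    have "(1 / q) ^ k = 1 + wt q k / q"
      using q by (simp add: wt_closed)
    moreover have "coeff (star q L (pCons 0 (pd q K))) k = coeff (star q L K) k * wt q k"
      by (cases k) auto
    ultimately show "of_real (coeff (star q L K) k * (1 / q) ^ k) * z ^ k =
      of_real (coeff (star q L K) k) * z ^ k +
      of_real (coeff (star q L (pCons 0 (pd q K))) k) * z ^ k / of_real q"
      by (simp add: algebra_simps del: coeff_star)
  qed
  also have "\<dots> = val q z L K + val q z L (pCons 0 (pd q K)) / of_real q"
    by (simp only: ev_altdef[OF deg] sum.distrib sum_divide_distrib)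
  finally show ?thesis .
qed

text \<open>By \<open>ev_star_divide_q\<close>, H(z/q) is H(z) plus 1/q times the convolution X of L
  with z \<open>pd q\<close> K. The summand H(z) accounts exactly for the lower bound in
  \<open>shrinks\<close>; what is left is the sign of Im (z H cnj X), obtained by expanding
  \<open>pd q\<close> K and moving z over to L.\<close>

theorem shrinks_star:
  assumes q: "0 < q" "q < 1" and IJ: "finite I" "finite J" "psep q \<xi> I" "psep q \<eta> J"
    and neg: "\<And>j. j \<in> J \<Longrightarrow> \<eta> j \<le> 0"
  shows "shrinks q (star q (rp m \<xi> I) (rp l \<eta> J))"
  unfolding shrinks_def
proof (intro allI impI)
  fix z :: complex assume z: "Im z > 0"
  let ?L = "rp m \<xi> I" and ?K = "rp l \<eta> J"
  let ?H = "val q z ?L ?K"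
  obtain e0 e where e: "e0 \<ge> 0" "\<And>i. i \<in> J \<Longrightarrow> e i \<ge> 0"
    "pd q ?K = (if l = 0 then 0 else smult e0 (rp (l - 1) \<eta> J)) -
        (\<Sum>i\<in>J. smult (e i * \<eta> i) (rp l \<eta> (J - {i})))"
    using pd_rp[of q J \<eta> l] q IJ by auto
  define X where "X = val q z ?L (pCons 0 (pd q ?K))"
  have X: "X = (if l = 0 then 0 else of_real e0 * ?H) +
      (\<Sum>i\<in>J. of_real (e i * - \<eta> i) * (z * val q z (pd q ?L) (rp l \<eta> (J - {i}))))"
  proof -
    have "pCons 0 (pd q ?K) = (if l = 0 then 0 else smult e0 (pCons 0 (rp (l - 1) \<eta> J))) +
        (\<Sum>i\<in>J. smult (e i * - \<eta> i) (pCons 0 (rp l \<eta> (J - {i}))))"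
      unfolding e(3) by (rule poly_eqI) (auto simp: coeff_pCons coeff_sum sum_negf split: nat.splits)
    also have "(if l = 0 then 0 else smult e0 (pCons 0 (rp (l - 1) \<eta> J))) =
        (if l = 0 then 0 else smult e0 ?K)"
      by (auto simp: rp_Suc[symmetric] simp del: smult_pCons)
    finally show ?thesis
      unfolding X_def by (simp add: val_sum_right val_pCons_right del: smult_pCons)
  qed
  \<comment> \<open>Both contributions have the right sign: the first half-plane inequality for K
    without its factor i, and the squared term because \<open>\<eta> i \<le> 0\<close>.\<close>
  have pos: "Im (z * ?H * cnj (z * val q z (pd q ?L) (rp l \<eta> (J - {i})))) \<ge> 0" if i: "i \<in> J" for i
  proof -
    let ?M = "rp l \<eta> (J - {i})"
    let ?B = "val q z (pd q ?L) ?M" and ?A = "val q z ?L ?M"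
    have *: "Im (?B * cnj ?A) \<le> 0"
      using val_pd_Im[of q z I "J - {i}" \<xi> \<eta> m l] q IJ z neg psep_subset[of q \<eta> J "J - {i}"] by auto
    have H: "?H = ?A - of_real (\<eta> i) * (z * ?B)"
      by (subst rp_remove[OF IJ(2) i]) (simp add: val_pCons_right)
    have gen: "Im (z * (a - of_real t * (z * b)) * cnj (z * b)) =
        (norm z)\<^sup>2 * (- Im (b * cnj a) - t * (Im z * (norm b)\<^sup>2))" for a b t
      unfolding cmod_power2 by (simp add: algebra_simps power2_eq_square)
    have "\<eta> i * (Im z * (norm ?B)\<^sup>2) \<le> 0"
      using neg[OF i] z by (intro mult_nonpos_nonneg) auto
    with * have "0 \<le> (norm z)\<^sup>2 * (- Im (?B * cnj ?A) - \<eta> i * (Im z * (norm ?B)\<^sup>2))"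
      by (intro mult_nonneg_nonneg) (simp, linarith)
    then show ?thesis unfolding H gen .
  qed
  have "Im (z * ?H * cnj X) = (if l = 0 then 0 else e0 * Im (z * ?H * cnj ?H)) +
      (\<Sum>i\<in>J. (e i * - \<eta> i) * Im (z * ?H * cnj (z * val q z (pd q ?L) (rp l \<eta> (J - {i})))))"
  proof -
    have "z * ?H * cnj X = (if l = 0 then 0 else of_real e0 * (z * ?H * cnj ?H)) +
      (\<Sum>i\<in>J. of_real (e i * - \<eta> i) * (z * ?H * cnj (z * val q z (pd q ?L) (rp l \<eta> (J - {i})))))"
      unfolding X by (simp add: sum_distrib_left algebra_simps sum_negf)
    then show ?thesis
      by (simp only: plus_complex.sel Im_sum Im_of_real_mult if_distrib[of Im] zero_complex.sel)
  qed
  also have "\<dots> \<ge> 0"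
  proof -
    have "Im (z * ?H * cnj ?H) \<ge> 0" using z unfolding Im_z_mult_cnj by simp
    then have "(if l = 0 then 0 else e0 * Im (z * ?H * cnj ?H)) \<ge> 0"
      using e(1) by (simp del: times_complex.sel)
    moreover have "(\<Sum>i\<in>J. (e i * - \<eta> i) * Im (z * ?H * cnj (z * val q z (pd q ?L) (rp l \<eta> (J - {i}))))) \<ge> 0"
      by (intro sum_nonneg mult_nonneg_nonneg pos e(2)) (use neg in auto)
    ultimately show ?thesis by linarith
  qed
  finally have "Im (z * ?H * cnj X) \<ge> 0" .
  moreover have "Im (z * ?H * cnj (ev (z / of_real q) (star q ?L ?K))) =
      Im z * (norm ?H)\<^sup>2 + Im (z * ?H * cnj X) / q"
  proof -
    have "z * ?H * cnj (?H + X / of_real q) = z * ?H * cnj ?H + of_real (1 / q) * (z * ?H * cnj X)"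
      using q by (simp add: field_simps)
    then show ?thesis
      unfolding ev_star_divide_q[OF q] X_def[symmetric]
      by (simp only: plus_complex.sel Im_of_real_mult Im_z_mult_cnj) simp
  qed
  ultimately show "Im (z * ?H * cnj (ev (z / of_real q) (star q ?L ?K))) \<ge> Im z * (norm ?H)\<^sup>2"
    using q by simp
qed

text \<open>Each further negative zero of K adds the strictly positive Im z |A|^2 to a non-negative
  term, starting from the convolution with 1. Constant terms 1 on both sides prevent the convolution
  from vanishing identically. At q = 1, where \<open>shrinks\<close> is an identity, real zeros come
  from here.\<close>

theorem val_rp_nonzero:
  assumes q: "0 < q" "q \<le> 1" and z: "Im z > 0" and I: "finite I" "psep q \<xi> I"
  shows "finite J \<Longrightarrow> psep q \<eta> J \<Longrightarrow> (\<And>j. j \<in> J \<Longrightarrow> \<eta> j \<le> 0) \<Longrightarrow>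
    val q z (rp 0 \<xi> I) (rp 0 \<eta> J) \<noteq> 0"
proof (induction rule: finite_induct)
  case empty
  have "star q (rp 0 \<xi> I) 1 = 1"
  proof (rule poly_eqI)
    fix n show "coeff (star q (rp 0 \<xi> I) 1) n = coeff 1 n"
      by (cases n) auto
  qed
  then show ?case by simp
next
  case (insert i J)
  have psJ: "psep q \<eta> J" using insert psep_subset[of q \<eta> "insert i J" J] by auto
  then have ne: "val q z (rp 0 \<xi> I) (rp 0 \<eta> J) \<noteq> 0" (is "?A \<noteq> 0")
    using insert by auto
  let ?B = "val q z (pd q (rp 0 \<xi> I)) (rp 0 \<eta> J)"
  have "Im (?B * cnj ?A) \<le> 0"
    using val_pd_Im[of q z I J \<xi> \<eta> 0 0] q I z insert psJ by auto
  then have "\<eta> i * ((norm z)\<^sup>2 * Im (?B * cnj ?A)) \<ge> 0"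
    using insert.prems by (intro mult_nonpos_nonpos mult_nonneg_nonpos) auto
  moreover have "Im z * (norm ?A)\<^sup>2 > 0" using z ne by simp
  ultimately have "Im (z * ?A * cnj (?A - of_real (\<eta> i) * (z * ?B))) > 0"
    unfolding Im_z_mult_cnj_diff by linarith
  moreover have "val q z (rp 0 \<xi> I) (rp 0 \<eta> (insert i J)) = ?A - of_real (\<eta> i) * (z * ?B)"
    using insert by (simp add: rp_insert val_pCons_right)
  ultimately show ?case
    by (metis complex_cnj_zero less_irrefl mult_zero_right zero_complex.sel(2))
qed

subsection \<open>Reality and separation of the zeros\<close>

definition real_rooted :: "real poly \<Rightarrow> bool" where
  "real_rooted P \<longleftrightarrow> (\<forall>z. Im z > 0 \<longrightarrow> ev z P \<noteq> 0)"

lemma real_rooted_imp_real: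
  assumes "real_rooted P" "ev z P = 0" shows "Im z = 0"
proof (rule ccontr)
  assume "Im z \<noteq> 0"
  then consider "Im z > 0" | "Im (cnj z) > 0" by (auto simp: neq_iff)
  then show False
    using assms by (cases) (metis ev_cnj complex_cnj_zero real_rooted_def)+
qed

lemma shrinks_imp_real_rooted:
  assumes q: "0 < q" "q < 1" and H: "shrinks q H" "H \<noteq> 0"
  shows "real_rooted H"
proof (rule ccontr)
  define S where "S = {z. ev z H = 0 \<and> Im z > 0}"
  assume "\<not> real_rooted H"
  then have S: "S \<noteq> {}" by (auto simp: real_rooted_def S_def)
  have fin: "finite S"
    using finite_ev_roots[OF H(2)] by (rule finite_subset[rotated]) (auto simp: S_def)
  \<comment> \<open>With z0 of largest modulus among the zeros in the upper half-plane, z0 / q lies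
    further out and is no zero, so that z H(z) / H(z/q) is holomorphic near z0 and vanishes
    there.\<close>
  obtain z0 where z0: "z0 \<in> S" "\<And>z. z \<in> S \<Longrightarrow> norm z \<le> norm z0"
    using ex_is_arg_min_if_finite[OF fin S, of "\<lambda>z. - norm z"]
    by (auto simp: is_arg_min_linorder)
  have "z0 \<noteq> 0" using z0(1) by (auto simp: S_def)
  have "z0 / of_real q \<notin> S"
  proof
    assume "z0 / of_real q \<in> S"
    then have "norm z0 / q \<le> norm z0" using z0(2)[of "z0 / of_real q"] q by (simp add: norm_divide)
    then show False using q \<open>z0 \<noteq> 0\<close> by (simp add: field_simps)
  qed
  then have "ev (z0 / of_real q) H \<noteq> 0"
    using z0(1) q by (auto simp: S_def)
  define U where "U = {z. Im z > 0} \<inter> {z. ev (z / of_real q) H \<noteq> 0}"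
  have "open U" unfolding U_def
  proof (intro open_Int open_halfspace_Im_gt)
    have "continuous_on UNIV (\<lambda>z. ev (z / of_real q) H)"
      using q by (intro continuous_intros) auto
    then show "open {z. ev (z / of_real q) H \<noteq> 0}"
      using open_Collect_neq[of "\<lambda>z. ev (z / of_real q) H" "\<lambda>_. 0"] by simp
  qed
  moreover have "z0 \<in> U" using z0(1) \<open>ev (z0 / of_real q) H \<noteq> 0\<close> by (auto simp: U_def S_def)
  ultimately obtain r where r: "r > 0" "ball z0 r \<subseteq> U" by (auto simp: open_contains_ball)
  define V where "V = (\<lambda>z. z * ev z H / ev (z / of_real q) H)"
  have holo: "V holomorphic_on ball z0 r"
    unfolding V_def using r(2) q by (intro holomorphic_intros) (auto simp: U_def)
  have "\<not> V constant_on ball z0 r"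
  proof
    assume "V constant_on ball z0 r"
    then obtain c where c: "\<And>z. z \<in> ball z0 r \<Longrightarrow> V z = c" by (auto simp: constant_on_def)
    moreover have "V z0 = 0" using z0(1) by (simp add: V_def S_def)
    ultimately have "c = 0" using r(1) by (metis centre_in_ball)
    then have "ball z0 r \<subseteq> {z. ev z H = 0}"
      using c r(2) by (fastforce simp: V_def U_def)
    then have "finite (ball z0 r)" using finite_ev_roots[OF H(2)] finite_subset by blast
    then show False using uncountable_ball[OF r(1), of z0] countable_finite by blast
  qed
  then have "open (V ` ball z0 r)"
    using open_mapping_thm[OF holo] by auto
  moreover have "0 \<in> V ` ball z0 r"
    using z0(1) r(1) by (intro image_eqI[of _ _ z0]) (auto simp: V_def S_def)
  ultimately obtain e where e: "e > 0" "ball 0 e \<subseteq> V ` ball z0 r"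
    by (auto simp: open_contains_ball)
  have "- \<i> * of_real (e / 2) \<in> ball 0 e" using e by (simp add: norm_mult)
  then obtain z where z: "z \<in> ball z0 r" "V z = - \<i> * of_real (e / 2)" using e by fastforce
  then have zU: "z \<in> U" using r by auto
  let ?d = "ev (z / of_real q) H"
  have "z * ev z H = V z * ?d" using zU by (simp add: V_def U_def)
  then have "z * ev z H * cnj ?d = V z * (?d * cnj ?d)" by simp
  then have "Im (z * ev z H * cnj ?d) = Im (V z * of_real ((norm ?d)\<^sup>2))"
    by (simp add: complex_norm_square[symmetric])
  also have "\<dots> = - (e / 2) * (norm ?d)\<^sup>2" by (simp add: z)
  also have "\<dots> < 0" using e zU by (simp add: U_def)
  finally show False
    using H(1) zU unfolding shrinks_def U_def
    by (smt (verit) mem_Collect_eq Int_iff mult_nonneg_nonneg zero_le_power2)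
qed

text \<open>The continuous argument of \<open>z P(z) / P(z / q)\<close> starts at \<open>Arg z\<close> and stays strictly between
  \<open>0\<close> and \<open>\<pi>\<close>; approaching a real point it counts the zeros in an interval of ratio \<open>q\<close>.\<close>

lemma arg_count_bounds:
  fixes \<xi> :: "nat \<Rightarrow> real"
  assumes pos: "\<And>z. Im z > 0 \<Longrightarrow> Im (z * (\<Prod>i<n. 1 - of_real (\<xi> i) * z) *
      cnj (\<Prod>i<n. 1 - of_real (\<xi> i / q) * z)) > 0"
    and z: "Im z > 0"
  shows "Arg z + (\<Sum>i<n. Arg (1 - of_real (\<xi> i) * z) - Arg (1 - of_real (\<xi> i / q) * z)) < pi"
proof -
  define \<phi> where "\<phi> = (\<lambda>t. Arg z + (\<Sum>i<n. Arg (1 - of_real (\<xi> i) * (of_real t * z)) -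
      Arg (1 - of_real (\<xi> i / q) * (of_real t * z))))"
  \<comment> \<open>On the segment from 0 to z each factor is either 1 or non-real. Hence the
    principal \<open>Arg\<close> is continuous along it and no branch has to be followed.\<close>
  have off: "1 - of_real x * (of_real t * z) \<notin> \<real>\<^sub>\<le>\<^sub>0" for x t :: real
  proof
    assume *: "1 - of_real x * (of_real t * z) \<in> \<real>\<^sub>\<le>\<^sub>0"
    then have "Im (1 - of_real x * (of_real t * z)) = 0" by (auto simp: complex_nonpos_Reals_iff)
    then have "x * t = 0" using z by simp
    then have "of_real x * (of_real t * z) = 0" by auto
    with * show False by simp
  qed
  have sin_pos: "sin (\<phi> t) > 0" if t: "t > 0" for t
  proof -
    let ?w = "of_real t * z"
    have w: "Im ?w > 0" using z t by simp
    have argw: "Arg ?w = Arg z" using t by (simp add: Arg_times_of_real)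
    have polar: "a = of_real (norm a) * cis (Arg a)" for a
      using cis_conv_exp[of "Arg a"] Arg_eq[of a] by (cases "a = 0") auto
    let ?R = "norm ?w * (\<Prod>i<n. norm (1 - of_real (\<xi> i) * ?w)) * (\<Prod>i<n. norm (1 - of_real (\<xi> i / q) * ?w))"
    have P: "(\<Prod>i<n. f i) = of_real (\<Prod>i<n. norm (f i)) * cis (\<Sum>i<n. Arg (f i))" for f
    proof (induction n)
      case (Suc n)
      show ?case
        using polar[of "f n"] by (simp add: Suc cis_mult[symmetric] mult_ac)
    qed simp
    define s1 where "s1 = (\<Sum>i<n. Arg (1 - of_real (\<xi> i) * ?w))"
    define s2 where "s2 = (\<Sum>i<n. Arg (1 - of_real (\<xi> i / q) * ?w))"
    have gen: "(of_real a * cis x) * (of_real b * cis y) * cnj (of_real c * cis y') =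
        of_real (a * b * c) * cis (x + (y - y'))" for a b c x y y'
    proof -
      have "cis (x + (y - y')) = cis x * cis y * cis (- y')" by (simp add: cis_mult algebra_simps)
      then show ?thesis by (simp add: cis_cnj)
    qed
    have "?w * (\<Prod>i<n. 1 - of_real (\<xi> i) * ?w) * cnj (\<Prod>i<n. 1 - of_real (\<xi> i / q) * ?w) =
      of_real (norm ?w) * cis (Arg z) * (of_real (\<Prod>i<n. norm (1 - of_real (\<xi> i) * ?w)) * cis s1) *
        cnj (of_real (\<Prod>i<n. norm (1 - of_real (\<xi> i / q) * ?w)) * cis s2)"
      using P[of "\<lambda>i. 1 - of_real (\<xi> i) * ?w"] P[of "\<lambda>i. 1 - of_real (\<xi> i / q) * ?w"]
        polar[of ?w] unfolding argw s1_def s2_def by metis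
    also have "\<dots> = of_real ?R * cis (Arg z + (s1 - s2))"
      by (rule gen)
    also have "Arg z + (s1 - s2) = \<phi> t"
      by (simp add: \<phi>_def s1_def s2_def sum_subtractf)
    finally have "?w * (\<Prod>i<n. 1 - of_real (\<xi> i) * ?w) * cnj (\<Prod>i<n. 1 - of_real (\<xi> i / q) * ?w) =
      of_real ?R * cis (\<phi> t)" .
    then have "?R * sin (\<phi> t) > 0"
      using pos[OF w] by (simp only: Im_of_real_mult cis.sel)
    moreover have "?R \<ge> 0" by (intro mult_nonneg_nonneg prod_nonneg) auto
    ultimately show ?thesis by (simp add: zero_less_mult_iff)
  qed
  have cont: "continuous_on {0..1} \<phi>"
    unfolding \<phi>_def by (intro continuous_intros off)
  have 0: "0 < \<phi> 0" "\<phi> 0 < pi" using z Arg_lt_pi[of z] by (auto simp: \<phi>_def)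
  have "\<phi> 1 < pi"
  proof (rule ccontr)
    assume "\<not> \<phi> 1 < pi"
    then obtain t where "0 \<le> t" "t \<le> 1" "\<phi> t = pi"
      using IVT'[of \<phi> 0 pi 1] cont 0 by auto
    moreover have "t \<noteq> 0" using 0 calculation by auto
    ultimately show False using sin_pos[of t] by simp
  qed
  then show ?thesis by (simp add: \<phi>_def)
qed

text \<open>If two positive reciprocal zeros violate separation, some real point sees both of them
  on one side and both of their multiples by 1/q on the other. Each pair then contributes a jump of
  \<open>pi\<close> to the total argument, which must stay below \<open>pi\<close>.\<close>

lemma arg_count_pos:
  fixes \<xi> :: "nat \<Rightarrow> real"
  assumes q: "0 < q" "q < 1"
    and pos: "\<And>z. Im z > 0 \<Longrightarrow> Im (z * (\<Prod>i<n. 1 - of_real (\<xi> i) * z) *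
      cnj (\<Prod>i<n. 1 - of_real (\<xi> i / q) * z)) > 0"
    and ij: "i < n" "j < n" "i \<noteq> j" "\<xi> i > 0" "\<xi> j > 0" "q * \<xi> i < \<xi> j" "q * \<xi> j < \<xi> i"
  shows False
proof -
  \<comment> \<open>The interval from \<open>?A\<close> to \<open>?B\<close> is non-empty precisely
    because separation fails in both directions. Choosing y in it outside a finite set keeps every
    factor away from 0 at x = 1 / y.\<close>
  let ?A = "max (\<xi> i) (\<xi> j)" and ?B = "min (\<xi> i) (\<xi> j) / q"
  have "q * \<xi> i < \<xi> i" "q * \<xi> j < \<xi> j" using q ij by simp_all
  then have "?A < ?B" using q ij by (auto simp: field_simps max_def min_def)
  then have "infinite {?A<..<?B}" by simp
  then have "infinite ({?A<..<?B} - (\<xi> ` {..<n} \<union> (\<lambda>k. \<xi> k / q) ` {..<n}))"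
    by (intro Diff_infinite_finite) auto
  then obtain y where "y \<in> {?A<..<?B} - (\<xi> ` {..<n} \<union> (\<lambda>k. \<xi> k / q) ` {..<n})"
    by (metis finite.emptyI equals0I)
  then have y: "?A < y" "y < ?B" "\<And>k. k < n \<Longrightarrow> \<xi> k \<noteq> y \<and> \<xi> k / q \<noteq> y"
    by auto
  have "y > 0" using y(1) ij by auto
  define x where "x = 1 / y"
  have x: "x > 0" using \<open>y > 0\<close> by (simp add: x_def)
  \<comment> \<open>The boundary value of the argument of 1 - c z as z tends to x = 1 / y from
    above: the factor tends to a negative number from below exactly if c > y.\<close>
  define l where "l = (\<lambda>c. if c > y then - pi else 0)"
  have Re1: "1 - c * x < 0 \<longleftrightarrow> c > y" "1 - c * x = 0 \<longleftrightarrow> c = y" for c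
    using \<open>y > 0\<close> by (auto simp: x_def field_simps)
  define Z where "Z = (\<lambda>e::real. of_real x + \<i> * of_real e)"
  have "((\<lambda>e::real. of_real x + \<i> * of_real e) \<longlongrightarrow> of_real x + \<i> * of_real 0) (at_right 0)"
    by (intro tendsto_intros)
  then have Z: "(Z \<longlongrightarrow> of_real x) (at_right 0)"
    by (simp only: Z_def of_real_0 mult_zero_right add_0_right)
  have lim: "((\<lambda>e. Arg (1 - of_real c * Z e)) \<longlongrightarrow> l c) (at_right 0)" if c: "c \<noteq> y" for c
  proof (cases "c > y")
    case False
    then have "1 - c * x > 0" using Re1 c by (metis linorder_neqE_linordered_idom)
    then have *: "1 - of_real c * of_real x \<notin> (\<real>\<^sub>\<le>\<^sub>0 :: complex set)" "Arg (1 - of_real c * of_real x) = 0"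
      using nonpos_Reals_of_real_iff[of "1 - c * x", where ?'a = complex] Arg_of_real[of "1 - c * x"] by simp_all
    have "((\<lambda>e. Arg (1 - of_real c * Z e)) \<longlongrightarrow> Arg (1 - of_real c * of_real x)) (at_right 0)"
      by (intro isCont_tendsto_compose[OF continuous_at_Arg] tendsto_intros Z *)
    then show ?thesis using False * by (simp add: l_def)
  next
    case True
    then have "c * x - 1 > 0" using Re1(1)[of c] by simp
    then have *: "of_real c * of_real x - 1 \<notin> (\<real>\<^sub>\<le>\<^sub>0 :: complex set)" "Arg (of_real c * of_real x - 1) = 0"
      using nonpos_Reals_of_real_iff[of "c * x - 1", where ?'a = complex] Arg_of_real[of "c * x - 1"] by simp_all
    have "((\<lambda>e. Arg (of_real c * Z e - 1) - pi) \<longlongrightarrow> Arg (of_real c * of_real x - 1) - pi) (at_right 0)"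
      by (intro tendsto_diff isCont_tendsto_compose[OF continuous_at_Arg] tendsto_intros Z *)
    moreover have "\<forall>\<^sub>F e in at_right 0. Arg (of_real c * Z e - 1) - pi = Arg (1 - of_real c * Z e)"
      using eventually_at_right_less
    proof eventually_elim
      case (elim e)
      have "Im (of_real c * Z e - 1) > 0" using True \<open>y > 0\<close> elim by (simp add: Z_def)
      then have "Arg (of_real c * Z e - 1) > 0" "of_real c * Z e - 1 \<noteq> 0"
        by (metis Arg_lt_pi, metis less_irrefl zero_complex.sel(2))
      then show ?case using Arg_minus[of "of_real c * Z e - 1"] by simp
    qed
    ultimately show ?thesis using True * by (simp add: l_def tendsto_cong)
  qed
  have limA: "((\<lambda>e. Arg (Z e)) \<longlongrightarrow> 0) (at_right 0)"
  proof -
    have "((\<lambda>e. Arg (Z e)) \<longlongrightarrow> Arg (of_real x)) (at_right 0)"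
      using x by (intro isCont_tendsto_compose[OF continuous_at_Arg] Z) auto
    then show ?thesis using x by simp
  qed
  let ?\<Theta> = "\<lambda>z. Arg z + (\<Sum>k<n. Arg (1 - of_real (\<xi> k) * z) - Arg (1 - of_real (\<xi> k / q) * z))"
  have "((\<lambda>e. ?\<Theta> (Z e)) \<longlongrightarrow> 0 + (\<Sum>k<n. l (\<xi> k) - l (\<xi> k / q))) (at_right 0)"
    using y(3) by (intro tendsto_add limA tendsto_sum tendsto_diff lim) auto
  moreover have "\<forall>\<^sub>F e in at_right 0. ?\<Theta> (Z e) \<le> pi"
    using eventually_at_right_less
  proof eventually_elim
    case (elim e)
    then have "Im (Z e) > 0" by (simp add: Z_def)
    from arg_count_bounds[OF pos this] show ?case by simp
  qed
  ultimately have "0 + (\<Sum>k<n. l (\<xi> k) - l (\<xi> k / q)) \<le> pi"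
    by (rule tendsto_upperbound) simp
  \<comment> \<open>Since \<open>\<xi> k > y\<close> forces \<open>\<xi> k / q > y\<close>, no term
    of the sum is negative and two terms suffice for the contradiction.\<close>
  moreover have "(\<Sum>k\<in>{i, j}. l (\<xi> k) - l (\<xi> k / q)) \<le> (\<Sum>k<n. l (\<xi> k) - l (\<xi> k / q))"
  proof (intro sum_mono2)
    fix k
    show "0 \<le> l (\<xi> k) - l (\<xi> k / q)"
    proof (cases "\<xi> k > y")
      case True
      then have "\<xi> k * q < \<xi> k * 1" using q \<open>y > 0\<close> by (intro mult_strict_left_mono) auto
      then have "\<xi> k / q > \<xi> k" using q by (simp add: field_simps)
      then show ?thesis using True by (auto simp: l_def)
    qed (auto simp: l_def)
  qed (use ij in auto)
  moreover have "l (\<xi> i) - l (\<xi> i / q) = pi" "l (\<xi> j) - l (\<xi> j / q) = pi"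
    using y(1,2) q by (auto simp: l_def field_simps)
  ultimately show False using ij(3) pi_gt_zero by simp
qed

lemma arg_count_sep:
  fixes \<xi> :: "nat \<Rightarrow> real"
  assumes q: "0 < q" "q < 1"
    and pos: "\<And>z. Im z > 0 \<Longrightarrow> Im (z * (\<Prod>i<n. 1 - of_real (\<xi> i) * z) *
      cnj (\<Prod>i<n. 1 - of_real (\<xi> i / q) * z)) > 0"
    and ij: "i < n" "j < n" "i \<noteq> j"
  shows "sep q (\<xi> i) (\<xi> j)"
proof (rule ccontr)
  assume "\<not> sep q (\<xi> i) (\<xi> j)"
  then have *: "\<xi> i * \<xi> j > 0" "q * \<bar>\<xi> i\<bar> < \<bar>\<xi> j\<bar>" "q * \<bar>\<xi> j\<bar> < \<bar>\<xi> i\<bar>"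
    by (auto simp: sep_def not_le)
  then consider "\<xi> i > 0" "\<xi> j > 0" | "\<xi> i < 0" "\<xi> j < 0" by (auto simp: zero_less_mult_iff)
  then show False
  proof cases
    case 1
    then show ?thesis using arg_count_pos[OF q pos ij] * by auto
  next
    case 2
    have "Im (z * (\<Prod>i<n. 1 - of_real (- \<xi> i) * z) * cnj (\<Prod>i<n. 1 - of_real (- \<xi> i / q) * z)) > 0"
      if z: "Im z > 0" for z
    proof -
      \<comment> \<open>This reflection preserves the upper half-plane and changes the sign of every
        \<open>\<xi> i\<close>, so negative pairs reduce to positive ones.\<close>
      let ?z = "- cnj z"
      have c: "(\<Prod>i<n. 1 - of_real (f i) * ?z) = cnj (\<Prod>i<n. 1 - of_real (- f i) * z)" for f :: "nat \<Rightarrow> real"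
        by (simp add: cnj_prod)
      have "0 < Im (?z * cnj (\<Prod>i<n. 1 - of_real (- \<xi> i) * z) * cnj (cnj (\<Prod>i<n. 1 - of_real (- (\<xi> i / q)) * z)))"
        using pos[of ?z] z unfolding c by simp
      moreover have "Im (- cnj a * cnj b * cnj (cnj d)) = Im (a * b * cnj d)" for a b d
        by (simp add: algebra_simps)
      ultimately show ?thesis by (simp only: minus_divide_left)
    qed
    from arg_count_pos[OF q, where \<xi> = "\<lambda>i. - \<xi> i", OF this ij] show ?thesis using 2 * by auto
  qed
qed

text \<open>Sorting by decreasing modulus puts the absent zeros, coded by 0, last. The order turns
  separation into geometric decay at a rate depending on q alone, and the condition survives
  pointwise limits.\<close>

definition canon :: "real \<Rightarrow> (nat \<Rightarrow> real) \<Rightarrow> bool" where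
  "canon q \<xi> \<longleftrightarrow> (\<forall>i j. i < j \<longrightarrow> \<bar>\<xi> j\<bar> \<le> \<bar>\<xi> i\<bar> \<and> (\<xi> i * \<xi> j \<le> 0 \<or> \<bar>\<xi> j\<bar> \<le> q * \<bar>\<xi> i\<bar>))"

lemma canon_psep: "canon q \<xi> \<Longrightarrow> psep q \<xi> I"
  unfolding psep_def sep_def canon_def by (metis linorder_neqE_nat mult.commute)

definition sep_poly :: "real \<Rightarrow> real poly \<Rightarrow> bool" where
  "sep_poly q P \<longleftrightarrow> (\<exists>c m n \<xi>. P = smult c (rp m \<xi> {..<n}) \<and> canon q \<xi> \<and> (\<forall>i\<ge>n. \<xi> i = 0))"

section \<open>Factorisation of real-rooted polynomials and the step from \<open>shrinks\<close> to
  separated zeros\<close>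

lemma ev_linear_factor: "ev z [:1, - x:] = 1 - of_real x * z"
  by (simp add: algebra_simps)

lemma ev_rp: "ev z (rp m \<xi> I) = z ^ m * (\<Prod>i\<in>I. 1 - of_real (\<xi> i) * z)"
  unfolding rp_def ev_mult ev_monom ev_prod ev_linear_factor by simp

lemma rp_cong: "(\<And>i. i \<in> I \<Longrightarrow> \<xi> i = \<xi>' i) \<Longrightarrow> rp m \<xi> I = rp m \<xi>' I"
  by (simp add: rp_def)

lemma rp_nth: "rp m (\<lambda>i. xs ! i) {..<length xs} = monom 1 m * (\<Prod>x\<leftarrow>xs. [:1, - x:])"
  by (simp add: rp_def prod.list_conv_set_nth atLeast0LessThan)

lemma real_rooted_factor_list:
  "P \<noteq> 0 \<Longrightarrow> real_rooted P \<Longrightarrow>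
    \<exists>c m xs. c \<noteq> 0 \<and> P = smult c (monom 1 m * (\<Prod>x\<leftarrow>xs. [:1, - x:])) \<and> 0 \<notin> set xs"
proof (induction "degree P" arbitrary: P)
  case 0
  then obtain c where "P = [:c:]" by (metis degree_eq_zeroE)
  then show ?case using 0 by (intro exI[of _ c] exI[of _ 0] exI[of _ "[]"]) auto
next
  case (Suc n)
  have "degree (map_poly of_real P :: complex poly) = Suc n"
    using Suc by (simp add: degree_map_poly)
  then obtain z where z: "ev z P = 0"
    using alg_closed_imp_poly_has_root[of "map_poly of_real P :: complex poly"]
    unfolding ev_def by auto
  then have "Im z = 0" using real_rooted_imp_real Suc.prems by blast
  then obtain x where x: "z = of_real x" by (metis complex_is_Real_iff Reals_cases)
  then have "poly P x = 0" using z by (simp add: ev_of_real)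
  then obtain Q where Q: "P = [:- x, 1:] * Q" by (metis poly_eq_0_iff_dvd dvdE)
  have "Q \<noteq> 0" using Q Suc by auto
  have "degree P = degree [:- x, 1:] + degree Q"
    unfolding Q using \<open>Q \<noteq> 0\<close> by (intro degree_mult_eq) auto
  then have "degree Q = n" using Suc(2) by simp
  moreover have "ev z P = ev z [:- x, 1:] * ev z Q" for z unfolding Q by (rule ev_mult)
  then have "real_rooted Q" using Suc.prems unfolding real_rooted_def by (metis mult_zero_right)
  ultimately obtain c m xs where IH: "c \<noteq> 0" "Q = smult c (monom 1 m * (\<Prod>x\<leftarrow>xs. [:1, - x:]))" "0 \<notin> set xs"
    using Suc.hyps(1)[of Q] \<open>Q \<noteq> 0\<close> by blast
  show ?case
  proof (cases "x = 0")
    case True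
    then have "P = pCons 0 Q" using Q by simp
    then show ?thesis using IH
      by (intro exI[of _ c] exI[of _ "Suc m"] exI[of _ xs]) (simp add: monom_Suc)
  next
    case False
    have "[:- x, 1:] = smult (- x) [:1, - (1 / x):]" using False by simp
    then have "P = smult (- x * c) (monom 1 m * (\<Prod>x\<leftarrow>(1 / x) # xs. [:1, - x:]))"
      unfolding Q IH(2) by (simp only: mult_smult_left mult_smult_right smult_smult list.map prod_list.Cons mult.left_commute mult.commute)
    then show ?thesis using IH False
      by (intro exI[of _ "- x * c"] exI[of _ m] exI[of _ "(1 / x) # xs"]) auto
  qed
qed

lemma real_rooted_factor:
  assumes "P \<noteq> 0" "real_rooted P"
  shows "\<exists>c m (n::nat) \<xi>. c \<noteq> 0 \<and> P = smult c (rp m \<xi> {..<n}) \<and> (\<forall>i<n. \<xi> i \<noteq> 0) \<and>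
    (\<forall>i\<ge>n. \<xi> i = 0) \<and> (\<forall>i j. i < j \<longrightarrow> \<bar>\<xi> j\<bar> \<le> \<bar>\<xi> i\<bar>)"
proof -
  obtain c m xs where xs: "c \<noteq> 0" "P = smult c (monom 1 m * (\<Prod>x\<leftarrow>xs. [:1, - x:]))" "0 \<notin> set xs"
    using real_rooted_factor_list[OF assms] by blast
  define ys where "ys = sort_key (\<lambda>x. - \<bar>x\<bar>) xs"
  define \<xi> where "\<xi> = (\<lambda>i. if i < length ys then ys ! i else 0)"
  have "(\<Prod>x\<leftarrow>xs. [:1, - x:]) = (\<Prod>x\<leftarrow>ys. [:1, - x:])"
    by (metis mset_map mset_sort prod_mset_prod_list ys_def)
  then have P: "P = smult c (rp m (\<lambda>i. ys ! i) {..<length ys})" using xs(2) by (simp only: rp_nth)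
  have "P = smult c (rp m \<xi> {..<length ys})" unfolding P by (subst rp_cong[of _ \<xi>]) (auto simp: \<xi>_def)
  moreover have "\<xi> i \<noteq> 0" if "i < length ys" for i
  proof -
    have "ys ! i \<in> set xs" using nth_mem[OF that] by (simp add: ys_def)
    then have "ys ! i \<noteq> 0" using xs(3) by metis
    then show ?thesis using that by (simp add: \<xi>_def)
  qed
  moreover have "\<bar>\<xi> j\<bar> \<le> \<bar>\<xi> i\<bar>" if "i < j" for i j
  proof (cases "j < length ys")
    case True
    have "sorted (map (\<lambda>x. - \<bar>x\<bar>) ys)" by (simp add: ys_def)
    then show ?thesis using True that sorted_nth_mono[of "map (\<lambda>x. - \<bar>x\<bar>) ys" i j] by (simp add: \<xi>_def)
  qed (auto simp: \<xi>_def)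
  moreover have "\<forall>i\<ge>length ys. \<xi> i = 0" by (simp add: \<xi>_def)
  ultimately show ?thesis using xs(1) by blast
qed

lemma real_rooted_imp_sep_poly_1: "real_rooted P \<Longrightarrow> sep_poly 1 P"
proof (cases "P = 0")
  case True
  then show ?thesis unfolding sep_poly_def canon_def
    by (intro exI[of _ 0] exI[of _ "\<lambda>_. 0"]) auto
next
  case False
  assume "real_rooted P"
  obtain c m and n :: nat and \<xi> where "c \<noteq> 0" "P = smult c (rp m \<xi> {..<n})"
    "\<And>i. i < n \<Longrightarrow> \<xi> i \<noteq> 0" "\<And>i. i \<ge> n \<Longrightarrow> \<xi> i = 0" "\<And>i j. i < j \<Longrightarrow> \<bar>\<xi> j\<bar> \<le> \<bar>\<xi> i\<bar>"
    using real_rooted_factor[OF False \<open>real_rooted P\<close>] by blast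
  then show ?thesis unfolding sep_poly_def canon_def
    by (intro exI[of _ c] exI[of _ m] exI[of _ n] exI[of _ \<xi>]) auto
qed

text \<open>Reality of the zeros is known, so H does not vanish in the upper half-plane and the
  lower bound in \<open>shrinks\<close> is strictly positive. After removal of c z^m this is the
  positivity that the argument count needs.\<close>

theorem shrinks_imp_sep_poly:
  assumes q: "0 < q" "q < 1" and H: "shrinks q H"
  shows "sep_poly q H"
proof (cases "H = 0")
  case True
  then show ?thesis unfolding sep_poly_def canon_def
    by (intro exI[of _ 0] exI[of _ "\<lambda>_. 0"]) auto
next
  case False
  have rr: "real_rooted H" using shrinks_imp_real_rooted q H False by blast
  obtain c m and n :: nat and \<xi> where cn: "c \<noteq> 0" "H = smult c (rp m \<xi> {..<n})" "\<And>i. i < n \<Longrightarrow> \<xi> i \<noteq> 0"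
    "\<And>i. i \<ge> n \<Longrightarrow> \<xi> i = 0" "\<And>i j. i < j \<Longrightarrow> \<bar>\<xi> j\<bar> \<le> \<bar>\<xi> i\<bar>"
    using real_rooted_factor[OF False rr] by blast
  have pos: "Im (z * (\<Prod>i<n. 1 - of_real (\<xi> i) * z) * cnj (\<Prod>i<n. 1 - of_real (\<xi> i / q) * z)) > 0"
    if z: "Im z > 0" for z
  proof -
    let ?P = "\<Prod>i<n. 1 - of_real (\<xi> i) * z" and ?Q = "\<Prod>i<n. 1 - of_real (\<xi> i / q) * z"
    have ez: "ev z H = of_real c * z ^ m * ?P" "ev (z / of_real q) H = of_real c * (z / of_real q) ^ m * ?Q"
      unfolding cn(2) ev_smult ev_rp by simp_all
    have "z * ev z H * cnj (ev (z / of_real q) H) =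
        of_real (c\<^sup>2 / q ^ m) * ((z ^ m * cnj (z ^ m)) * (z * ?P * cnj ?Q))"
      unfolding ez by (simp add: power_divide power2_eq_square)
    also have "z ^ m * cnj (z ^ m) = of_real ((norm (z ^ m))\<^sup>2)"
      by (rule complex_norm_square[symmetric])
    finally have "Im (z * ev z H * cnj (ev (z / of_real q) H)) =
        c\<^sup>2 / q ^ m * ((norm (z ^ m))\<^sup>2 * Im (z * ?P * cnj ?Q))"
      by (simp only: Im_of_real_mult)
    moreover have "Im (z * ev z H * cnj (ev (z / of_real q) H)) > 0"
    proof -
      have "ev z H \<noteq> 0" using rr z by (auto simp: real_rooted_def)
      then have "Im z * (norm (ev z H))\<^sup>2 > 0" using z by simp
      then show ?thesis using H z unfolding shrinks_def by (metis less_le_trans)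
    qed
    ultimately have "c\<^sup>2 / q ^ m * ((norm (z ^ m))\<^sup>2 * Im (z * ?P * cnj ?Q)) > 0" by linarith
    moreover have "c\<^sup>2 / q ^ m > 0" using q cn(1) by simp
    moreover have "(norm (z ^ m))\<^sup>2 \<ge> 0" by simp
    ultimately show ?thesis by (simp only: zero_less_mult_iff not_less[symmetric]) auto
  qed
  have "\<xi> i * \<xi> j \<le> 0 \<or> \<bar>\<xi> j\<bar> \<le> q * \<bar>\<xi> i\<bar>" if ij: "i < j" for i j
  proof (cases "j < n")
    case True
    then have "sep q (\<xi> i) (\<xi> j)" using arg_count_sep[OF q pos] ij by auto
    moreover have "\<bar>\<xi> j\<bar> > q * \<bar>\<xi> j\<bar>" using q cn(3)[OF True] by simp
    moreover have "q * \<bar>\<xi> j\<bar> \<le> q * \<bar>\<xi> i\<bar>" using q cn(5)[OF ij] by simp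
    ultimately show ?thesis using cn(5)[OF ij] unfolding sep_def by linarith
  qed (use cn(4) in auto)
  then show ?thesis unfolding sep_poly_def canon_def using cn by blast
qed

theorem star_sep_poly:
  assumes q: "0 < q" "q < 1" and IJ: "finite I" "finite J" "psep q \<xi> I" "psep q \<eta> J"
    and neg: "\<And>j. j \<in> J \<Longrightarrow> \<eta> j \<le> 0"
  shows "sep_poly q (star q (rp m \<xi> I) (rp l \<eta> J))"
  using shrinks_imp_sep_poly[OF q shrinks_star[OF q IJ neg]] by blast

lemma sep_poly_0: "sep_poly q 0"
  unfolding sep_poly_def canon_def by (intro exI[of _ 0] exI[of _ "\<lambda>_. 0"]) auto

lemma sep_poly_smult: "sep_poly q P \<Longrightarrow> sep_poly q (smult c P)"
  unfolding sep_poly_def by (metis smult_smult)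

lemma ev_divide_q:
  assumes q: "0 < q" "q < 1"
  shows "ev (z / of_real q) P = ev z P + z * ev z (pd q P) / of_real q"
proof -
  have deg: "degree (pCons 0 (pd q P)) \<le> degree P"
  proof (rule degree_le, intro allI impI)
    fix i assume "i > degree P"
    then show "coeff (pCons 0 (pd q P)) i = 0" by (cases i) (auto simp: coeff_eq_0)
  qed
  have "ev (z / of_real q) P = (\<Sum>k\<le>degree P. of_real (coeff P k * (1 / q) ^ k) * z ^ k)"
    by (subst ev_altdef[OF order_refl]) (simp add: power_divide mult_ac)
  also have "\<dots> = (\<Sum>k\<le>degree P. of_real (coeff P k) * z ^ k +
      of_real (coeff (pCons 0 (pd q P)) k) * z ^ k / of_real q)"
  proof (intro sum.cong refl)
    fix k
    have "(1 / q) ^ k = 1 + wt q k / q"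
      using q by (simp add: wt_closed)
    moreover have "coeff (pCons 0 (pd q P)) k = coeff P k * wt q k"
      by (cases k) auto
    ultimately show "of_real (coeff P k * (1 / q) ^ k) * z ^ k = of_real (coeff P k) * z ^ k +
      of_real (coeff (pCons 0 (pd q P)) k) * z ^ k / of_real q"
      by (simp add: algebra_simps)
  qed
  also have "\<dots> = ev z P + ev z (pCons 0 (pd q P)) / of_real q"
    by (simp only: ev_altdef[OF order_refl, of z P] ev_altdef[OF deg] sum.distrib sum_divide_distrib)
  finally show ?thesis by simp
qed

text \<open>The converse of \<open>shrinks_imp_sep_poly\<close>, from the expansion of
  \<open>pd q\<close> alone; each \<open>\<xi> i\<close> again appears squared, so both signs are
  covered.\<close>

lemma shrinks_rp:
  assumes q: "0 < q" "q < 1" and I: "finite I" "psep q \<xi> I"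
  shows "shrinks q (rp m \<xi> I)"
  unfolding shrinks_def
proof (intro allI impI)
  fix z :: complex assume z: "Im z > 0"
  let ?P = "ev z (rp m \<xi> I)" and ?P' = "\<lambda>i. ev z (rp m \<xi> (I - {i}))"
  obtain e0 e where e: "e0 \<ge> 0" "\<And>i. i \<in> I \<Longrightarrow> e i \<ge> 0"
    "pd q (rp m \<xi> I) = (if m = 0 then 0 else smult e0 (rp (m - 1) \<xi> I)) -
        (\<Sum>i\<in>I. smult (e i * \<xi> i) (rp m \<xi> (I - {i})))"
    using pd_rp[of q I \<xi> m] q I by auto
  have X: "z * ev z (pd q (rp m \<xi> I)) = (if m = 0 then 0 else of_real e0 * ?P) +
      (\<Sum>i\<in>I. of_real (e i * - \<xi> i) * (z * ?P' i))"
  proof -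
    have "z * ev z (rp (m - 1) \<xi> I) = ?P" if "m \<noteq> 0"
      using that rp_Suc[of "m - 1" \<xi> I] by simp
    then show ?thesis
      unfolding e(3) by (simp add: ev_sum sum_distrib_left sum_negf algebra_simps)
  qed
  have pos: "- \<xi> i * Im (z * ?P * cnj (z * ?P' i)) \<ge> 0" if i: "i \<in> I" for i
  proof -
    have "?P = ?P' i * (1 - of_real (\<xi> i) * z)"
      by (subst rp_remove[OF I(1) i]) (simp add: algebra_simps)
    then have "Im (z * ?P * cnj (z * ?P' i)) =
        Im ((1 - of_real (\<xi> i) * z) * ((z * ?P' i) * cnj (z * ?P' i)))"
      by (simp only: mult.assoc mult.commute mult.left_commute)
    also have "(z * ?P' i) * cnj (z * ?P' i) = of_real ((norm (z * ?P' i))\<^sup>2)"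
      by (rule complex_norm_square[symmetric])
    finally have "- \<xi> i * Im (z * ?P * cnj (z * ?P' i)) = (\<xi> i)\<^sup>2 * (Im z * (norm (z * ?P' i))\<^sup>2)"
      by (simp add: power2_eq_square)
    then show ?thesis using z by simp
  qed
  have "Im (z * ?P * cnj (z * ev z (pd q (rp m \<xi> I)))) =
      (if m = 0 then 0 else e0 * Im (z * ?P * cnj ?P)) +
      (\<Sum>i\<in>I. e i * (- \<xi> i * Im (z * ?P * cnj (z * ?P' i))))"
  proof -
    have "z * ?P * cnj (z * ev z (pd q (rp m \<xi> I))) =
      (if m = 0 then 0 else of_real e0 * (z * ?P * cnj ?P)) +
      (\<Sum>i\<in>I. of_real (e i * - \<xi> i) * (z * ?P * cnj (z * ?P' i)))"
      unfolding X by (simp add: sum_distrib_left algebra_simps sum_negf)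
    then show ?thesis
      by (simp only: plus_complex.sel Im_sum Im_of_real_mult if_distrib[of Im] zero_complex.sel mult.assoc)
  qed
  also have "\<dots> \<ge> 0"
  proof -
    have "Im (z * ?P * cnj ?P) \<ge> 0" using z unfolding Im_z_mult_cnj by simp
    then have "(if m = 0 then 0 else e0 * Im (z * ?P * cnj ?P)) \<ge> 0"
      using e(1) by (simp del: times_complex.sel)
    moreover have "(\<Sum>i\<in>I. e i * (- \<xi> i * Im (z * ?P * cnj (z * ?P' i)))) \<ge> 0"
      by (intro sum_nonneg mult_nonneg_nonneg pos e(2))
    ultimately show ?thesis by linarith
  qed
  finally have "Im (z * ?P * cnj (z * ev z (pd q (rp m \<xi> I)))) \<ge> 0" .
  moreover have "Im (z * ?P * cnj (ev (z / of_real q) (rp m \<xi> I))) =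
      Im z * (norm ?P)\<^sup>2 + Im (z * ?P * cnj (z * ev z (pd q (rp m \<xi> I)))) / q"
  proof -
    have "z * ?P * cnj (?P + X / of_real q) = z * ?P * cnj ?P + of_real (1 / q) * (z * ?P * cnj X)" for X
      using q by (simp add: field_simps)
    then show ?thesis
      unfolding ev_divide_q[OF q]
      by (simp only: plus_complex.sel Im_of_real_mult Im_z_mult_cnj) simp
  qed
  ultimately show "Im (z * ?P * cnj (ev (z / of_real q) (rp m \<xi> I))) \<ge> Im z * (norm ?P)\<^sup>2"
    using q by simp
qed

lemma real_rooted_rp: "c \<noteq> 0 \<Longrightarrow> finite I \<Longrightarrow> real_rooted (smult c (rp m \<xi> I))"
  unfolding real_rooted_def
proof (intro allI impI)
  fix z assume z: "Im z > 0" and c: "c \<noteq> 0" and I: "finite I"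
  have "1 - of_real (\<xi> i) * z \<noteq> 0" for i
  proof
    assume *: "1 - of_real (\<xi> i) * z = 0"
    then have "Im (1 - of_real (\<xi> i) * z) = 0" by (simp only: zero_complex.sel)
    then have "\<xi> i = 0" using z by simp
    with * show False by simp
  qed
  moreover have "z \<noteq> 0" using z by auto
  ultimately show "ev z (smult c (rp m \<xi> I)) \<noteq> 0" using c I by (simp add: ev_rp)
qed

text \<open>The sorted form of an arbitrarily indexed separated family is reached without permuting
  indices: for q < 1 the property \<open>shrinks\<close> mentions only the polynomial, and its
  consequences are already sorted.\<close>

lemma sep_poly_rp:
  assumes q: "0 < q" "q \<le> 1" and I: "finite I" "psep q \<xi> I"
  shows "sep_poly q (smult c (rp m \<xi> I))"
proof -
  have "sep_poly q (rp m \<xi> I)"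
  proof (cases "q = 1")
    case True
    then show ?thesis using real_rooted_rp[of 1 I m \<xi>] I real_rooted_imp_sep_poly_1 by simp
  next
    case False
    then have "q < 1" using q by simp
    then show ?thesis using shrinks_imp_sep_poly[OF q(1)] shrinks_rp[OF q(1) _ I] by blast
  qed
  then show ?thesis by (rule sep_poly_smult)
qed

subsection \<open>Limits of polynomials with separated zeros\<close>

lemma coeff_rp: "coeff (rp m \<xi> I) k = (if k < m then 0 else coeff (rp 0 \<xi> I) (k - m))"
  by (simp add: rp_def coeff_monom_mult)

lemma rp_lessThan_Suc: "rp m \<xi> {..<Suc N :: nat} = rp m \<xi> {..<N} - smult (\<xi> N) (pCons 0 (rp m \<xi> {..<N}))"
  by (simp add: lessThan_Suc rp_insert)

lemma coeff_rp_Suc: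
  "coeff (rp 0 \<xi> {..<Suc N}) (Suc k) = coeff (rp 0 \<xi> {..<N}) (Suc k) - \<xi> N * coeff (rp 0 \<xi> {..<N}) k"
  by (simp add: rp_lessThan_Suc del: smult_pCons)

lemma power_add_ge:
  fixes s x :: real
  assumes "s \<ge> 0" "x \<ge> 0"
  shows "s ^ Suc k + real (Suc k) * x * s ^ k \<le> (s + x) ^ Suc k"
proof (induction k)
  case (Suc k)
  have "s ^ Suc (Suc k) + real (Suc (Suc k)) * x * s ^ Suc k \<le>
      (s + x) * (s ^ Suc k + real (Suc k) * x * s ^ k)"
    using assms by (simp add: algebra_simps)
  also have "\<dots> \<le> (s + x) * (s + x) ^ Suc k"
    using assms by (intro mult_left_mono Suc) auto
  finally show ?case by simp
qed simp

text \<open>Up to sign the coefficient is the elementary symmetric function of order k, and each of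
  its monomials occurs k! times in the k-th power of the sum.\<close>

lemma coeff_rp_bound: "\<bar>coeff (rp 0 \<xi> {..<N :: nat}) k\<bar> \<le> (\<Sum>i<N. \<bar>\<xi> i\<bar>) ^ k / fact k"
proof (induction N arbitrary: k)
  case 0
  then show ?case by (cases k) (auto simp: coeff_1)
next
  case (Suc N)
  show ?case
  proof (cases k)
    case (Suc l)
    let ?s = "\<Sum>i<N. \<bar>\<xi> i\<bar>" and ?x = "\<bar>\<xi> N\<bar>"
    have s: "?s \<ge> 0" by (simp add: sum_nonneg)
    have "\<bar>coeff (rp 0 \<xi> {..<Suc N}) (Suc l)\<bar> \<le>
        \<bar>coeff (rp 0 \<xi> {..<N}) (Suc l)\<bar> + ?x * \<bar>coeff (rp 0 \<xi> {..<N}) l\<bar>"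
      unfolding coeff_rp_Suc by (metis abs_mult abs_triangle_ineq4)
    also have "\<dots> \<le> ?s ^ Suc l / fact (Suc l) + ?x * (?s ^ l / fact l)"
      by (intro add_mono mult_left_mono Suc.IH) auto
    also have "?x * (?s ^ l / fact l) = real (Suc l) * ?x * ?s ^ l / fact (Suc l)"
      by (simp add: divide_simps)
    also have "?s ^ Suc l / fact (Suc l) + \<dots> \<le> (?s + ?x) ^ Suc l / fact (Suc l)"
      unfolding add_divide_distrib[symmetric] using power_add_ge[OF s, of ?x l]
      by (intro divide_right_mono) auto
    finally show ?thesis using Suc by simp
  qed auto
qed

text \<open>The recursion in N telescopes: a coefficient is a series in \<open>\<xi> i\<close> times
  lower coefficients of earlier products, which are uniformly bounded.\<close>

lemma coeff_rp_convergent: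
  assumes "summable (\<lambda>i. \<bar>\<xi> i\<bar>)"
  shows "convergent (\<lambda>N :: nat. coeff (rp 0 \<xi> {..<N}) k)"
proof (cases k)
  case 0
  then show ?thesis by (simp add: convergent_const)
next
  case (Suc l)
  let ?S = "\<Sum>i. \<bar>\<xi> i\<bar>"
  have *: "coeff (rp 0 \<xi> {..<N}) (Suc l) = (\<Sum>i<N. - (\<xi> i * coeff (rp 0 \<xi> {..<i}) l))" for N
    by (induction N) (simp_all add: coeff_rp_Suc coeff_1)
  have "\<bar>coeff (rp 0 \<xi> {..<N}) l\<bar> \<le> ?S ^ l / fact l" for N
    by (rule order_trans[OF coeff_rp_bound])
      (intro divide_right_mono power_mono sum_le_suminf assms sum_nonneg; simp)
  then have "norm (- (\<xi> i * coeff (rp 0 \<xi> {..<i}) l)) \<le> \<bar>\<xi> i\<bar> * (?S ^ l / fact l)" for i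
    unfolding real_norm_def abs_minus_cancel abs_mult by (rule mult_left_mono) simp
  then have "summable (\<lambda>i. - (\<xi> i * coeff (rp 0 \<xi> {..<i}) l))"
    by (intro summable_comparison_test'[OF summable_mult2[OF assms]])
  then show ?thesis
    unfolding Suc * using summable_iff_convergent by blast
qed

lemma coeff_rp_tendsto_finite:
  assumes "\<And>i :: nat. i < J \<Longrightarrow> (\<lambda>N. Z N i) \<longlonglongrightarrow> \<zeta> i"
  shows "(\<lambda>N. coeff (rp 0 (Z N) {..<J}) k) \<longlonglongrightarrow> coeff (rp 0 \<zeta> {..<J}) k"
  using assms
proof (induction J arbitrary: k)
  case (Suc J)
  show ?case
    by (cases k) (auto simp: coeff_rp_Suc intro!: tendsto_intros Suc)
qed simp

text \<open>Newton's identity for the second power sum; the sign of the first coefficient is lost in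
  its square.\<close>

lemma sum_squares_rp:
  "(coeff (rp 0 \<xi> {..<N :: nat}) 1)\<^sup>2 - 2 * coeff (rp 0 \<xi> {..<N}) 2 = (\<Sum>i<N. (\<xi> i)\<^sup>2)"
  by (induction N) (simp_all add: coeff_rp_Suc coeff_1 numeral_2_eq_2 power2_eq_square algebra_simps)

text \<open>Among three consecutive non-zero entries two have the same sign, so two steps always
  gain a factor q.\<close>

lemma canon_decay2:
  assumes "canon q \<xi>" "0 < q"
  shows "\<bar>\<xi> (j + 2)\<bar> \<le> q * \<bar>\<xi> j\<bar>"
proof -
  let ?a = "\<xi> j" and ?b = "\<xi> (j + 1)" and ?c = "\<xi> (j + 2)"
  have ord: "\<bar>?b\<bar> \<le> \<bar>?a\<bar>" "\<bar>?c\<bar> \<le> \<bar>?b\<bar>"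
    and alt: "?a * ?b \<le> 0 \<or> \<bar>?b\<bar> \<le> q * \<bar>?a\<bar>" "?b * ?c \<le> 0 \<or> \<bar>?c\<bar> \<le> q * \<bar>?b\<bar>"
      "?a * ?c \<le> 0 \<or> \<bar>?c\<bar> \<le> q * \<bar>?a\<bar>"
    using assms(1) unfolding canon_def by auto
  have "q * \<bar>?b\<bar> \<le> q * \<bar>?a\<bar>" using ord assms(2) by simp
  moreover have "?c = 0" if "?a * ?b \<le> 0" "?b * ?c \<le> 0" "?a * ?c \<le> 0"
  proof (rule ccontr)
    assume c: "?c \<noteq> 0"
    then have "?a \<noteq> 0" "?b \<noteq> 0" using ord by auto
    then show False using that c by (auto simp: mult_le_0_iff)
  qed
  moreover have "q * \<bar>?a\<bar> \<ge> 0" using assms(2) by simp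
  ultimately show ?thesis using ord alt by (smt (verit))
qed

text \<open>The rate is \<open>sqrt q\<close> because a factor q is gained only every second step;
  the constant \<open>M / sqrt q\<close> is the one needed at j = 1.\<close>

lemma canon_decay:
  assumes "canon q \<xi>" "0 < q" "q < 1" "\<And>i. \<bar>\<xi> i\<bar> \<le> M"
  shows "\<bar>\<xi> j\<bar> \<le> M / sqrt q * sqrt q ^ j"
proof (induction j rule: less_induct)
  case (less j)
  have M: "M \<ge> 0" using assms(4)[of 0] by linarith
  consider "j = 0" | "j = 1" | i where "j = i + 2"
    by (metis add_2_eq_Suc' not0_implies_Suc One_nat_def)
  then show ?case
  proof cases
    case 1
    have "M * sqrt q \<le> M" using M assms by (simp add: mult_left_le)
    then have "M \<le> M / sqrt q" using assms by (simp add: field_simps)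
    then show ?thesis using 1 assms(4)[of 0] by simp
  next
    case 2
    then show ?thesis using assms(4)[of 1] assms(2) by simp
  next
    case 3
    have "\<bar>\<xi> j\<bar> \<le> q * \<bar>\<xi> i\<bar>" using canon_decay2[OF assms(1,2)] 3 by simp
    also have "\<dots> \<le> q * (M / sqrt q * sqrt q ^ i)"
      using less[of i] 3 assms(2) by (intro mult_left_mono) auto
    also have "\<dots> = (sqrt q)\<^sup>2 * (M / sqrt q * sqrt q ^ i)" using assms(2) by simp
    also have "\<dots> = M / sqrt q * sqrt q ^ j" using 3 by (simp only: power_add mult_ac)
    finally show ?thesis .
  qed
qed

lemma canon_summable:
  assumes "canon q \<xi>" "0 < q" "q < 1"
  shows "summable (\<lambda>i. \<bar>\<xi> i\<bar>)"
proof -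
  have "\<bar>\<xi> i\<bar> \<le> \<bar>\<xi> 0\<bar>" for i
    using assms(1) unfolding canon_def by (cases "i = 0") auto
  note * = canon_decay[OF assms this]
  show ?thesis
    by (rule summable_comparison_test'[OF summable_mult[OF summable_geometric[of "sqrt q"], of "\<bar>\<xi> 0\<bar> / sqrt q"]])
      (use assms * in auto)
qed

text \<open>For real-rooted polynomials and for the limits considered, coefficients of one sign mean
  that no zero is positive. Unlike a statement about zeros, this passes directly to coefficientwise
  limits and products.\<close>

definition same_sign :: "(nat \<Rightarrow> real) \<Rightarrow> bool" where
  "same_sign f \<longleftrightarrow> (\<forall>k. f k \<ge> 0) \<or> (\<forall>k. f k \<le> 0)"

lemma same_sign_poly_pos:
  assumes "same_sign (coeff P)" "P \<noteq> 0" "x > 0"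
  shows "poly P x \<noteq> 0"
proof
  assume 0: "poly P x = 0"
  have "coeff P k * x ^ k = 0" if "k \<le> degree P" for k
  proof (cases "\<forall>k. coeff P k \<ge> 0")
    case True
    have "(\<Sum>k\<le>degree P. coeff P k * x ^ k) = 0" using 0 by (simp add: poly_altdef)
    then show ?thesis using True assms(3) that by (subst (asm) sum_nonneg_eq_0_iff) auto
  next
    case False
    then have neg: "\<forall>k. coeff P k \<le> 0" using assms(1) by (auto simp: same_sign_def)
    have "(\<Sum>k\<le>degree P. - (coeff P k * x ^ k)) = 0" using 0 by (simp add: poly_altdef sum_negf)
    then show ?thesis using neg assms(3) that
      by (subst (asm) sum_nonneg_eq_0_iff) (auto simp: mult_nonpos_nonneg)
  qed
  from this[of "degree P"] show False using assms by simp
qed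

lemma same_sign_rp_nonpos:
  assumes "same_sign (coeff (smult c (rp m \<xi> I)))" "c \<noteq> 0" "finite I" "i \<in> I"
  shows "\<xi> i \<le> 0"
proof (rule ccontr)
  assume "\<not> \<xi> i \<le> 0"
  then have x: "1 / \<xi> i > 0" and ne: "\<xi> i \<noteq> 0" by auto
  have "poly (smult c (rp m \<xi> I)) (1 / \<xi> i) = 0"
    unfolding rp_def using assms(3,4) ne by (auto simp: poly_prod intro!: bexI[of _ i])
  moreover have "smult c (rp m \<xi> I) \<noteq> 0"
    using assms(2,3) by (simp add: rp_def)
  ultimately show False using same_sign_poly_pos[OF assms(1) _ x] by blast
qed

text \<open>The Taylor coefficients of c z^m times the product of the 1 - \<open>\<xi> i\<close> z,
  described through partial products. For q < 1 the convolution arguments can thus stay on the level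
  of coefficients.\<close>

definition sep_seq :: "real \<Rightarrow> (nat \<Rightarrow> real) \<Rightarrow> bool" where
  "sep_seq q h \<longleftrightarrow> (\<exists>c m \<xi>. canon q \<xi> \<and>
    (\<forall>k. (\<lambda>N. coeff (smult c (rp m \<xi> {..<N})) k) \<longlonglongrightarrow> h k))"

definition neg_seq :: "real \<Rightarrow> (nat \<Rightarrow> real) \<Rightarrow> bool" where
  "neg_seq q h \<longleftrightarrow> (\<exists>c m \<xi>. canon q \<xi> \<and> (\<forall>i. \<xi> i \<le> 0) \<and>
    (\<forall>k. (\<lambda>N. coeff (smult c (rp m \<xi> {..<N})) k) \<longlonglongrightarrow> h k))"

text \<open>Tychonoff's theorem in place of a diagonal argument: a countable product of intervals is
  compact and metrizable, hence sequentially compact.\<close>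

lemma bounded_family_subseq:
  fixes Z :: "nat \<Rightarrow> nat \<Rightarrow> real"
  assumes "\<And>N i. \<bar>Z N i\<bar> \<le> M"
  obtains r \<zeta> where "strict_mono (r :: nat \<Rightarrow> nat)" "\<And>i. (\<lambda>N. Z (r N) i) \<longlonglongrightarrow> \<zeta> i"
proof -
  define K where "K = (PiE UNIV (\<lambda>_. {-M..M}) :: (nat \<Rightarrow> real) set)"
  have "compactin (product_topology (\<lambda>_. euclidean) UNIV) K"
    unfolding K_def by (subst compactin_PiE) simp
  then have "compact K"
    by (simp add: euclidean_product_topology)
  then have "seq_compact K"
    by (simp add: compact_eq_seq_compact_metric)
  moreover have "\<forall>N. Z N \<in> K"
    using assms by (auto simp: K_def abs_le_iff) (metis minus_le_iff)
  ultimately obtain \<zeta> r where r: "strict_mono r" "(Z \<circ> r) \<longlonglongrightarrow> \<zeta>"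
    unfolding seq_compact_def by metis
  have "(\<lambda>N. (Z \<circ> r) N i) \<longlonglongrightarrow> \<zeta> i" for i
    by (rule continuous_on_tendsto_compose[OF continuous_on_product_coordinates r(2)]) auto
  then show thesis by (intro that[OF r(1), of \<zeta>]) simp
qed

lemma rp_eventually_const:
  assumes "\<And>i. i \<ge> n \<Longrightarrow> \<xi> i = 0" "n \<le> N"
  shows "rp m \<xi> {..<N :: nat} = rp m \<xi> {..<n}"
  using assms(2)
proof (induction rule: dec_induct)
  case (step k)
  then show ?case using assms(1)[of k] by (simp add: rp_lessThan_Suc)
qed simp

text \<open>The increments are \<open>\<xi> n\<close> times a bounded coefficient, so their sum is
  dominated by a geometric tail. The bound depends on \<open>\<xi>\<close> only through C and
  \<open>\<rho>\<close>, which later allows two limits to be interchanged.\<close>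

lemma rp_tail_bound:
  assumes \<rho>: "0 < \<rho>" "\<rho> < 1" "\<And>i. \<bar>\<xi> i\<bar> \<le> C * \<rho> ^ i" and JJ: "J \<le> J'"
  shows "\<bar>coeff (rp 0 \<xi> {..<J'}) (Suc k) - coeff (rp 0 \<xi> {..<J}) (Suc k)\<bar>
    \<le> (C / (1 - \<rho>)) ^ k / fact k * (C * \<rho> ^ J / (1 - \<rho>))"
proof -
  have C: "C \<ge> 0" using \<rho>(3)[of 0] by simp
  have geo: "(\<Sum>i\<in>{a..<b}. C * \<rho> ^ i) \<le> C * \<rho> ^ a / (1 - \<rho>)" for a b
  proof -
    have "(\<Sum>i\<in>{a..<b}. C * \<rho> ^ i) \<le> (C * \<rho> ^ a - C * \<rho> ^ max a b) / (1 - \<rho>)"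
    proof (cases "a \<le> b")
      case True
      then show ?thesis
      proof (induction rule: dec_induct)
        case (step n)
        then show ?case using \<rho> by (simp add: field_simps)
      qed simp
    qed simp
    also have "\<dots> \<le> C * \<rho> ^ a / (1 - \<rho>)" using C \<rho> by (intro divide_right_mono) auto
    finally show ?thesis .
  qed
  define B where "B = (C / (1 - \<rho>)) ^ k / fact k"
  have B: "\<bar>coeff (rp 0 \<xi> {..<i}) k\<bar> \<le> B" for i
  proof -
    have "(\<Sum>i<i. \<bar>\<xi> i\<bar>) \<le> (\<Sum>i\<in>{0..<i}. C * \<rho> ^ i)"
      unfolding atLeast0LessThan by (intro sum_mono \<rho>)
    also have "\<dots> \<le> C / (1 - \<rho>)" using geo[of 0 i] by simp
    finally show ?thesis
      unfolding B_def by (intro order_trans[OF coeff_rp_bound] divide_right_mono power_mono)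
        (auto simp: sum_nonneg)
  qed
  have "B \<ge> 0" using B[of 0] by linarith
  have "\<bar>coeff (rp 0 \<xi> {..<J'}) (Suc k) - coeff (rp 0 \<xi> {..<J}) (Suc k)\<bar> \<le> (\<Sum>i\<in>{J..<J'}. C * \<rho> ^ i * B)"
    using JJ
  proof (induction rule: dec_induct)
    case (step n)
    have "\<bar>coeff (rp 0 \<xi> {..<Suc n}) (Suc k) - coeff (rp 0 \<xi> {..<J}) (Suc k)\<bar> \<le>
      \<bar>coeff (rp 0 \<xi> {..<n}) (Suc k) - coeff (rp 0 \<xi> {..<J}) (Suc k)\<bar> + \<bar>\<xi> n * coeff (rp 0 \<xi> {..<n}) k\<bar>"
      unfolding coeff_rp_Suc by linarith
    also have "\<bar>\<xi> n * coeff (rp 0 \<xi> {..<n}) k\<bar> \<le> C * \<rho> ^ n * B"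
      unfolding abs_mult using B \<rho> C by (intro mult_mono) auto
    finally show ?case using step by simp
  qed simp
  also have "\<dots> \<le> (C * \<rho> ^ J / (1 - \<rho>)) * B"
    unfolding sum_distrib_right[symmetric] using \<open>B \<ge> 0\<close> geo by (intro mult_right_mono)
  finally show ?thesis by (simp add: B_def mult.commute)
qed

lemma canon_limit:
  assumes "\<And>N. canon q (Z N)" "\<And>i. (\<lambda>N. Z N i) \<longlonglongrightarrow> \<zeta> i"
  shows "canon q \<zeta>"
  unfolding canon_def
proof (intro allI impI conjI)
  fix i j :: nat assume ij: "i < j"
  have Z: "\<bar>Z N j\<bar> \<le> \<bar>Z N i\<bar>" "Z N i * Z N j \<le> 0 \<or> \<bar>Z N j\<bar> \<le> q * \<bar>Z N i\<bar>" for N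
    using assms(1)[of N] ij unfolding canon_def by auto
  have lim: "(\<lambda>N. \<bar>Z N j\<bar>) \<longlonglongrightarrow> \<bar>\<zeta> j\<bar>" "(\<lambda>N. \<bar>Z N i\<bar>) \<longlonglongrightarrow> \<bar>\<zeta> i\<bar>"
    "(\<lambda>N. Z N i * Z N j) \<longlonglongrightarrow> \<zeta> i * \<zeta> j" "(\<lambda>N. q * \<bar>Z N i\<bar>) \<longlonglongrightarrow> q * \<bar>\<zeta> i\<bar>"
    by (intro tendsto_intros assms)+
  show "\<bar>\<zeta> j\<bar> \<le> \<bar>\<zeta> i\<bar>" using lim(1,2) Z(1) by (intro LIMSEQ_le[OF lim(1,2)]) auto
  show "\<zeta> i * \<zeta> j \<le> 0 \<or> \<bar>\<zeta> j\<bar> \<le> q * \<bar>\<zeta> i\<bar>"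
  proof (cases "\<zeta> i * \<zeta> j \<le> 0")
    case False
    then have "\<forall>\<^sub>F N in sequentially. Z N i * Z N j > 0"
      using order_tendstoD(1)[OF lim(3)] by simp
    then have "\<forall>\<^sub>F N in sequentially. \<bar>Z N j\<bar> \<le> q * \<bar>Z N i\<bar>"
      by (rule eventually_mono) (use Z(2) in force)
    then show ?thesis using tendsto_le[OF _ lim(4,1)] by simp
  qed simp
qed

text \<open>The sum of the squares of the reciprocal zeros is a polynomial in the first two coefficients, so
  convergence of the coefficients alone keeps the zeros away from \<open>0\<close>.\<close>

theorem sep_poly_limit:
  assumes q: "0 < q" "q < 1" and H: "\<And>N. sep_poly q (H N)"
    and lim: "\<And>k. (\<lambda>N. coeff (H N) k) \<longlonglongrightarrow> h k"
    and p: "\<And>N k. k < p \<Longrightarrow> coeff (H N) k = 0" "h p \<noteq> 0"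
  shows "\<exists>\<zeta>. canon q \<zeta> \<and> ((\<forall>N. same_sign (coeff (H N))) \<longrightarrow> (\<forall>i. \<zeta> i \<le> 0)) \<and>
    (\<forall>k. (\<lambda>N. coeff (smult (h p) (rp p \<zeta> {..<N})) k) \<longlonglongrightarrow> h k)"
proof -
  have "\<forall>\<^sub>F N in sequentially. coeff (H N) p \<noteq> 0"
    using tendsto_imp_eventually_ne[OF lim p(2)] .
  then obtain N0 where N0: "\<And>N. N \<ge> N0 \<Longrightarrow> coeff (H N) p \<noteq> 0"
    by (auto simp: eventually_sequentially)
  \<comment> \<open>From \<open>N0\<close> on the order of vanishing at the origin is exactly p, so
    all polynomials can be normalised by the same power of z.\<close>
  define G where "G = (\<lambda>N. H (N + N0))"
  have G: "coeff (G N) p \<noteq> 0" "sep_poly q (G N)" "(\<lambda>N. coeff (G N) k) \<longlonglongrightarrow> h k"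
    "k < p \<Longrightarrow> coeff (G N) k = 0" for N k
    using N0 H p LIMSEQ_ignore_initial_segment[OF lim] by (auto simp: G_def)
  have "\<exists>Z n. G N = smult (coeff (G N) p) (rp p Z {..<n}) \<and> canon q Z \<and> (\<forall>i\<ge>n. Z i = 0)" for N
  proof -
    obtain c m n Z where Z: "G N = smult c (rp m Z {..<n})" "canon q Z" "\<forall>i\<ge>n. Z i = 0"
      using G(2)[of N] unfolding sep_poly_def by blast
    have c: "c \<noteq> 0" using G(1)[of N] Z by auto
    then have "coeff (G N) m = c" unfolding Z(1) by (simp add: coeff_rp[of m])
    moreover have "coeff (G N) k = 0" if "k < m" for k using that unfolding Z(1) by (simp add: coeff_rp[of m])
    ultimately have "m = p" using G(1)[of N] G(4)[of m N] c by (metis linorder_neqE_nat)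
    with Z \<open>coeff (G N) m = c\<close> show ?thesis by metis
  qed
  then obtain Z n where Z: "\<And>N. G N = smult (coeff (G N) p) (rp p (Z N) {..<n N})"
    "\<And>N. canon q (Z N)" "\<And>N i. i \<ge> n N \<Longrightarrow> Z N i = 0"
    by metis
  define e where "e = (\<lambda>k. h (k + p) / h p)"
  have E: "coeff (rp 0 (Z N) {..<n N}) k = coeff (G N) (k + p) / coeff (G N) p" for N k
  proof -
    have "coeff (G N) (k + p) = coeff (G N) p * coeff (rp 0 (Z N) {..<n N}) k"
      by (subst Z(1)) (simp add: coeff_rp[of p])
    then show ?thesis using G(1)[of N] by simp
  qed
  have limE: "(\<lambda>N. coeff (rp 0 (Z N) {..<n N}) k) \<longlonglongrightarrow> e k" for k
    unfolding E e_def by (intro tendsto_divide G p(2))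
  have "(\<lambda>N. (coeff (rp 0 (Z N) {..<n N}) 1)\<^sup>2 - 2 * coeff (rp 0 (Z N) {..<n N}) 2)
      \<longlonglongrightarrow> (e 1)\<^sup>2 - 2 * e 2"
    by (intro tendsto_intros limE)
  then have "Bseq (\<lambda>N. \<Sum>i<n N. (Z N i)\<^sup>2)"
    unfolding sum_squares_rp by (intro convergent_imp_Bseq) (auto simp: convergent_def)
  then obtain K where K: "K > 0" "\<And>N. \<bar>\<Sum>i<n N. (Z N i)\<^sup>2\<bar> \<le> K"
    unfolding Bseq_def by auto
  define M where "M = sqrt K"
  have M: "\<bar>Z N i\<bar> \<le> M" for N i
  proof (cases "i < n N")
    case True
    then have "(Z N i)\<^sup>2 \<le> (\<Sum>i<n N. (Z N i)\<^sup>2)" by (intro member_le_sum) auto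
    also have "\<dots> \<le> K" using K(2)[of N] by simp
    finally show ?thesis unfolding M_def using real_le_rsqrt by auto
  next
    case False
    then show ?thesis using Z(3)[of N i] K by (simp add: M_def)
  qed
  define \<rho> where "\<rho> = sqrt q"
  have \<rho>: "0 < \<rho>" "\<rho> < 1" using q by (auto simp: \<rho>_def)
  define C where "C = M / \<rho>"
  have decay: "\<bar>Z N i\<bar> \<le> C * \<rho> ^ i" for N i
    using canon_decay[OF Z(2) q M] by (simp add: C_def \<rho>_def)
  obtain r \<zeta> where r: "strict_mono r" "\<And>i. (\<lambda>N. Z (r N) i) \<longlonglongrightarrow> \<zeta> i"
    using bounded_family_subseq[of Z M] M by auto
  have canon: "canon q \<zeta>" using canon_limit[OF Z(2) r(2)] .
  have lime: "(\<lambda>J. coeff (rp 0 \<zeta> {..<J}) k) \<longlonglongrightarrow> e k" for k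
  proof (cases k)
    case 0
    have "e 0 = 1" using p(2) by (simp add: e_def)
    then show ?thesis using 0 by simp
  next
    case (Suc l)
    define D where "D = (C / (1 - \<rho>)) ^ l / fact l * (C / (1 - \<rho>))"
    \<comment> \<open>For fixed J only finitely many reciprocal zeros occur and the limit along
      \<open>r\<close> is termwise; the tail estimate is uniform in N and survives it.\<close>
    have bd: "\<bar>coeff (rp 0 \<zeta> {..<J}) (Suc l) - e (Suc l)\<bar> \<le> D * \<rho> ^ J" for J
    proof -
      have "\<bar>coeff (rp 0 (Z N) {..<J}) (Suc l) - coeff (rp 0 (Z N) {..<n N}) (Suc l)\<bar> \<le> D * \<rho> ^ J" for N
      proof -
        have "rp 0 (Z N) {..<n N} = rp 0 (Z N) {..<max J (n N)}"
          by (rule rp_eventually_const[symmetric]) (use Z(3) in auto)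
        then show ?thesis
          using rp_tail_bound[OF \<rho> decay[of N], where J = J and J' = "max J (n N)" and k = l]
          by (simp add: D_def abs_minus_commute)
      qed
      moreover have "(\<lambda>N. \<bar>coeff (rp 0 (Z (r N)) {..<J}) (Suc l) - coeff (rp 0 (Z (r N)) {..<n (r N)}) (Suc l)\<bar>)
          \<longlonglongrightarrow> \<bar>coeff (rp 0 \<zeta> {..<J}) (Suc l) - e (Suc l)\<bar>"
        using LIMSEQ_subseq_LIMSEQ[OF limE r(1), of "Suc l"]
        by (intro tendsto_intros coeff_rp_tendsto_finite r(2)) (simp add: o_def)
      ultimately show ?thesis by (intro LIMSEQ_le_const2) auto
    qed
    have "(\<lambda>J. coeff (rp 0 \<zeta> {..<J}) (Suc l) - e (Suc l)) \<longlonglongrightarrow> 0"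
    proof (rule Lim_null_comparison[of _ "\<lambda>J. D * \<rho> ^ J"])
      show "(\<lambda>J. D * \<rho> ^ J) \<longlonglongrightarrow> 0"
        using tendsto_mult_right_zero[OF LIMSEQ_realpow_zero, of \<rho> D] \<rho> by simp
    qed (use bd in auto)
    then show ?thesis unfolding Suc by (rule LIM_zero_cancel)
  qed
  have "(\<lambda>N. coeff (smult (h p) (rp p \<zeta> {..<N})) k) \<longlonglongrightarrow> h k" for k
  proof (cases "k < p")
    case True
    then have "(\<lambda>N. coeff (G N) k) = (\<lambda>_. 0)" using G(4) by auto
    then have "(\<lambda>_. 0) \<longlonglongrightarrow> h k" using G(3)[of k] by simp
    then have "h k = 0" by (simp add: LIMSEQ_const_iff)
    then show ?thesis using True by (simp add: coeff_rp[of p])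
  next
    case False
    have "(\<lambda>N. h p * coeff (rp 0 \<zeta> {..<N}) (k - p)) \<longlonglongrightarrow> h p * e (k - p)"
      by (intro tendsto_intros lime)
    moreover have "coeff (smult (h p) (rp p \<zeta> {..<N})) k = h p * coeff (rp 0 \<zeta> {..<N}) (k - p)" for N
      using False by (simp add: coeff_rp[of p])
    moreover have "h p * e (k - p) = h k" using False p(2) by (simp add: e_def)
    ultimately show ?thesis by (simp only:)
  qed
  moreover have "\<zeta> i \<le> 0" if ss: "\<forall>N. same_sign (coeff (H N))" for i
  proof -
    have "Z N i \<le> 0" for N
    proof (cases "i < n N")
      case True
      have "same_sign (coeff (smult (coeff (G N) p) (rp p (Z N) {..<n N})))"
        unfolding Z(1)[symmetric] using ss by (simp add: G_def)
      then show ?thesis using True by (intro same_sign_rp_nonpos[OF _ G(1)]) auto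
    qed (use Z(3) in auto)
    then show ?thesis using LIMSEQ_le_const2[OF r(2)] by blast
  qed
  ultimately show ?thesis using canon by blast
qed

subsection \<open>Convolution of power series\<close>

definition neg_poly :: "real \<Rightarrow> real poly \<Rightarrow> bool" where
  "neg_poly q K \<longleftrightarrow> (\<exists>c l (n::nat) \<eta>. K = smult c (rp l \<eta> {..<n}) \<and> canon q \<eta> \<and> (\<forall>i. \<eta> i \<le> 0))"

lemma coeff_rp_nonneg:
  "finite I \<Longrightarrow> (\<And>i. i \<in> I \<Longrightarrow> \<eta> i \<le> 0) \<Longrightarrow> coeff (rp m \<eta> I) k \<ge> 0"
proof (induction arbitrary: k rule: finite_induct)
  case empty
  then show ?case by (simp add: rp_def)
next
  case (insert i I)
  then show ?case
    by (cases k) (auto simp: rp_insert simp del: smult_pCons intro: order_trans[OF mult_nonpos_nonneg])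
qed

text \<open>Coefficients are non-negative, so multiplying by 1 + x z with x > 0 replaces the support
  by its union with its shift by one; an interval remains an interval.\<close>

lemma coeff_rp_no_internal_zeros:
  "finite I \<Longrightarrow> (\<And>i. i \<in> I \<Longrightarrow> \<eta> i \<le> 0) \<Longrightarrow> i \<le> j \<Longrightarrow> coeff (rp m \<eta> I) i \<noteq> 0 \<Longrightarrow>
    coeff (rp m \<eta> I) j = 0 \<Longrightarrow> j \<le> k \<Longrightarrow> coeff (rp m \<eta> I) k = 0"
proof (induction arbitrary: i j k rule: finite_induct)
  case empty
  have *: "coeff (rp m \<eta> {}) n = (if m = n then 1 else 0)" for n by (simp add: rp_def)
  have "i = m" "j \<noteq> m" using empty.prems(3,4) unfolding * by presburger+
  then have "k \<noteq> m" using empty.prems(2,5) by linarith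
  then show ?case unfolding * by simp
next
  case (insert a I)
  let ?P = "coeff (rp m \<eta> I)"
  define x where "x = - \<eta> a"
  have x: "x \<ge> 0" unfolding x_def neg_0_le_iff_le by (rule insert.prems(1)) simp
  have new0: "coeff (rp m \<eta> (insert a I)) 0 = ?P 0"
    and newS: "coeff (rp m \<eta> (insert a I)) (Suc n) = ?P (Suc n) + x * ?P n" for n
    using insert.hyps by (simp_all add: rp_insert x_def del: smult_pCons)
  have nonneg: "?P n \<ge> 0" for n
    by (rule coeff_rp_nonneg) (simp_all add: insert.hyps insert.prems(1))
  have IH: "?P i \<noteq> 0 \<Longrightarrow> ?P j = 0 \<Longrightarrow> i \<le> j \<Longrightarrow> j \<le> k \<Longrightarrow> ?P k = 0" for i j k
    by (rule insert.IH[of i j]) (simp_all add: insert.prems(1))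
  show ?case
  proof (cases "x = 0")
    case True
    have "coeff (rp m \<eta> (insert a I)) n = ?P n" for n
      by (cases n) (simp_all only: new0 newS True mult_zero_left add_0_right)
    then show ?thesis using IH[of i j k] insert.prems(2-5) by metis
  next
    case False
    show ?thesis
    proof (cases j)
      case 0
      then show ?thesis using insert.prems(2,3,4) by simp
    next
      case (Suc l)
      have "x * ?P l \<ge> 0" using x nonneg by simp
      then have z: "?P (Suc l) = 0" "?P l = 0"
        using insert.prems(4) nonneg[of "Suc l"] False unfolding Suc newS by (linarith, simp add: add_nonneg_eq_0_iff)
      obtain i' where i': "?P i' \<noteq> 0" "i' \<le> l"
      proof (cases i)
        case 0
        then show thesis using that[of 0] insert.prems(3) new0 by auto
      next
        case (Suc i0)
        show thesis
        proof (cases "?P i = 0")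
          case True
          then have "?P i0 \<noteq> 0" using insert.prems(3) newS Suc by auto
          then show thesis using that[of i0] insert.prems(2) Suc \<open>j = Suc l\<close> by auto
        next
          case False
          then have "i \<noteq> Suc l" using z by auto
          then show thesis using that[of i] False insert.prems(2) \<open>j = Suc l\<close> by auto
        qed
      qed
      obtain k' where k': "k = Suc k'" "l \<le> k'" using insert.prems(5) Suc by (cases k) auto
      then have "?P k = 0" "?P k' = 0" using IH[OF i'(1) z(2) i'(2)] by auto
      then show ?thesis using newS k' by simp
    qed
  qed
qed

text \<open>Successive ratios decrease, so f(i+n+1) / f(i+1) is at most the n-th power of f(i+1) /
  f(i); the form without division is a closed condition. In contrast to Newton's inequalities, which
  allow 1, 0, 0, 1, it excludes gaps in the support also after a limit.\<close>

lemma log_concave_power: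
  fixes f :: "nat \<Rightarrow> real"
  assumes nn: "\<And>k. f k \<ge> 0" and lc: "\<And>k. f k * f (k + 2) \<le> (f (Suc k))\<^sup>2"
    and nz: "\<And>i j k. i \<le> j \<Longrightarrow> f i \<noteq> 0 \<Longrightarrow> f j = 0 \<Longrightarrow> j \<le> k \<Longrightarrow> f k = 0"
  shows "f i ^ n * f (i + n + 1) \<le> f (i + 1) ^ (n + 1)"
proof -
  have step: "f i * f (i + n + 1) \<le> f (i + 1) * f (i + n)" for n
  proof (induction n)
    case (Suc n)
    show ?case
    proof (cases "f i = 0 \<or> f (i + n + 1) = 0")
      case True
      then have "f i = 0 \<or> f (i + n + 2) = 0"
        using nz[of i "i + n + 1" "i + n + 2"] by auto
      then show ?thesis using nn by (auto simp: numeral_2_eq_2)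
    next
      case False
      then have "f (i + n) \<noteq> 0" using nz[of i "i + n" "i + n + 1"] by auto
      then have pos: "f (i + n) > 0" "f (i + n + 1) > 0" using False nn by (simp_all add: less_le)
      have "(f i * f (i + n + 2)) * f (i + n) \<le> f i * (f (i + n + 1))\<^sup>2"
        using mult_left_mono[OF lc[of "i + n"] nn[of i]] by (simp add: mult_ac)
      also have "\<dots> = (f i * f (i + n + 1)) * f (i + n + 1)" by (simp add: power2_eq_square)
      also have "\<dots> \<le> (f (i + 1) * f (i + n)) * f (i + n + 1)"
        using Suc pos by (intro mult_right_mono) auto
      finally have "(f i * f (i + n + 2)) * f (i + n) \<le> (f (i + 1) * f (i + n + 1)) * f (i + n)"
        by (simp add: mult_ac)
      then show ?thesis using pos(1) by (simp add: numeral_2_eq_2)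
    qed
  qed simp
  show ?thesis
  proof (induction n)
    case (Suc n)
    have "f i ^ Suc n * f (i + Suc n + 1) = f i ^ n * (f i * f (i + Suc n + 1))" by simp
    also have "\<dots> \<le> f i ^ n * (f (i + 1) * f (i + Suc n))"
      using nn by (intro mult_left_mono step) auto
    also have "\<dots> = f (i + 1) * (f i ^ n * f (i + n + 1))" by simp
    also have "\<dots> \<le> f (i + 1) * f (i + 1) ^ (n + 1)"
      using nn Suc by (intro mult_left_mono) auto
    finally show ?case by simp
  qed simp
qed

lemma neg_poly_power_bound:
  assumes q: "0 < q" "q \<le> 1" and K: "neg_poly q K"
  defines "f \<equiv> \<lambda>k. cw q k * coeff K k"
  shows "\<bar>f i\<bar> ^ n * \<bar>f (i + n + 1)\<bar> \<le> \<bar>f (i + 1)\<bar> ^ (n + 1)"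
proof -
  obtain c l m \<eta> where K: "K = smult c (rp l \<eta> {..<m::nat})" "canon q \<eta>" "\<forall>i. \<eta> i \<le> 0"
    using K unfolding neg_poly_def by blast
  define g where "g = (\<lambda>k. cw q k * coeff (rp l \<eta> {..<m}) k)"
  have g0: "g k \<ge> 0" for k
    unfolding g_def using cw_pos[OF q] coeff_rp_nonneg[of "{..<m}" \<eta> l k] K(3) by (simp add: less_imp_le)
  have "g i ^ n * g (i + n + 1) \<le> g (i + 1) ^ (n + 1)"
  proof (rule log_concave_power[OF g0])
    show "g k * g (k + 2) \<le> (g (Suc k))\<^sup>2" for k
      unfolding g_def using star_rp_newton[OF q, of "{..<m}" \<eta> k l] canon_psep[OF K(2)] by simp
    show "g k = 0" if "i \<le> j" "g i \<noteq> 0" "g j = 0" "j \<le> k" for i j k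
      using that coeff_rp_no_internal_zeros[of "{..<m}" \<eta> i j l k] K(3) cw_pos[OF q]
      unfolding g_def by (auto simp: less_le)
  qed
  moreover have "\<bar>f k\<bar> = \<bar>c\<bar> * g k" for k
  proof -
    have "f k = c * g k" unfolding f_def K(1) g_def by simp
    then show ?thesis using g0[of k] by (simp add: abs_mult)
  qed
  ultimately show ?thesis
    using mult_left_mono[of "g i ^ n * g (i + n + 1)" "g (i + 1) ^ (n + 1)" "\<bar>c\<bar> ^ (n + 1)"]
    by (simp add: power_mult_distrib mult_ac)
qed

lemma sep_poly_newton:
  assumes q: "0 < q" "q \<le> 1" and K: "sep_poly q K"
  defines "f \<equiv> \<lambda>k. cw q k * coeff K k"
  shows "f k * f (k + 2) \<le> (f (Suc k))\<^sup>2"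
proof -
  obtain c l m \<eta> where K: "K = smult c (rp l \<eta> {..<m::nat})" "canon q \<eta>"
    using K unfolding sep_poly_def by blast
  have "c\<^sup>2 * ((cw q k * coeff (rp l \<eta> {..<m}) k) * (cw q (k + 2) * coeff (rp l \<eta> {..<m}) (k + 2)))
    \<le> c\<^sup>2 * (cw q (Suc k) * coeff (rp l \<eta> {..<m}) (Suc k))\<^sup>2"
    using star_rp_newton[OF q, of "{..<m}" \<eta> k l] canon_psep[OF K(2)]
    by (intro mult_left_mono) auto
  then show ?thesis unfolding f_def K(1) by (simp add: power2_eq_square mult_ac)
qed

lemma neg_poly_same_sign:
  assumes "neg_poly q K" shows "same_sign (coeff K)"
proof -
  obtain c l m \<eta> where K: "K = smult c (rp l \<eta> {..<m::nat})" "\<forall>i. \<eta> i \<le> 0"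
    using assms unfolding neg_poly_def by blast
  have "coeff (rp l \<eta> {..<m}) k \<ge> 0" for k using K(2) by (intro coeff_rp_nonneg) auto
  then show ?thesis unfolding K(1) same_sign_def
    by (cases "c \<ge> 0") (auto simp: mult_nonpos_nonneg)
qed

lemma same_sign_limit:
  assumes "\<And>N. same_sign (g N)" "\<And>k. (\<lambda>N. g N k) \<longlonglongrightarrow> h k"
  shows "same_sign h"
proof (cases "\<exists>k. h k > 0")
  case True
  then obtain k where "h k > 0" by blast
  then have "\<forall>\<^sub>F N in sequentially. g N k > 0" using order_tendstoD(1)[OF assms(2)] by blast
  then have *: "\<forall>\<^sub>F N in sequentially. \<forall>j. g N j \<ge> 0"
    by (rule eventually_mono) (use assms(1) same_sign_def not_less in metis)
  have "h j \<ge> 0" for j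
    using assms(2)[of j] by (rule tendsto_lowerbound) (use * in \<open>auto elim: eventually_mono\<close>)
  then show ?thesis by (simp add: same_sign_def)
qed (auto simp: same_sign_def not_less)

lemma star_sep_neg:
  assumes q: "0 < q" "q < 1" and "sep_poly q P" "neg_poly q K"
  shows "sep_poly q (star q P K)"
proof -
  obtain c m n \<xi> where P: "P = smult c (rp m \<xi> {..<n::nat})" "canon q \<xi>"
    using assms(3) unfolding sep_poly_def by blast
  obtain d l n' \<eta> where K: "K = smult d (rp l \<eta> {..<n'::nat})" "canon q \<eta>" "\<forall>i. \<eta> i \<le> 0"
    using assms(4) unfolding neg_poly_def by blast
  have "sep_poly q (star q (rp m \<xi> {..<n}) (rp l \<eta> {..<n'}))"
    using K(3) by (intro star_sep_poly q canon_psep P K) auto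
  then show ?thesis unfolding P K by (simp add: sep_poly_smult)
qed

text \<open>The polynomials \<open>rp 0 (geom q) {..<N}\<close> are the partial products of \<open>R_inf q\<close>.\<close>

definition geom :: "real \<Rightarrow> nat \<Rightarrow> real" where
  "geom q i = - (q ^ i)"

lemma canon_geom: "0 < q \<Longrightarrow> q \<le> 1 \<Longrightarrow> canon q (geom q)"
  unfolding canon_def geom_def
proof (intro allI impI conjI)
  fix i j :: nat assume q: "0 < q" "q \<le> 1" and ij: "i < j"
  show "\<bar>- (q ^ j)\<bar> \<le> \<bar>- (q ^ i)\<bar>" using q ij by (simp add: power_decreasing)
  have "q ^ j \<le> q ^ Suc i" using q ij by (intro power_decreasing) auto
  then show "- (q ^ i) * - (q ^ j) \<le> 0 \<or> \<bar>- (q ^ j)\<bar> \<le> q * \<bar>- (q ^ i)\<bar>" using q by simp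
qed

text \<open>Splitting off the first factor instead of the last: the product of N + 1 factors is 1 +
  z times the product of N factors taken at q z.\<close>

lemma coeff_geom_rec:
  "coeff (rp 0 (geom q) {..<Suc N}) (Suc k) =
    q ^ Suc k * coeff (rp 0 (geom q) {..<N}) (Suc k) + q ^ k * coeff (rp 0 (geom q) {..<N}) k"
proof (induction N arbitrary: k)
  case 0
  then show ?case by (cases k) (simp_all add: coeff_rp_Suc coeff_1 geom_def)
next
  case (Suc N)
  have geom_simp: "geom q N = - (q ^ N)" "geom q (Suc N) = - (q * q ^ N)"
    by (simp_all add: geom_def)
  show ?case
  proof (cases k)
    case 0
    let ?P = "coeff (rp 0 (geom q) {..<N}) (Suc 0)"
    have IH: "q ^ N + ?P = 1 + q * ?P"
      using Suc.IH[of 0] by (simp add: coeff_rp_Suc geom_simp)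
    have "q * q ^ N + q * ?P = q * 1 + q * (q * ?P)"
      by (simp only: distrib_left[symmetric] IH)
    then show ?thesis using 0 IH by (simp add: coeff_rp_Suc geom_simp algebra_simps)
  next
    case (Suc l)
    let ?A = "coeff (rp 0 (geom q) {..<N}) (Suc k)" and ?B = "coeff (rp 0 (geom q) {..<N}) k"
      and ?C = "coeff (rp 0 (geom q) {..<N}) l"
    have 1: "?A + q ^ N * ?B = q ^ Suc k * ?A + q ^ k * ?B"
      using Suc.IH[of k] unfolding coeff_rp_Suc geom_simp by simp
    have 3: "coeff (rp 0 (geom q) {..<Suc N}) k = ?B + q ^ N * ?C"
      unfolding Suc coeff_rp_Suc geom_simp by simp
    have 2: "?B + q ^ N * ?C = q ^ k * ?B + q ^ l * ?C"
      using Suc.IH[of l] 3 unfolding Suc by linarith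
    have "(?A + q ^ N * ?B) + q ^ Suc N * (?B + q ^ N * ?C) =
        q ^ Suc k * (?A + q ^ N * ?B) + q ^ k * (?B + q ^ N * ?C)"
    proof -
      have "q ^ Suc N * (?B + q ^ N * ?C) = q ^ Suc N * (q ^ k * ?B + q ^ l * ?C)" by (simp only: 2)
      also have "\<dots> = q ^ Suc k * (q ^ N * ?B) + q ^ k * (q ^ N * ?C)"
        by (simp add: Suc algebra_simps)
      finally show ?thesis using 1 unfolding distrib_left by linarith
    qed
    moreover note 3
    moreover have "coeff (rp 0 (geom q) {..<Suc N}) (Suc k) = ?A + q ^ N * ?B"
      unfolding coeff_rp_Suc geom_simp by simp
    moreover have "coeff (rp 0 (geom q) {..<Suc (Suc N)}) (Suc k) =
        coeff (rp 0 (geom q) {..<Suc N}) (Suc k) + q ^ Suc N * coeff (rp 0 (geom q) {..<Suc N}) k"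
      unfolding coeff_rp_Suc[of _ "Suc N"] geom_simp by simp
    ultimately show ?thesis by simp
  qed
qed

text \<open>Euler's expansion of the product. In the limit the recursion becomes (1 - q^(k+1))
  b_(k+1) = q^k b_k, which is the recursion of the reciprocals of \<open>cw q\<close>.\<close>

lemma coeff_geom_tendsto:
  assumes q: "0 < q" "q < 1"
  shows "(\<lambda>N. coeff (rp 0 (geom q) {..<N}) k) \<longlonglongrightarrow> 1 / cw q k"
proof -
  have "summable (\<lambda>i. \<bar>geom q i\<bar>)"
    using canon_summable[OF canon_geom q] q by auto
  then have "convergent (\<lambda>N. coeff (rp 0 (geom q) {..<N}) k)" for k
    by (rule coeff_rp_convergent)
  then obtain b where b: "\<And>k. (\<lambda>N. coeff (rp 0 (geom q) {..<N}) k) \<longlonglongrightarrow> b k"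
    unfolding convergent_def by metis
  have "b k = 1 / cw q k" for k
  proof (induction k)
    case 0
    then show ?case using b[of 0] by (simp add: LIMSEQ_const_iff)
  next
    case (Suc k)
    have "(\<lambda>N. coeff (rp 0 (geom q) {..<Suc N}) (Suc k)) \<longlonglongrightarrow> q ^ Suc k * b (Suc k) + q ^ k * b k"
      unfolding coeff_geom_rec by (intro tendsto_intros b)
    then have "b (Suc k) = q ^ Suc k * b (Suc k) + q ^ k * b k"
      using LIMSEQ_unique[OF LIMSEQ_Suc[OF b[of "Suc k"]]] by blast
    moreover have "wt q (Suc k) * q ^ k = 1 - q ^ Suc k"
      using q by (simp add: wt_closed power_divide field_simps)
    moreover have "b (Suc k) * (1 - q ^ Suc k) = q ^ k * b k"
    proof -
      have "b (Suc k) - q ^ Suc k * b (Suc k) = q ^ k * b k" using calculation(1) by linarith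
      then show ?thesis by (simp only: right_diff_distrib mult_1_right mult.commute)
    qed
    ultimately have "(b (Suc k) * wt q (Suc k)) * q ^ k = b k * q ^ k" by (simp add: mult.assoc)
    then have "b (Suc k) * wt q (Suc k) = b k" using q by simp
    then show ?case using Suc cw_pos[of q k] wt_pos[of q "Suc k"] q by (simp add: cw_Suc field_simps)
  qed
  then show ?thesis using b by simp
qed

lemma neg_poly_geom: "0 < q \<Longrightarrow> q \<le> 1 \<Longrightarrow> neg_poly q (rp l (geom q) {..<N})"
  unfolding neg_poly_def using canon_geom[of q]
  by (intro exI[of _ 1] exI[of _ l] exI[of _ N] exI[of _ "geom q"]) (auto simp: geom_def)

section \<open>Coefficient sequences of entire functions: shifts, limits and the
  \<open>q\<close>-derivative\<close>

lemma sep_seq_0: "sep_seq q (\<lambda>_. 0)"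
  unfolding sep_seq_def canon_def by (intro exI[of _ 0] exI[of _ "\<lambda>_. 0"]) auto

lemma sep_seqI:
  assumes "canon q \<xi>" "\<And>k. (\<lambda>N. coeff (smult c (rp m \<xi> {..<N})) k) \<longlonglongrightarrow> h k"
  shows "sep_seq q h"
  using assms unfolding sep_seq_def by blast

lemma sep_seq_shift_up:
  assumes "sep_seq q a"
  shows "sep_seq q (\<lambda>k. case k of 0 \<Rightarrow> 0 | Suc j \<Rightarrow> a j)"
proof -
  obtain c m \<xi> where *: "canon q \<xi>" "\<And>k. (\<lambda>N. coeff (smult c (rp m \<xi> {..<N})) k) \<longlonglongrightarrow> a k"
    using assms unfolding sep_seq_def by blast
  show ?thesis
  proof (rule sep_seqI[OF *(1), of c "Suc m"])
    fix k show "(\<lambda>N. coeff (smult c (rp (Suc m) \<xi> {..<N})) k) \<longlonglongrightarrow> (case k of 0 \<Rightarrow> 0 | Suc j \<Rightarrow> a j)"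
      using *(2) by (cases k) (simp_all add: rp_Suc)
  qed
qed

lemma sep_seq_shift_down:
  assumes "sep_seq q a" "a 0 = 0"
  shows "sep_seq q (\<lambda>k. a (Suc k))"
proof -
  obtain c m \<xi> where *: "canon q \<xi>" "\<And>k. (\<lambda>N. coeff (smult c (rp m \<xi> {..<N})) k) \<longlonglongrightarrow> a k"
    using assms unfolding sep_seq_def by blast
  show ?thesis
  proof (cases m)
    case 0
    then have "c = 0" using *(2)[of 0] assms(2) by (simp add: LIMSEQ_const_iff)
    then have "a k = 0" for k using *(2)[of k] by (simp add: LIMSEQ_const_iff)
    then show ?thesis using sep_seq_0 by simp
  next
    case (Suc n)
    show ?thesis
    proof (rule sep_seqI[OF *(1), of c n])
      fix k show "(\<lambda>N. coeff (smult c (rp n \<xi> {..<N})) k) \<longlonglongrightarrow> a (Suc k)"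
        using *(2)[of "Suc k"] Suc by (simp add: rp_Suc)
    qed
  qed
qed

lemma sep_seq_limit:
  assumes "0 < q" "q < 1" "\<And>N. sep_poly q (H N)" "\<And>k. (\<lambda>N. coeff (H N) k) \<longlonglongrightarrow> h k"
    and "\<And>N k. k < p \<Longrightarrow> coeff (H N) k = 0" "h p \<noteq> 0"
  shows "sep_seq q h"
  using sep_poly_limit[OF assms] sep_seqI by metis

text \<open>Changing the largest reciprocal zero of the right sign makes the reciprocal zeros sum to \<open>0\<close>
  and keeps them separated.\<close>

lemma balanced_approximation:
  assumes q: "0 < q" "q < 1" and \<xi>: "canon q \<xi>" "\<xi> 0 \<noteq> 0" and bal: "(\<lambda>N. \<Sum>i<N. \<xi> i) \<longlonglongrightarrow> 0"
  obtains P where "\<And>N. sep_poly q (P N)" "\<And>N. coeff (P N) 1 = 0" "\<And>N. coeff (P N) 0 = 1"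
    "\<And>k h. (\<lambda>N. coeff (rp 0 \<xi> {..<N}) k) \<longlonglongrightarrow> h \<Longrightarrow> (\<lambda>N. coeff (P N) k) \<longlonglongrightarrow> h"
proof -
  have summ: "summable (\<lambda>i. \<bar>\<xi> i\<bar>)" using canon_summable[OF \<xi>(1) q] .
  \<comment> \<open>Entries of both signs exist, since a sum without cancellation could not tend to
    0 while \<open>\<xi> 0 \<noteq> 0\<close>. The first one of either sign is also the largest of
    that sign.\<close>
  have sgn: "\<exists>i. s * \<xi> i > 0 \<and> (\<forall>j. j < i \<longrightarrow> s * \<xi> j \<le> 0)" if s: "s = 1 \<or> s = -1" for s
  proof -
    have "\<exists>i. s * \<xi> i > 0"
    proof (rule ccontr)
      assume "\<nexists>i. s * \<xi> i > 0"
      then have neg: "s * \<xi> i \<le> 0" for i by (simp add: not_less)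
      have "(\<lambda>N. \<Sum>i<N. \<bar>\<xi> i\<bar>) \<longlonglongrightarrow> - s * 0"
      proof -
        have "\<bar>\<xi> i\<bar> = - s * \<xi> i" for i using neg[of i] s by auto
        then have "(\<lambda>N. \<Sum>i<N. \<bar>\<xi> i\<bar>) = (\<lambda>N. - s * (\<Sum>i<N. \<xi> i))"
          by (simp only: sum_distrib_left)
        then show ?thesis using tendsto_mult_left[OF bal, of "- s"] by simp
      qed
      moreover have "\<bar>\<xi> 0\<bar> \<le> (\<Sum>i<N. \<bar>\<xi> i\<bar>)" if "N \<ge> 1" for N
        using that by (intro member_le_sum) auto
      ultimately have "\<bar>\<xi> 0\<bar> \<le> - s * 0" by (intro LIMSEQ_le_const) auto
      then show False using \<xi>(2) by simp
    qed
    then show ?thesis using exists_least_iff[of "\<lambda>i. s * \<xi> i > 0"] by (auto simp: not_less)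
  qed
  obtain a where a: "\<xi> a > 0" "\<And>j. j < a \<Longrightarrow> \<xi> j \<le> 0" using sgn[of 1] by auto
  obtain b where b: "\<xi> b < 0" "\<And>j. j < b \<Longrightarrow> \<xi> j \<ge> 0" using sgn[of "-1"] by auto
  \<comment> \<open>The correction that makes the sum vanish. It is added to the first entry with
    the sign of \<open>t N\<close>, which only grows in modulus; entries of the same sign come later
    and are already smaller by a factor q, so separation persists.\<close>
  define t where "t = (\<lambda>N. - (\<Sum>i<N. \<xi> i))"
  define s where "s = (\<lambda>N. if t N \<ge> 0 then a else b)"
  define \<xi>' where "\<xi>' = (\<lambda>N. \<xi>(s N := \<xi> (s N) + t N))"
  define M where "M = Suc (max a b)"
  define P where "P = (\<lambda>N. rp 0 (\<xi>' (N + M)) {..<N + M})"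
  have sM: "s N < N' + M" for N N' by (auto simp: s_def M_def)
  have least: "\<xi> j * \<xi> (s N) \<le> 0" if "j < s N" for j N
    using that a b by (auto simp: s_def mult_le_0_iff split: if_splits)
  have grow: "\<bar>\<xi> (s N)\<bar> \<le> \<bar>\<xi> (s N) + t N\<bar>"
    "\<xi> (s N) > 0 \<and> \<xi> (s N) + t N > 0 \<or> \<xi> (s N) < 0 \<and> \<xi> (s N) + t N < 0" for N
    using a(1) b(1) by (auto simp: s_def)
  have pair: "sep q (\<xi> (s N) + t N) (\<xi> j)" if "j \<noteq> s N" for j N
  proof (cases "\<xi> (s N) * \<xi> j \<le> 0")
    case True
    have "(\<xi> (s N) + t N) * \<xi> j \<le> 0"
      using True grow(2)[of N] by (auto simp: mult_le_0_iff)
    then show ?thesis by (simp add: sep_def)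
  next
    case False
    then have "s N < j" using least[of j N] that by (metis linorder_neqE_nat mult.commute)
    then have "\<bar>\<xi> j\<bar> \<le> q * \<bar>\<xi> (s N)\<bar>" using \<xi>(1) False unfolding canon_def by blast
    also have "\<dots> \<le> q * \<bar>\<xi> (s N) + t N\<bar>" using grow q by (intro mult_left_mono) auto
    finally show ?thesis by (simp add: sep_def)
  qed
  have "psep q (\<xi>' N) I" for N and I :: "nat set"
    unfolding psep_def
  proof (intro ballI impI)
    fix i j :: nat assume ij: "i \<noteq> j"
    have "sep q (\<xi> i) (\<xi> j)" using canon_psep[OF \<xi>(1), of UNIV] ij by (simp add: psep_def)
    moreover have "sep q (\<xi> i) (\<xi> j + t N)" if "j = s N" using pair[of i N] that ij sep_commute by metis
    ultimately show "sep q (\<xi>' N i) (\<xi>' N j)"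
      using pair[of j N] ij by (auto simp: \<xi>'_def)
  qed
  then have "sep_poly q (P N)" for N
    using sep_poly_rp[of q "{..<N + M}" "\<xi>' (N + M)" 1 0] q by (simp add: P_def)
  moreover have "coeff (P N) 1 = 0" for N
  proof -
    have c1: "coeff (rp 0 f {..<n}) 1 = - (\<Sum>i<n. f i)" for f :: "nat \<Rightarrow> real" and n
      by (induction n) (simp_all add: coeff_rp_Suc coeff_1)
    have "(\<Sum>i<N + M. \<xi>' (N + M) i) = (\<Sum>i<N + M. \<xi> i + (if i = s (N + M) then t (N + M) else 0))"
      by (intro sum.cong) (auto simp: \<xi>'_def)
    also have "\<dots> = 0" using sM[of "N + M" N] by (simp add: sum.distrib t_def)
    finally show ?thesis unfolding P_def c1 by simp
  qed
  moreover have "coeff (P N) 0 = 1" for N by (simp add: P_def)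
  moreover have "(\<lambda>N. coeff (P N) k) \<longlonglongrightarrow> h" if h: "(\<lambda>N. coeff (rp 0 \<xi> {..<N}) k) \<longlonglongrightarrow> h" for k h
  proof (cases k)
    case 0
    then show ?thesis using h by (simp add: P_def)
  next
    case (Suc l)
    let ?S = "\<Sum>i. \<bar>\<xi> i\<bar>"
    \<comment> \<open>Only one linear factor was changed, so the coefficients differ by
      \<open>t\<close> times a bounded coefficient of the product of the other factors.\<close>
    have bd: "\<bar>coeff (P N) k - coeff (rp 0 \<xi> {..<N + M}) k\<bar> \<le> \<bar>t (N + M)\<bar> * (?S ^ l / fact l)" for N
    proof -
      let ?n = "N + M" and ?s = "s (N + M)"
      let ?Q = "rp 0 \<xi> ({..<?n} - {?s})"
      have mem: "?s \<in> {..<?n}" using sM[of "N + M" N] by simp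
      have "rp 0 (\<xi>' ?n) ({..<?n} - {?s}) = ?Q" by (intro rp_cong) (auto simp: \<xi>'_def)
      then have "P N = ?Q - smult (\<xi> ?s + t ?n) (pCons 0 ?Q)"
        unfolding P_def using rp_remove[OF finite_lessThan mem, of 0 "\<xi>' ?n"] by (simp add: \<xi>'_def del: smult_pCons)
      moreover have "rp 0 \<xi> {..<?n} = ?Q - smult (\<xi> ?s) (pCons 0 ?Q)"
        by (rule rp_remove[OF finite_lessThan mem])
      ultimately have "coeff (P N) k = coeff ?Q k - (\<xi> ?s + t ?n) * coeff ?Q l"
        "coeff (rp 0 \<xi> {..<?n}) k = coeff ?Q k - \<xi> ?s * coeff ?Q l"
        using Suc by (simp_all del: smult_pCons)
      then have "coeff (P N) k - coeff (rp 0 \<xi> {..<?n}) k = - (t ?n * coeff ?Q l)"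
        by (simp add: algebra_simps)
      moreover have "\<bar>coeff ?Q l\<bar> \<le> ?S ^ l / fact l"
      proof -
        have "?Q = rp 0 (\<xi>(?s := 0)) {..<?n}"
        proof -
          have "rp 0 (\<xi>(?s := 0)) {..<?n} = rp 0 (\<xi>(?s := 0)) ({..<?n} - {?s})"
            using rp_remove[OF finite_lessThan mem, of 0 "\<xi>(?s := 0)"] by simp
          also have "\<dots> = ?Q" by (intro rp_cong) auto
          finally show ?thesis ..
        qed
        then have "\<bar>coeff ?Q l\<bar> \<le> (\<Sum>i<?n. \<bar>(\<xi>(?s := 0)) i\<bar>) ^ l / fact l"
          using coeff_rp_bound by metis
        moreover have "(\<Sum>i<?n. \<bar>(\<xi>(?s := 0)) i\<bar>) \<le> (\<Sum>i<?n. \<bar>\<xi> i\<bar>)" by (intro sum_mono) auto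
        moreover have "(\<Sum>i<?n. \<bar>\<xi> i\<bar>) \<le> ?S" by (intro sum_le_suminf summ) auto
        ultimately show ?thesis
          by (elim order_trans) (intro divide_right_mono power_mono; simp add: sum_nonneg)
      qed
      ultimately show ?thesis
        by (simp only: abs_minus_cancel abs_mult) (rule mult_left_mono, simp_all)
    qed
    have lim0: "(\<lambda>N. \<bar>t (N + M)\<bar> * (?S ^ l / fact l)) \<longlonglongrightarrow> \<bar>- 0\<bar> * (?S ^ l / fact l)"
      unfolding t_def by (intro tendsto_intros LIMSEQ_ignore_initial_segment bal)
    have "(\<lambda>N. coeff (P N) k - coeff (rp 0 \<xi> {..<N + M}) k) \<longlonglongrightarrow> 0"
    proof (rule Lim_null_comparison)
      show "\<forall>\<^sub>F N in sequentially. norm (coeff (P N) k - coeff (rp 0 \<xi> {..<N + M}) k) \<le>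
          \<bar>t (N + M)\<bar> * (?S ^ l / fact l)"
        unfolding real_norm_def by (intro always_eventually allI bd)
      show "(\<lambda>N. \<bar>t (N + M)\<bar> * (?S ^ l / fact l)) \<longlonglongrightarrow> 0"
        using lim0 by (simp only: minus_zero abs_zero mult_zero_left)
    qed
    from tendsto_add[OF this LIMSEQ_ignore_initial_segment[OF h, of M]] show ?thesis by simp
  qed
  ultimately show thesis by (intro that[of P])
qed

text \<open>z times the \<open>q\<close>-derivative is the convolution with z
  \<open>R_inf q\<close>, whose partial products have non-positive zeros. The work lies in the order
  of vanishing at the origin, which the approximants must share with their limit.\<close>

lemma sep_seq_pd:
  assumes q: "0 < q" "q < 1" and a: "sep_seq q a"
  shows "sep_seq q (\<lambda>k. wt q (Suc k) * a (Suc k))"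
proof -
  obtain c m \<xi> where \<xi>: "canon q \<xi>" "\<And>k. (\<lambda>N. coeff (smult c (rp m \<xi> {..<N})) k) \<longlonglongrightarrow> a k"
    using a unfolding sep_seq_def by blast
  define K where "K = (\<lambda>N. rp (Suc 0) (geom q) {..<N})"
  define h where "h = (\<lambda>k. wt q k * a k)"
  have a_low: "a k = 0" if "k < m" for k
    using \<xi>(2)[of k] that by (simp add: coeff_rp[of m] LIMSEQ_const_iff)
  have a_m: "a m = c"
    using \<xi>(2)[of m] by (simp add: coeff_rp[of m] LIMSEQ_const_iff)
  have K: "(\<lambda>N. coeff (K N) k) \<longlonglongrightarrow> (case k of 0 \<Rightarrow> 0 | Suc j \<Rightarrow> 1 / cw q j)" for k
    using coeff_geom_tendsto[OF q] by (cases k) (simp_all add: K_def rp_Suc)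
  have lim: "(\<lambda>N. coeff (star q (P N) (K N)) k) \<longlonglongrightarrow> h k"
    if P: "\<And>k. (\<lambda>N. coeff (P N) k) \<longlonglongrightarrow> a k" for P k
  proof -
    have "(\<lambda>N. cw q k * coeff (P N) k * coeff (K N) k) \<longlonglongrightarrow>
        cw q k * a k * (case k of 0 \<Rightarrow> 0 | Suc j \<Rightarrow> 1 / cw q j)"
      by (intro tendsto_intros K P)
    moreover have "cw q k * a k * (case k of 0 \<Rightarrow> 0 | Suc j \<Rightarrow> 1 / cw q j) = h k"
      using cw_pos[of q] q by (cases k) (simp_all add: h_def cw_Suc less_imp_neq[symmetric])
    ultimately show ?thesis by simp
  qed
  have sep: "sep_poly q (star q P (K N))" if "sep_poly q P" for P N
    using star_sep_neg[OF q that neg_poly_geom] q by (simp add: K_def)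
  have seppart: "sep_poly q (smult c (rp m \<xi> {..<N}))" for N
    using sep_poly_rp[of q "{..<N}"] canon_psep[OF \<xi>(1)] q by simp
  have low: "coeff (star q P (K N)) 0 = 0" for P N
    by (simp add: K_def rp_Suc)
  \<comment> \<open>The cases locate the first non-zero coefficient of \<open>h\<close>: none, at m,
    at 1, or at 2. In the last case the partial products may have a non-zero coefficient at 1 that
    disappears only in the limit, and balanced approximants replace them.\<close>
  consider "\<forall>k\<ge>1. a k = 0" | "m > 0" "c \<noteq> 0" | "m = 0" "c \<noteq> 0" "a 1 \<noteq> 0" | "m = 0" "c \<noteq> 0" "a 1 = 0" "\<xi> 0 \<noteq> 0"
  proof (cases "c = 0")
    case True
    then show thesis using \<xi>(2) that(1) by (simp add: LIMSEQ_const_iff)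
  next
    case False
    have "a k = 0" if "\<xi> 0 = 0" "m = 0" "k \<ge> 1" for k
    proof -
      have "\<xi> i = 0" for i using \<xi>(1) that(1) unfolding canon_def by (metis abs_le_zero_iff abs_zero gr0I)
      then have "rp 0 \<xi> {..<N} = 1" for N :: nat by (simp add: rp_def one_pCons[symmetric])
      then show ?thesis using \<xi>(2)[of k] that by (cases k) (auto simp: LIMSEQ_const_iff)
    qed
    then have triv: "\<forall>k\<ge>1. a k = 0" if "m = 0" "\<xi> 0 = 0" using that by simp
    show thesis
    proof (cases "m = 0")
      case m: True
      show thesis
      proof (cases "a 1 = 0")
        case a1: True
        show thesis using that(1)[OF triv[OF m]] that(4)[OF m False a1] by (cases "\<xi> 0 = 0") simp_all
      qed (rule that(3)[OF m False])
    qed (use that(2) False in simp)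
  qed
  then have "sep_seq q h"
  proof cases
    case 1
    have "h k = 0" for k using 1 by (cases k) (simp_all add: h_def)
    then show ?thesis using sep_seq_0 by presburger
  next
    case 2
    show ?thesis
    proof (rule sep_seq_limit[OF q sep[OF seppart] lim[OF \<xi>(2)]])
      show "coeff (star q (smult c (rp m \<xi> {..<N})) (K N)) k = 0" if "k < m" for k N
        using that by (simp add: coeff_rp[of m])
      show "h m \<noteq> 0" using 2 wt_pos[of q m] q by (simp add: h_def a_m)
    qed
  next
    case 3
    show ?thesis
    proof (rule sep_seq_limit[OF q sep[OF seppart] lim[OF \<xi>(2)]])
      show "coeff (star q (smult c (rp m \<xi> {..<N})) (K N)) k = 0" if "k < 1" for k N
        using that low by simp
      show "h 1 \<noteq> 0" using 3 wt_pos[of q 1] q by (simp add: h_def)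
    qed
  next
    case 4
    have lim': "(\<lambda>N. coeff (rp 0 \<xi> {..<N}) k) \<longlonglongrightarrow> a k / c" for k
      using tendsto_divide[OF \<xi>(2)[of k] tendsto_const[of c]] 4 by simp
    have c1: "coeff (rp 0 \<xi> {..<n}) 1 = - (\<Sum>i<n. \<xi> i)" for n :: nat
      by (induction n) (simp_all add: coeff_rp_Suc coeff_1)
    have "(\<lambda>N. \<Sum>i<N. \<xi> i) \<longlonglongrightarrow> 0"
      using tendsto_minus[OF lim'[of 1]] 4 unfolding c1 by simp
    then obtain P where P: "\<And>N. sep_poly q (P N)" "\<And>N. coeff (P N) 1 = 0" "\<And>N. coeff (P N) 0 = 1"
      "\<And>k h. (\<lambda>N. coeff (rp 0 \<xi> {..<N}) k) \<longlonglongrightarrow> h \<Longrightarrow> (\<lambda>N. coeff (P N) k) \<longlonglongrightarrow> h"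
      using balanced_approximation[OF q \<xi>(1) 4(4)] by metis
    have P': "(\<lambda>N. coeff (smult c (P N)) k) \<longlonglongrightarrow> a k" for k
      using tendsto_mult[OF tendsto_const[of c] P(4)[OF lim'[of k]]] 4 by simp
    \<comment> \<open>As \<open>a 1 = 0\<close>, Newton's identity identifies the sum of squares
      with - 2 \<open>a 2\<close> / c; it is positive because \<open>\<xi> 0 \<noteq> 0\<close>, so
      \<open>a 2\<close> cannot vanish.\<close>
    have "(\<lambda>N. \<Sum>i<N. (\<xi> i)\<^sup>2) \<longlonglongrightarrow> (a 1 / c)\<^sup>2 - 2 * (a 2 / c)"
      unfolding sum_squares_rp[symmetric] by (intro tendsto_intros lim')
    moreover have "(\<xi> 0)\<^sup>2 \<le> (\<Sum>i<N. (\<xi> i)\<^sup>2)" if "N \<ge> 1" for N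
      using that by (intro member_le_sum) auto
    ultimately have "(\<xi> 0)\<^sup>2 \<le> (a 1 / c)\<^sup>2 - 2 * (a 2 / c)" by (intro LIMSEQ_le_const) auto
    then have "a 2 \<noteq> 0" using 4 by auto
    show ?thesis
    proof (rule sep_seq_limit[OF q sep[OF sep_poly_smult[OF P(1)]] lim[OF P']])
      show "coeff (star q (smult c (P N)) (K N)) k = 0" if "k < 2" for k N
        using that low P(2) by (auto simp: less_Suc_eq numeral_2_eq_2)
      show "h 2 \<noteq> 0" using \<open>a 2 \<noteq> 0\<close> wt_pos[of q 2] q by (simp add: h_def)
    qed
  qed
  moreover have "h 0 = 0" by (simp add: h_def)
  ultimately show ?thesis using sep_seq_shift_down[of q h] by (simp add: h_def)
qed

lemma power_bound_zero:
  fixes f :: "nat \<Rightarrow> real"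
  assumes "\<And>i n. \<bar>f i\<bar> ^ n * \<bar>f (i + n + 1)\<bar> \<le> \<bar>f (i + 1)\<bar> ^ (n + 1)"
    and "f i \<noteq> 0" "i \<le> j" "f j = 0" "j \<le> k"
  shows "f k = 0"
proof -
  define P where "P = (\<lambda>j. i \<le> j \<and> f j = 0)"
  define l where "l = (LEAST j. P j)"
  have "P j" using assms(3,4) by (simp add: P_def)
  then have l: "P l" "l \<le> j" unfolding l_def by (rule LeastI, rule Least_le)
  have "\<not> P n" if "n < l" for n using that unfolding l_def by (rule not_less_Least)
  note l = l this
  then have "l \<noteq> i" using assms(2) by (auto simp: P_def)
  then obtain l' where l': "l = Suc l'" "i \<le> l'" using l(1) by (cases l) (auto simp: P_def)
  then have ne: "f l' \<noteq> 0" using l(3)[of l'] by (simp add: P_def)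
  show ?thesis
  proof (cases "k = l")
    case True
    then show ?thesis using l(1) by (simp add: P_def)
  next
    case False
    then have "l' < k" using l(2) l' assms(5) by simp
    then obtain n where "k = l' + n + 1" using less_iff_Suc_add[of l' k] by auto
    then have "\<bar>f l'\<bar> ^ n * \<bar>f k\<bar> \<le> 0" using assms(1)[of l' n] l(1) l'(1) by (simp add: P_def)
    moreover have "\<bar>f l'\<bar> ^ n > 0" using ne by simp
    ultimately show ?thesis by (simp add: mult_le_0_iff)
  qed
qed

text \<open>Induction on the order l of the zero of b at the origin: a factor z of b turns into a
  \<open>q\<close>-derivative of a and an outer factor z. For l = 0 the lowest term of the
  convolutions sits at m. If it disappears because b is 0 at m, then b, whose support has no gaps,
  is 0 from m on, and the convolution vanishes altogether.\<close>

theorem sep_seq_star: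
  assumes q: "0 < q" "q < 1" and a: "sep_seq q a" and b: "neg_seq q b"
  shows "sep_seq q (\<lambda>k. cw q k * a k * b k)"
proof -
  obtain d l \<eta> where \<eta>: "canon q \<eta>" "\<forall>i. \<eta> i \<le> 0"
    "\<And>k. (\<lambda>N. coeff (smult d (rp l \<eta> {..<N})) k) \<longlonglongrightarrow> b k"
    using b unfolding neg_seq_def by blast
  show ?thesis using a \<eta>(3)
  proof (induction l arbitrary: a b)
    case 0
    obtain c m \<xi> where \<xi>: "canon q \<xi>" "\<And>k. (\<lambda>N. coeff (smult c (rp m \<xi> {..<N})) k) \<longlonglongrightarrow> a k"
      using 0(1) unfolding sep_seq_def by blast
    have a_low: "a k = 0" if "k < m" for k
      using \<xi>(2)[of k] that by (simp add: coeff_rp[of m] LIMSEQ_const_iff)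
    have a_m: "a m = c"
      using \<xi>(2)[of m] by (simp add: coeff_rp[of m] LIMSEQ_const_iff)
    have b_0: "b 0 = d"
      using 0(2)[of 0] by (simp add: LIMSEQ_const_iff)
    have neg: "neg_poly q (smult d (rp 0 \<eta> {..<N}))" for N
      unfolding neg_poly_def using \<eta> by blast
    have lim: "(\<lambda>N. coeff (star q (smult c (rp m \<xi> {..<N})) (smult d (rp 0 \<eta> {..<N}))) k)
      \<longlonglongrightarrow> cw q k * a k * b k" for k
      unfolding coeff_star by (intro tendsto_intros \<xi>(2) 0(2))
    have sep: "sep_poly q (star q (smult c (rp m \<xi> {..<N})) (smult d (rp 0 \<eta> {..<N})))" for N
      using sep_poly_rp[of q "{..<N}"] canon_psep[OF \<xi>(1)] q by (intro star_sep_neg neg) auto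
    show ?case
    proof (cases "c \<noteq> 0 \<and> b m \<noteq> 0")
      case True
      show ?thesis
      proof (rule sep_seq_limit[OF q sep lim])
        show "coeff (star q (smult c (rp m \<xi> {..<N})) (smult d (rp 0 \<eta> {..<N}))) k = 0" if "k < m" for k N
          using that by (simp add: coeff_rp[of m])
        show "cw q m * a m * b m \<noteq> 0" using True cw_pos[of q m] q a_m by simp
      qed
    next
      case False
      have "cw q k * a k * b k = 0" for k
      proof (cases "c = 0 \<or> k < m \<or> d = 0")
        case True
        then have "a k = 0 \<or> b k = 0"
          using a_low \<xi>(2)[of k] 0(2)[of k] by (auto simp: LIMSEQ_const_iff)
        then show ?thesis by auto
      next
        case nz: False
        have pb: "\<bar>cw q i * b i\<bar> ^ n * \<bar>cw q (i + n + 1) * b (i + n + 1)\<bar> \<le> \<bar>cw q (i + 1) * b (i + 1)\<bar> ^ (n + 1)" for i n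
          by (rule LIMSEQ_le[where X = "\<lambda>N. \<bar>cw q i * coeff (smult d (rp 0 \<eta> {..<N})) i\<bar> ^ n *
                \<bar>cw q (i + n + 1) * coeff (smult d (rp 0 \<eta> {..<N})) (i + n + 1)\<bar>"
              and Y = "\<lambda>N. \<bar>cw q (i + 1) * coeff (smult d (rp 0 \<eta> {..<N})) (i + 1)\<bar> ^ (n + 1)"])
            (intro tendsto_intros 0(2), intro tendsto_intros 0(2),
              intro exI allI impI neg_poly_power_bound neg, use q in auto)
        have "cw q k * b k = 0"
          using power_bound_zero[OF pb, of 0 m k] nz False b_0 by auto
        then show ?thesis by auto
      qed
      then have "(\<lambda>k. cw q k * a k * b k) = (\<lambda>_. 0)" by auto
      then show ?thesis by (simp only: sep_seq_0)
    qed
  next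
    case (Suc l)
    define a' where "a' = (\<lambda>k. wt q (Suc k) * a (Suc k))"
    have a': "sep_seq q a'" unfolding a'_def by (rule sep_seq_pd[OF q Suc.prems(1)])
    have "b 0 = 0" using Suc.prems(2)[of 0] by (simp add: rp_Suc LIMSEQ_const_iff)
    have "(\<lambda>N. coeff (smult d (rp l \<eta> {..<N})) k) \<longlonglongrightarrow> b (Suc k)" for k
      using Suc.prems(2)[of "Suc k"] by (simp add: rp_Suc)
    then have "sep_seq q (\<lambda>k. cw q k * a' k * b (Suc k))"
      by (rule Suc.IH[OF a'])
    from sep_seq_shift_up[OF this]
    have "sep_seq q (\<lambda>k. case k of 0 \<Rightarrow> 0 | Suc j \<Rightarrow> cw q j * a' j * b (Suc j))" .
    moreover have "(\<lambda>k. case k of 0 \<Rightarrow> 0 | Suc j \<Rightarrow> cw q j * a' j * b (Suc j)) = (\<lambda>k. cw q k * a k * b k)"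
      using \<open>b 0 = 0\<close> by (auto simp: fun_eq_iff a'_def cw_Suc split: nat.splits)
    ultimately show ?case by simp
  qed
qed

section \<open>Passage from q to a smaller base r\<close>

definition cmult_poly :: "(nat \<Rightarrow> real) \<Rightarrow> real poly \<Rightarrow> real poly" where
  "cmult_poly f P = (\<Sum>k\<le>degree P. monom (f k * coeff P k) k)"

lemma coeff_cmult_poly [simp]: "coeff (cmult_poly f P) k = f k * coeff P k"
proof -
  have "coeff (cmult_poly f P) k = (\<Sum>j\<le>degree P. if j = k then f j * coeff P j else 0)"
    by (simp add: cmult_poly_def coeff_sum)
  then show ?thesis
    by (auto simp: sum.delta coeff_eq_0 not_le)
qed

lemma degree_cmult_poly: "degree (cmult_poly f P) \<le> degree P"
  by (rule degree_le) (simp add: coeff_eq_0)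

lemma ev_cmult_power: "ev z (cmult_poly (\<lambda>k. r ^ k) P) = ev (of_real r * z) P"
  unfolding ev_altdef[OF degree_cmult_poly] ev_altdef[OF order_refl, of "of_real r * z"]
  by (simp add: power_mult_distrib mult_ac)

lemma ev_tendsto:
  assumes "\<And>N. degree (P N) \<le> D" "\<And>k. (\<lambda>N. coeff (P N) k) \<longlonglongrightarrow> coeff Q k"
  shows "(\<lambda>N. ev z (P N)) \<longlonglongrightarrow> ev z Q"
proof -
  have "degree Q \<le> D"
  proof (rule degree_le, intro allI impI)
    fix k assume "k > D"
    then have "coeff (P N) k = 0" for N using assms(1)[of N] by (intro coeff_eq_0) auto
    then show "coeff Q k = 0" using assms(2)[of k] by (simp add: LIMSEQ_const_iff)
  qed
  then show ?thesis
    unfolding ev_altdef[OF assms(1)] ev_altdef[OF \<open>degree Q \<le> D\<close>]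
    by (intro tendsto_intros assms)
qed

lemma canon_mono: "canon r \<xi> \<Longrightarrow> r \<le> q \<Longrightarrow> canon q \<xi>"
  unfolding canon_def by (meson abs_ge_zero mult_right_mono order_trans)

text \<open>With \<open>A\<close> and \<open>B\<close> the convolutions of \<open>L\<close> and of \<open>pd q L\<close> with \<open>R_inf r\<close> evaluated at \<open>r z\<close>, the
  functional equation \<open>R_inf r z = (1 + z) R_inf r (r z)\<close> turns the convolution of \<open>L\<close> with \<open>R_inf r\<close> into
  \<open>A + z B\<close>, and its value at \<open>r z\<close> is \<open>A\<close>.\<close>

theorem sep_poly_transfer:
  assumes r: "0 < r" "r < q" "q \<le> 1" and L: "sep_poly q L"
  shows "sep_poly r (cmult_poly (\<lambda>k. cw q k / cw r k) L)"
proof -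
  have q: "0 < q" "q \<le> 1" and r1: "r < 1" using r by auto
  obtain c m n \<xi> where L: "L = smult c (rp m \<xi> {..<n::nat})" "canon q \<xi>"
    using L unfolding sep_poly_def by blast
  \<comment> \<open>The partial products of \<open>R_inf r\<close> at r z. Their reciprocal zeros
    decrease by the factor r < q, so they are admissible second factors for the convolution with
    base q.\<close>
  define K where "K = (\<lambda>M. rp 0 (\<lambda>i. geom r (Suc i)) {..<M::nat})"
  define H where "H = cmult_poly (\<lambda>k. cw q k / cw r k) L"
  define HA where "HA = cmult_poly (\<lambda>k. r ^ k) H"
  \<comment> \<open>Division of H(z) - H(r z) by z; the coefficient of order 0 cancels in the
    difference.\<close>
  define HB where "HB = poly_shift 1 (H - HA)"
  have coeffK: "coeff (K M) k = r ^ k * coeff (rp 0 (geom r) {..<M}) k" for M k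
  proof (induction M arbitrary: k)
    case 0
    then show ?case by (cases k) (simp_all add: K_def coeff_1)
  next
    case (Suc M)
    then show ?case by (cases k) (simp_all add: K_def coeff_rp_Suc geom_def algebra_simps)
  qed
  have limK: "(\<lambda>M. coeff (K M) k) \<longlonglongrightarrow> r ^ k / cw r k" for k
    unfolding coeffK using tendsto_mult[OF tendsto_const coeff_geom_tendsto[OF r(1) r1]] by simp
  have degH: "degree (star q P M) \<le> degree P" for P M
    by (rule degree_le) (simp add: coeff_eq_0)
  have limA: "(\<lambda>M. ev z (star q L (K M))) \<longlonglongrightarrow> ev z HA" for z
  proof (rule ev_tendsto[OF degH])
    fix k
    have "(\<lambda>M. cw q k * coeff L k * coeff (K M) k) \<longlonglongrightarrow> cw q k * coeff L k * (r ^ k / cw r k)"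
      by (intro tendsto_intros limK)
    then show "(\<lambda>M. coeff (star q L (K M)) k) \<longlonglongrightarrow> coeff HA k" by (simp add: HA_def H_def mult_ac)
  qed
  have wtr: "wt r (Suc k) * r ^ k = 1 - r ^ Suc k" for k
    using r r1 by (simp add: wt_closed power_divide field_simps)
  have limB: "(\<lambda>M. ev z (star q (pd q L) (K M))) \<longlonglongrightarrow> ev z HB" for z
  proof (rule ev_tendsto[OF degH])
    fix k
    have "(\<lambda>M. cw q k * coeff (pd q L) k * coeff (K M) k) \<longlonglongrightarrow> cw q k * coeff (pd q L) k * (r ^ k / cw r k)"
      by (intro tendsto_intros limK)
    moreover have "cw q k * coeff (pd q L) k * (r ^ k / cw r k) = coeff HB k"
    proof -
      have pos: "wt r (Suc k) > 0" "cw r k > 0" using wt_pos[of r "Suc k"] cw_pos[of r k] r r1 by auto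
      have "coeff HB k = cw q (Suc k) * coeff L (Suc k) / cw r (Suc k) * (1 - r ^ Suc k)"
        by (simp add: HB_def HA_def H_def coeff_poly_shift algebra_simps diff_divide_distrib)
      also have "\<dots> = cw q k * wt q (Suc k) * coeff L (Suc k) / (cw r k * wt r (Suc k)) * (wt r (Suc k) * r ^ k)"
        unfolding wtr cw_Suc by simp
      also have "\<dots> = cw q k * coeff (pd q L) k * (r ^ k / cw r k)"
        using pos by simp
      finally show ?thesis by simp
    qed
    ultimately show "(\<lambda>M. coeff (star q (pd q L) (K M)) k) \<longlonglongrightarrow> coeff HB k" by simp
  qed
  have canonK: "canon q (\<lambda>i. geom r (Suc i))"
    using canon_geom[of r] r r1 canon_mono[of r _ q] unfolding canon_def by (auto simp: Suc_less_eq)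
  have neg: "Im (val q z (pd q L) (K M) * cnj (val q z L (K M))) \<le> 0" if z: "Im z > 0" for z M
  proof -
    let ?L = "rp m \<xi> {..<n}"
    have "Im (val q z (pd q ?L) (K M) * cnj (val q z ?L (K M))) \<le> 0"
      using val_pd_Im[OF q z, of "{..<n}" "{..<M}" \<xi> "\<lambda>i. geom r (Suc i)" m 0]
        canon_psep[OF L(2)] canon_psep[OF canonK] r unfolding K_def by (simp add: geom_def)
    then have "c\<^sup>2 * Im (val q z (pd q ?L) (K M) * cnj (val q z ?L (K M))) \<le> 0"
      by (intro mult_nonneg_nonpos) auto
    also have "c\<^sup>2 * Im (val q z (pd q ?L) (K M) * cnj (val q z ?L (K M))) =
        Im (of_real (c\<^sup>2) * (val q z (pd q ?L) (K M) * cnj (val q z ?L (K M))))"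
      by (simp only: Im_of_real_mult)
    also have "of_real (c\<^sup>2) * (val q z (pd q ?L) (K M) * cnj (val q z ?L (K M))) =
        val q z (pd q L) (K M) * cnj (val q z L (K M))"
      by (simp add: L(1) power2_eq_square mult_ac)
    finally show ?thesis .
  qed
  have "shrinks r H"
    unfolding shrinks_def
  proof (intro allI impI)
    fix u :: complex assume u: "Im u > 0"
    define z where "z = u / of_real r"
    have z: "Im z > 0" "u = of_real r * z" using u r by (simp_all add: z_def)
    have "Im (ev z HB * cnj (ev z HA)) \<le> 0"
      by (rule LIMSEQ_le_const2[where X = "\<lambda>M. Im (val q z (pd q L) (K M) * cnj (val q z L (K M)))"])
        (intro tendsto_intros limA limB, use neg z in blast)
    moreover have "H - HA = pCons 0 HB"
      by (rule poly_eqI) (simp add: HB_def coeff_pCons coeff_poly_shift HA_def split: nat.splits)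
    then have "ev z H = ev z HA + z * ev z HB"
      by (metis add.commute diff_add_cancel ev_add ev_pCons add_0 of_real_0)
    then have "Im (z * ev z HA * cnj (ev z H)) =
        Im z * (norm (ev z HA))\<^sup>2 - (norm z)\<^sup>2 * Im (ev z HB * cnj (ev z HA))"
      using Im_z_mult_cnj_diff[of z "ev z HA" "-1" "ev z HB"] by simp
    ultimately have "Im (z * ev z HA * cnj (ev z H)) \<ge> Im z * (norm (ev z HA))\<^sup>2"
      by (simp add: mult_nonneg_nonpos del: times_complex.sel)
    then have "r * (Im z * (norm (ev z HA))\<^sup>2) \<le> r * Im (z * ev z HA * cnj (ev z H))"
      using r by (intro mult_left_mono) auto
    moreover have "ev u H = ev z HA" unfolding HA_def ev_cmult_power z(2) ..
    moreover have "Im (u * ev z HA * cnj (ev z H)) = r * Im (z * ev z HA * cnj (ev z H))"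
      unfolding z(2) by (simp only: mult.assoc Im_of_real_mult)
    ultimately show "Im u * (norm (ev u H))\<^sup>2 \<le> Im (u * ev u H * cnj (ev (u / of_real r) H))"
      using z by (simp add: z_def[symmetric] mult.assoc del: times_complex.sel) (simp add: z(2))
  qed
  then show ?thesis using shrinks_imp_sep_poly r r1 unfolding H_def by blast
qed

subsection \<open>Entire functions with separated zeros\<close>

lemma taylor_of_power_series:
  assumes "\<And>z. (\<lambda>k. of_real (h k) * z ^ k) sums F z"
  shows "F holomorphic_on UNIV" "taylor F = fps_of_real_seq h"
proof -
  let ?f = "fps_of_real_seq h"
  have nth: "fps_nth ?f k = of_real (h k)" for k by (simp add: fps_of_real_seq_def)
  have rad: "fps_conv_radius ?f = \<infinity>"
    unfolding fps_conv_radius_def using assms by (intro conv_radius_inftyI'') (auto simp: nth sums_iff)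
  have F: "eval_fps ?f = F"
    unfolding eval_fps_def using assms by (auto simp: nth sums_iff fun_eq_iff)
  have "eval_fps ?f holomorphic_on UNIV" by (rule holomorphic_on_eval_fps) (simp add: rad)
  then show "F holomorphic_on UNIV" unfolding F .
  have "F has_fps_expansion ?f"
    unfolding has_fps_expansion_def F rad by simp
  then show "taylor F = ?f" by (rule fps_expansion_eqI)
qed

lemma power_series_of_taylor:
  assumes "F holomorphic_on UNIV"
  shows "(\<lambda>k. fps_nth (taylor F) k * z ^ k) sums F z"
  using holomorphic_power_series[of F 0 "norm z + 1" z] assms
  by (auto simp: fps_expansion_def intro: holomorphic_on_subset)

text \<open>Tannery's theorem interchanges the limit over partial products with summation over the
  coefficients; the majorant is an exponential series obtained from
  \<open>coeff_rp_bound\<close>.\<close>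

lemma prodinf_power_series:
  assumes summ: "summable (\<lambda>i. \<bar>\<xi> i\<bar>)"
    and h: "\<And>k. (\<lambda>N. coeff (smult c (rp m \<xi> {..<N})) k) \<longlonglongrightarrow> h k"
  shows "convergent_prod (\<lambda>j. 1 - of_real (\<xi> j) * z)"
    and "(\<lambda>k. of_real (h k) * z ^ k) sums (of_real c * z ^ m * (\<Prod>j. 1 - of_real (\<xi> j) * z :: complex))"
proof -
  let ?S = "\<Sum>i. \<bar>\<xi> i\<bar>"
  have "norm (1 - of_real (\<xi> j) * z - 1) = \<bar>\<xi> j\<bar> * norm z" for j
    by (simp add: norm_mult)
  then have "summable (\<lambda>j. norm (1 - of_real (\<xi> j) * z - 1))"
    by (simp only: summable_mult2[OF summ])
  then show conv: "convergent_prod (\<lambda>j. 1 - of_real (\<xi> j) * z)"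
    by (rule abs_convergent_prod_imp_convergent_prod[OF summable_imp_abs_convergent_prod])
  then have "(\<lambda>n. \<Prod>i<n. 1 - of_real (\<xi> i) * z) \<longlonglongrightarrow> (\<Prod>j. 1 - of_real (\<xi> j) * z)"
    using convergent_prod_LIMSEQ[OF conv]
      LIMSEQ_lessThan_iff_atMost[where f = "\<lambda>A. \<Prod>i\<in>A. 1 - of_real (\<xi> i) * z"] by simp
  then have lim1: "(\<lambda>N. ev z (smult c (rp m \<xi> {..<N}))) \<longlonglongrightarrow> of_real c * z ^ m * (\<Prod>j. 1 - of_real (\<xi> j) * z)"
    unfolding ev_smult ev_rp mult.assoc by (intro tendsto_intros)
  define g where "g = (\<lambda>N k. coeff (smult c (rp m \<xi> {..<N})) k)"
  define B where "B = (\<lambda>k. \<bar>c\<bar> * norm z ^ m * ((?S * norm z) ^ (k - m) / fact (k - m)))"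
  have S: "?S \<ge> 0" by (intro suminf_nonneg summ) simp
  have bd: "norm (of_real (g N k) * z ^ k) \<le> B k" for N k
  proof (cases "k < m")
    case True
    then show ?thesis using S by (simp add: g_def B_def coeff_rp[of m])
  next
    case False
    have "\<bar>coeff (rp 0 \<xi> {..<N}) (k - m)\<bar> \<le> (\<Sum>i<N. \<bar>\<xi> i\<bar>) ^ (k - m) / fact (k - m)"
      by (rule coeff_rp_bound)
    also have "\<dots> \<le> ?S ^ (k - m) / fact (k - m)"
      by (intro divide_right_mono power_mono sum_le_suminf summ sum_nonneg) auto
    finally have *: "\<bar>coeff (rp 0 \<xi> {..<N}) (k - m)\<bar> \<le> ?S ^ (k - m) / fact (k - m)" .
    have zk: "norm z ^ k = norm z ^ m * norm z ^ (k - m)" using False by (simp flip: power_add)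
    have "norm (of_real (g N k) * z ^ k) = \<bar>c\<bar> * (norm z ^ m * norm z ^ (k - m)) * \<bar>coeff (rp 0 \<xi> {..<N}) (k - m)\<bar>"
      using False by (simp add: g_def coeff_rp[of m] norm_mult norm_power abs_mult zk)
    also have "\<dots> \<le> \<bar>c\<bar> * (norm z ^ m * norm z ^ (k - m)) * (?S ^ (k - m) / fact (k - m))"
      by (intro mult_left_mono *) auto
    finally show ?thesis by (simp add: B_def power_mult_distrib mult_ac)
  qed
  have sB: "summable B"
  proof -
    have "summable (\<lambda>k. (\<bar>c\<bar> * norm z ^ m) * (inverse (fact k) * (?S * norm z) ^ k))"
      by (rule summable_mult[OF summable_exp])
    moreover have "inverse (fact k) * (?S * norm z) ^ k = (?S * norm z) ^ k / fact k" for k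
      by (simp add: divide_inverse mult.commute)
    ultimately have "summable (\<lambda>k. (\<bar>c\<bar> * norm z ^ m) * ((?S * norm z) ^ k / fact k))"
      by (simp only:)
    then have "summable (\<lambda>k. B (k + m))" by (simp add: B_def)
    then show ?thesis using summable_iff_shift by blast
  qed
  have lim: "(\<lambda>N. of_real (g N k) * z ^ k) \<longlonglongrightarrow> of_real (h k) * z ^ k" for k
    unfolding g_def by (intro tendsto_intros h)
  have T: "summable (\<lambda>k. norm (of_real (h k) * z ^ k)) \<and>
      (\<lambda>N. \<Sum>k. of_real (g N k) * z ^ k) \<longlonglongrightarrow> (\<Sum>k. of_real (h k) * z ^ k)"
  proof -
    have "\<forall>\<^sub>F (k, N) in sequentially \<times>\<^sub>F sequentially. norm (of_real (g N k) * z ^ k) \<le> B k"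
      using bd by (intro always_eventually) auto
    from tannerys_theorem[where a = "\<lambda>k N. of_real (g N k) * z ^ k" and F = sequentially, OF lim this sB]
    show ?thesis by simp
  qed
  have "(\<Sum>k. of_real (g N k) * z ^ k) = ev z (smult c (rp m \<xi> {..<N}))" for N
  proof -
    have "(\<Sum>k. of_real (g N k) * z ^ k) = (\<Sum>k\<le>degree (smult c (rp m \<xi> {..<N})). of_real (g N k) * z ^ k)"
      by (intro suminf_finite) (auto simp: g_def not_le intro!: coeff_eq_0)
    then show ?thesis by (simp only: ev_altdef[OF order_refl] g_def)
  qed
  then have "(\<lambda>N. ev z (smult c (rp m \<xi> {..<N}))) \<longlonglongrightarrow> (\<Sum>k. of_real (h k) * z ^ k)"
    using T by simp
  from LIMSEQ_unique[OF this lim1]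
  have "(\<Sum>k. of_real (h k) * z ^ k) = of_real c * z ^ m * (\<Prod>j. 1 - of_real (\<xi> j) * z)" .
  moreover have "summable (\<lambda>k. of_real (h k) * z ^ k)"
    by (rule summable_norm_cancel[OF conjunct1[OF T]])
  ultimately show "(\<lambda>k. of_real (h k) * z ^ k) sums (of_real c * z ^ m * (\<Prod>j. 1 - of_real (\<xi> j) * z))"
    by (simp only: sums_iff)
qed

text \<open>A geometric series summed without ordering the set: once the largest entry is removed,
  all others are at most q times it, and the induction continues with that bound in place of
  M.\<close>

lemma sep_finite_sum_bound:
  assumes q: "0 < q" "q < 1"
  shows "finite I \<Longrightarrow> psep q \<xi> I \<Longrightarrow> (\<forall>i\<in>I. \<forall>j\<in>I. \<xi> i * \<xi> j > 0) \<Longrightarrow> (\<forall>i\<in>I. \<bar>\<xi> i\<bar> \<le> M) \<Longrightarrow> M \<ge> 0 \<Longrightarrow>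
    (\<Sum>i\<in>I. \<bar>\<xi> i\<bar>) \<le> M / (1 - q)"
proof (induction "card I" arbitrary: I M)
  case 0
  then show ?case using q by auto
next
  case (Suc n)
  then have "I \<noteq> {}" by auto
  then obtain a where a: "a \<in> I" "\<And>i. i \<in> I \<Longrightarrow> \<bar>\<xi> i\<bar> \<le> \<bar>\<xi> a\<bar>"
    using ex_is_arg_min_if_finite[OF Suc.prems(1), of "\<lambda>i. - \<bar>\<xi> i\<bar>"]
    by (auto simp: is_arg_min_linorder)
  have "(\<Sum>i\<in>I - {a}. \<bar>\<xi> i\<bar>) \<le> (q * \<bar>\<xi> a\<bar>) / (1 - q)"
  proof (rule Suc.hyps(1))
    show "\<forall>i\<in>I - {a}. \<bar>\<xi> i\<bar> \<le> q * \<bar>\<xi> a\<bar>"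
    proof
      fix i assume i: "i \<in> I - {a}"
      then have "sep q (\<xi> i) (\<xi> a)" "\<xi> i * \<xi> a > 0" using Suc.prems a by (auto simp: psep_def)
      moreover have "\<xi> a \<noteq> 0" using calculation(2) by auto
      then have "\<bar>\<xi> a\<bar> > q * \<bar>\<xi> a\<bar>" using q by simp
      moreover have "q * \<bar>\<xi> i\<bar> \<le> q * \<bar>\<xi> a\<bar>" using a i q by (intro mult_left_mono) auto
      ultimately show "\<bar>\<xi> i\<bar> \<le> q * \<bar>\<xi> a\<bar>" unfolding sep_def by linarith
    qed
    show "n = card (I - {a})" using Suc.hyps(2) Suc.prems(1) a(1) by simp
    show "psep q \<xi> (I - {a})" using Suc.prems(2) psep_subset by blast
  qed (use Suc.prems q in auto)
  then have "(\<Sum>i\<in>I. \<bar>\<xi> i\<bar>) \<le> \<bar>\<xi> a\<bar> + (q * \<bar>\<xi> a\<bar>) / (1 - q)"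
    using Suc.prems(1) a(1) by (simp add: sum.remove)
  also have "\<dots> = \<bar>\<xi> a\<bar> / (1 - q)" using q by (simp add: field_simps)
  also have "\<dots> \<le> M / (1 - q)" using Suc.prems(4) a q by (intro divide_right_mono) auto
  finally show ?case .
qed

lemma psep_summable:
  fixes \<xi> :: "nat \<Rightarrow> real"
  assumes q: "0 < q" "q < 1" and \<xi>: "psep q \<xi> UNIV" "\<And>i. \<bar>\<xi> i\<bar> \<le> M"
  shows "summable (\<lambda>i. \<bar>\<xi> i\<bar>)"
proof (rule bounded_imp_summable)
  fix n
  have M: "M \<ge> 0" using \<xi>(2)[of 0] by linarith
  let ?P = "{i\<in>{..n}. \<xi> i > 0}" and ?N = "{i\<in>{..n}. \<xi> i < 0}"
  have "(\<Sum>i\<le>n. \<bar>\<xi> i\<bar>) = (\<Sum>i\<in>?P \<union> ?N. \<bar>\<xi> i\<bar>)"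
    by (intro sum.mono_neutral_right) auto
  also have "\<dots> = (\<Sum>i\<in>?P. \<bar>\<xi> i\<bar>) + (\<Sum>i\<in>?N. \<bar>\<xi> i\<bar>)"
    by (intro sum.union_disjoint) auto
  also have "\<dots> \<le> M / (1 - q) + M / (1 - q)"
    using \<xi> M psep_subset[OF \<xi>(1)]
    by (intro add_mono sep_finite_sum_bound[OF q])
      (auto simp: mult_neg_neg intro: abs_le_D1[OF \<xi>(2)] abs_le_D2[OF \<xi>(2)])
  finally show "(\<Sum>i\<le>n. \<bar>\<xi> i\<bar>) \<le> M / (1 - q) + M / (1 - q)" .
qed simp

text \<open>The given zeros come in arbitrary order, and the infinite product is never rearranged.
  Its partial products are \<open>sep_poly\<close>, and the limit theorem supplies a sorted sequence
  \<open>\<zeta>\<close> with the same coefficients.\<close>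

lemma sep_entire_seq:
  assumes q: "0 < q" "q < 1" and F: "F \<in> sep_entire q"
  obtains h where "taylor F = fps_of_real_seq h" "sep_seq q h" "F \<in> sep_entire_nonpos q \<Longrightarrow> neg_seq q h"
proof -
  obtain a m n x where holo: "F holomorphic_on UNIV" and sep: "q_separated q n x"
    and x0: "\<And>j. enat j < n \<Longrightarrow> x j \<noteq> 0" and "\<exists>\<delta>>0. \<forall>j. enat j < n \<longrightarrow> \<delta> \<le> \<bar>x j\<bar>"
    and prod: "\<And>z. F z = of_real a * z ^ m * (\<Prod>j. if enat j < n then 1 - z / of_real (x j) else 1)"
    using F unfolding sep_entire_def by blast
  then obtain \<delta> where \<delta>: "\<delta> > 0" "\<And>j. enat j < n \<Longrightarrow> \<delta> \<le> \<bar>x j\<bar>" by blast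
  define \<xi> where "\<xi> = (\<lambda>j. if enat j < n then 1 / x j else 0)"
  have fac: "(if enat j < n then 1 - z / of_real (x j) else 1) = 1 - of_real (\<xi> j) * z" for j and z :: complex
    by (simp add: \<xi>_def)
  have bd: "\<bar>\<xi> i\<bar> \<le> 1 / \<delta>" for i
    using \<delta>(1) \<delta>(2)[of i] x0[of i] by (auto simp: \<xi>_def frac_le)
  have key: "sep q (1 / x i) (1 / x j)"
    if ij: "i \<noteq> j" "enat i < n" "enat j < n" "\<bar>x i\<bar> \<le> \<bar>x j\<bar>" for i j
  proof (cases "x i * x j \<le> 0")
    case True
    then show ?thesis by (simp add: sep_def divide_le_0_iff)
  next
    case False
    have ne: "x i \<noteq> 0" "x j \<noteq> 0" using False by auto
    have "x j \<le> x i \<and> x i < 0 \<or> 0 < x i \<and> x i \<le> x j"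
      using False ij(4) by (auto simp: mult_le_0_iff)
    then have "x i / x j \<le> q" using sep ij unfolding q_separated_def by blast
    moreover have "x i / x j = \<bar>x i\<bar> / \<bar>x j\<bar>" using False by (auto simp: mult_le_0_iff abs_if)
    ultimately have "\<bar>1 / x j\<bar> \<le> q * \<bar>1 / x i\<bar>" using ne by (simp add: field_simps)
    then show ?thesis by (simp add: sep_def)
  qed
  have psep: "psep q \<xi> UNIV"
    unfolding psep_def
  proof (intro ballI impI)
    fix i j :: nat assume ij: "i \<noteq> j"
    show "sep q (\<xi> i) (\<xi> j)"
    proof (cases "enat i < n \<and> enat j < n")
      case True
      then show ?thesis using key[of i j] key[of j i] ij sep_commute[of q "1 / x i"]
        by (cases "\<bar>x i\<bar> \<le> \<bar>x j\<bar>") (auto simp: \<xi>_def)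
    qed (auto simp: \<xi>_def sep_def)
  qed
  have summ: "summable (\<lambda>i. \<bar>\<xi> i\<bar>)" by (rule psep_summable[OF q psep bd])
  obtain e where e: "\<And>k. (\<lambda>N. coeff (rp 0 \<xi> {..<N}) k) \<longlonglongrightarrow> e k"
    using coeff_rp_convergent[OF summ] unfolding convergent_def by metis
  define h where "h = (\<lambda>k. if k < m then 0 else a * e (k - m))"
  have h: "(\<lambda>N. coeff (smult a (rp m \<xi> {..<N})) k) \<longlonglongrightarrow> h k" for k
    by (auto simp: h_def coeff_rp[of m] intro!: tendsto_intros e)
  have ser: "(\<lambda>k. of_real (h k) * z ^ k) sums F z" for z
    using prodinf_power_series(2)[OF summ h, of z] unfolding prod fac .
  have e0: "e 0 = 1" using e[of 0] by (simp add: LIMSEQ_const_iff)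
  have sp: "sep_poly q (smult a (rp m \<xi> {..<N}))" for N
    using sep_poly_rp[of q "{..<N}" \<xi>] psep_subset[OF psep] q by simp
  have "sep_seq q h \<and> (F \<in> sep_entire_nonpos q \<longrightarrow> neg_seq q h)"
  proof (cases "a = 0")
    case True
    then have "h = (\<lambda>_. 0)" by (auto simp: h_def)
    moreover have "neg_seq q (\<lambda>_. 0)"
      unfolding neg_seq_def canon_def by (intro exI[of _ 0] exI[of _ "\<lambda>_. 0"]) auto
    ultimately show ?thesis using sep_seq_0 by simp
  next
    case False
    have "\<exists>\<zeta>. canon q \<zeta> \<and> ((\<forall>N. same_sign (coeff (smult a (rp m \<xi> {..<N})))) \<longrightarrow> (\<forall>i. \<zeta> i \<le> 0)) \<and>
        (\<forall>k. (\<lambda>N. coeff (smult (h m) (rp m \<zeta> {..<N})) k) \<longlonglongrightarrow> h k)"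
      by (rule sep_poly_limit[OF q sp h]) (auto simp: coeff_rp[of m] h_def False e0)
    then obtain \<zeta> where \<zeta>: "canon q \<zeta>" "(\<forall>N. same_sign (coeff (smult a (rp m \<xi> {..<N})))) \<longrightarrow> (\<forall>i. \<zeta> i \<le> 0)"
      "\<And>k. (\<lambda>N. coeff (smult (h m) (rp m \<zeta> {..<N})) k) \<longlonglongrightarrow> h k" by blast
    have "neg_seq q h" if N: "F \<in> sep_entire_nonpos q"
    proof -
      have "F \<noteq> (\<lambda>z. 0)"
      proof
        assume "F = (\<lambda>z. 0)"
        then have "taylor F = fps_of_real_seq (\<lambda>_. 0)"
          by (intro taylor_of_power_series(2)) simp
        then have "fps_of_real_seq h = fps_of_real_seq (\<lambda>_. 0)" using taylor_of_power_series(2)[OF ser] by simp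
        then have "fps_nth (fps_of_real_seq h) m = fps_nth (fps_of_real_seq (\<lambda>_. 0)) m" by simp
        then show False using False e0 by (simp add: fps_of_real_seq_def h_def)
      qed
      then have zeros: "\<And>z. F z = 0 \<Longrightarrow> z \<in> \<real>\<^sub>\<le>\<^sub>0" using N unfolding sep_entire_nonpos_def by blast
      \<comment> \<open>The partial products vanish at \<open>x j\<close> from index j on, so the
        infinite product does as well and \<open>x j\<close> is a zero of F.\<close>
      have neg: "\<xi> j \<le> 0" for j
      proof (cases "enat j < n")
        case True
        let ?z = "of_real (x j) :: complex"
        have "\<xi> j * x j = 1" using True x0 by (simp add: \<xi>_def)
        then have 0: "1 - of_real (\<xi> j) * ?z = 0" by (simp flip: of_real_mult)
        have "(\<lambda>N. \<Prod>i\<le>N. 1 - of_real (\<xi> i) * ?z) \<longlonglongrightarrow> (\<Prod>i. 1 - of_real (\<xi> i) * ?z)"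
          by (rule convergent_prod_LIMSEQ[OF prodinf_power_series(1)[OF summ h]])
        moreover have "\<forall>\<^sub>F N in sequentially. (\<Prod>i\<le>N. 1 - of_real (\<xi> i) * ?z) = 0"
          using eventually_ge_at_top[of j]
        proof eventually_elim
          case (elim N)
          show ?case by (rule prod_zero) (use 0 elim in auto)
        qed
        ultimately have "(\<Prod>i. 1 - of_real (\<xi> i) * ?z) = 0"
          by (rule LIMSEQ_unique[OF _ tendsto_eventually])
        then have "F ?z = 0" unfolding prod fac by simp
        then have "?z \<in> \<real>\<^sub>\<le>\<^sub>0" by (rule zeros)
        then have "x j \<le> 0" by simp
        then show ?thesis using True by (simp add: \<xi>_def)
      qed (simp add: \<xi>_def)
      have "coeff (rp m \<xi> {..<N}) k \<ge> 0" for N k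
        using neg by (intro coeff_rp_nonneg) auto
      then have "same_sign (coeff (smult a (rp m \<xi> {..<N})))" for N
        unfolding same_sign_def by (cases "a \<ge> 0") (auto simp: mult_nonpos_nonneg)
      then show ?thesis using \<zeta> unfolding neg_seq_def by blast
    qed
    then show ?thesis using \<zeta> sep_seqI by blast
  qed
  then show thesis using that taylor_of_power_series(2)[OF ser] by blast
qed

lemma sep_seq_entire:
  assumes q: "0 < q" "q < 1" and h: "sep_seq q h"
  obtains F where "F \<in> sep_entire q" "taylor F = fps_of_real_seq h"
    "\<And>z. (\<lambda>k. of_real (h k) * z ^ k) sums F z" "\<And>z. F z = 0 \<Longrightarrow> F = (\<lambda>_. 0) \<or> z \<in> \<real>"
proof -
  obtain c m \<xi> where \<xi>: "canon q \<xi>" "\<And>k. (\<lambda>N. coeff (smult c (rp m \<xi> {..<N})) k) \<longlonglongrightarrow> h k"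
    using h unfolding sep_seq_def by blast
  have summ: "summable (\<lambda>i. \<bar>\<xi> i\<bar>)" using canon_summable[OF \<xi>(1) q] .
  note ser = prodinf_power_series[OF summ \<xi>(2)]
  define F where "F = (\<lambda>z. of_real c * z ^ m * (\<Prod>j. 1 - of_real (\<xi> j) * z :: complex))"
  \<comment> \<open>By the sorting, all entries after the first 0 are 0, so the genuine zeros occupy
    an initial segment.\<close>
  define n where "n = (if \<exists>j. \<xi> j = 0 then enat (LEAST j. \<xi> j = 0) else \<infinity>)"
  define x where "x = (\<lambda>j. 1 / \<xi> j)"
  have n1: "\<xi> j \<noteq> 0" if "enat j < n" for j
    using that not_less_Least by (auto simp: n_def split: if_splits)
  have n2: "\<xi> j = 0" if "\<not> enat j < n" for j
  proof -
    have "\<exists>j. \<xi> j = 0" "(LEAST j. \<xi> j = 0) \<le> j"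
      using that by (auto simp: n_def split: if_splits)
    moreover have "\<xi> (LEAST j. \<xi> j = 0) = 0" using LeastI_ex[OF calculation(1)] .
    ultimately show ?thesis using \<xi>(1) unfolding canon_def
      by (metis abs_le_zero_iff abs_zero le_neq_implies_less)
  qed
  have ser': "(\<lambda>k. of_real (h k) * z ^ k) sums F z" for z
    using ser(2)[of z] by (simp add: F_def)
  have "F \<in> sep_entire q"
    unfolding sep_entire_def
  proof (intro CollectI conjI exI)
    show "F holomorphic_on UNIV" by (rule taylor_of_power_series(1)[OF ser'])
    show "q_separated q n x"
      unfolding q_separated_def
    proof (intro allI impI)
      fix k l assume *: "enat k < n \<and> enat l < n \<and> k \<noteq> l \<and> (x l \<le> x k \<and> x k < 0 \<or> 0 < x k \<and> x k \<le> x l)"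
      then have ne: "\<xi> k \<noteq> 0" "\<xi> l \<noteq> 0" using n1 by auto
      from * have "x k * x l > 0" and le: "\<bar>x k\<bar> \<le> \<bar>x l\<bar>"
        by (auto simp: zero_less_mult_iff)
      then have pos: "\<xi> k * \<xi> l > 0" by (simp add: x_def zero_less_divide_iff)
      from le have le': "\<bar>\<xi> l\<bar> \<le> \<bar>\<xi> k\<bar>" using ne by (simp add: x_def field_simps)
      have "\<bar>\<xi> l\<bar> \<le> q * \<bar>\<xi> k\<bar>"
      proof (cases "k < l")
        case True
        then show ?thesis using \<xi>(1) pos unfolding canon_def by (metis not_less)
      next
        case False
        then have "l < k" using * by auto
        then have "\<bar>\<xi> k\<bar> \<le> q * \<bar>\<xi> l\<bar>" using \<xi>(1) pos unfolding canon_def by (metis not_less mult.commute)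
        moreover have "q * \<bar>\<xi> l\<bar> < \<bar>\<xi> l\<bar>" using q ne by simp
        ultimately show ?thesis using le' by linarith
      qed
      moreover have "x k / x l = \<bar>\<xi> l\<bar> / \<bar>\<xi> k\<bar>" using pos by (auto simp: x_def zero_less_mult_iff)
      moreover have "\<bar>\<xi> l\<bar> / \<bar>\<xi> k\<bar> \<le> q" using calculation(1) ne by (simp add: divide_le_eq)
      ultimately show "x k / x l \<le> q" by (simp only:)
    qed
    show "\<forall>j. enat j < n \<longrightarrow> x j \<noteq> 0" using n1 by (simp add: x_def)
    have le0: "\<bar>\<xi> j\<bar> \<le> \<bar>\<xi> 0\<bar>" for j using \<xi>(1) unfolding canon_def by (cases "j = 0") auto
    \<comment> \<open>The largest reciprocal is at index 0; the summand 1 avoids division by 0 when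
      there are no zeros.\<close>
    show "1 / (\<bar>\<xi> 0\<bar> + 1) > 0" by (simp add: add_nonneg_pos)
    show "\<forall>j. enat j < n \<longrightarrow> 1 / (\<bar>\<xi> 0\<bar> + 1) \<le> \<bar>x j\<bar>"
    proof (intro allI impI)
      fix j assume "enat j < n"
      then have "\<bar>\<xi> j\<bar> > 0" using n1 by simp
      then show "1 / (\<bar>\<xi> 0\<bar> + 1) \<le> \<bar>x j\<bar>" using le0[of j] by (simp add: x_def frac_le)
    qed
    have "(if enat j < n then 1 - z / of_real (x j) else 1) = 1 - of_real (\<xi> j) * z" for j and z :: complex
      using n2[of j] by (simp add: x_def mult.commute)
    then show "\<forall>z. F z = of_real c * z ^ m * (\<Prod>j. if enat j < n then 1 - z / of_real (x j) else 1)"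
      by (simp add: F_def)
  qed
  moreover have "F = (\<lambda>_. 0) \<or> z \<in> \<real>" if "F z = 0" for z
  proof (cases "c = 0 \<or> z = 0")
    case False
    then have "(\<Prod>j. 1 - of_real (\<xi> j) * z) = 0" using that by (simp add: F_def)
    then obtain j where j: "1 - of_real (\<xi> j) * z = 0" using prodinf_nonzero[OF ser(1)] by blast
    then have "\<xi> j \<noteq> 0" by auto
    with j have "z = of_real (1 / \<xi> j)" by (simp add: field_simps)
    then show ?thesis by simp
  qed (auto simp: F_def)
  ultimately show thesis using that[of F] ser' taylor_of_power_series(2)[OF ser'] by blast
qed

lemma same_sign_sums_pos:
  assumes "same_sign h" "\<And>z::complex. (\<lambda>k. of_real (h k) * z ^ k) sums F z" "x > 0" "F (of_real x) = 0"
  shows "h k = 0"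
proof -
  have "(\<lambda>k. of_real (h k * x ^ k) :: complex) sums of_real 0"
    using assms(2)[of "of_real x"] assms(4) by simp
  then have s: "(\<lambda>k. h k * x ^ k) sums 0" by (subst (asm) sums_of_real_iff)
  show ?thesis
  proof (cases "\<forall>k. h k \<ge> 0")
    case True
    then have "h k * x ^ k = 0"
      using suminf_eq_zero_iff[of "\<lambda>k. h k * x ^ k"] s assms(3) by (auto simp: sums_iff)
    then show ?thesis using assms(3) by simp
  next
    case False
    then have "\<forall>k. h k \<le> 0" using assms(1) by (auto simp: same_sign_def)
    then have "- (h k * x ^ k) = 0"
      using suminf_eq_zero_iff[of "\<lambda>k. - (h k * x ^ k)"] sums_minus[OF s] assms(3)
      by (auto simp: sums_iff mult_nonpos_nonneg)
    then show ?thesis using assms(3) by simp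
  qed
qed

lemma sep_seq_same_sign_entire:
  assumes q: "0 < q" "q < 1" and h: "sep_seq q h" "same_sign h"
  shows "fps_of_real_seq h \<in> taylor ` sep_entire_nonpos q"
proof -
  obtain F where F: "F \<in> sep_entire q" "taylor F = fps_of_real_seq h"
    "\<And>z. (\<lambda>k. of_real (h k) * z ^ k) sums F z" "\<And>z. F z = 0 \<Longrightarrow> F = (\<lambda>_. 0) \<or> z \<in> \<real>"
    using sep_seq_entire[OF q h(1)] by metis
  have "F = (\<lambda>_. 0) \<or> z \<in> \<real>\<^sub>\<le>\<^sub>0" if z: "F z = 0" for z
  proof (cases "F = (\<lambda>_. 0)")
    case False
    then obtain x where x: "z = of_real x" using F(4)[OF z] by (auto elim: Reals_cases)
    have "x \<le> 0"
    proof (rule ccontr)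
      assume "\<not> x \<le> 0"
      then have "h k = 0" for k using same_sign_sums_pos[OF h(2) F(3), of x k] z x by simp
      then have "F w = 0" for w using F(3)[of w] by (simp add: sums_iff)
      then show False using False by auto
    qed
    then show ?thesis using x by simp
  qed simp
  then have "F \<in> sep_entire_nonpos q" using F(1) unfolding sep_entire_nonpos_def by auto
  then show ?thesis using F(2) by (metis imageI)
qed

subsection \<open>The case \<open>q = 1\<close>\<close>

lemma uniform_limit_of_bound:
  assumes "\<And>n z. z \<in> S \<Longrightarrow> dist (f n z) (g z) \<le> e n" "e \<longlonglongrightarrow> (0::real)"
  shows "uniform_limit S f g sequentially"
proof (rule uniform_limitI)
  fix \<epsilon> :: real assume "\<epsilon> > 0"
  then have "\<forall>\<^sub>F n in sequentially. e n < \<epsilon>" using order_tendstoD(2)[OF assms(2)] by blast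
  then show "\<forall>\<^sub>F n in sequentially. \<forall>z\<in>S. dist (f n z) (g z) < \<epsilon>"
    by (rule eventually_mono) (use assms(1) in \<open>meson le_less_trans\<close>)
qed

lemma ev_uniform_limit:
  assumes "\<And>N. degree (P N) \<le> D" "degree Q \<le> D" "\<And>k. (\<lambda>N. coeff (P N) k) \<longlonglongrightarrow> coeff Q k" "compact K"
  shows "uniform_limit K (\<lambda>N z. ev z (P N)) (\<lambda>z. ev z Q) sequentially"
proof -
  obtain R where R: "\<And>z. z \<in> K \<Longrightarrow> norm z \<le> R"
    using compact_imp_bounded[OF assms(4)] unfolding bounded_iff by blast
  show ?thesis
  proof (rule uniform_limit_of_bound)
    fix N z assume z: "z \<in> K"
    have "dist (ev z (P N)) (ev z Q) = norm (\<Sum>k\<le>D. of_real (coeff (P N) k - coeff Q k) * z ^ k)"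
      unfolding dist_norm ev_altdef[OF assms(1)] ev_altdef[OF assms(2)] sum_subtractf[symmetric]
      by (simp add: left_diff_distrib)
    also have "\<dots> \<le> (\<Sum>k\<le>D. \<bar>coeff (P N) k - coeff Q k\<bar> * R ^ k)"
      using R[OF z] by (intro sum_norm_le) (auto simp: norm_mult norm_power simp flip: of_real_diff
        intro!: mult_left_mono power_mono)
    finally show "dist (ev z (P N)) (ev z Q) \<le> (\<Sum>k\<le>D. \<bar>coeff (P N) k - coeff Q k\<bar> * R ^ k)" .
  next
    have "(\<lambda>N. \<Sum>k\<le>D. \<bar>coeff (P N) k - coeff Q k\<bar> * R ^ k) \<longlonglongrightarrow> (\<Sum>k\<le>D. \<bar>coeff Q k - coeff Q k\<bar> * R ^ k)"
      by (intro tendsto_intros assms(3))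
    then show "(\<lambda>N. \<Sum>k\<le>D. \<bar>coeff (P N) k - coeff Q k\<bar> * R ^ k) \<longlonglongrightarrow> 0" by simp
  qed
qed

lemma nonvanishing_limit:
  assumes holo: "\<And>n. F n holomorphic_on UNIV" "G holomorphic_on UNIV"
    and ul: "\<And>K. compact K \<Longrightarrow> uniform_limit K F G sequentially"
    and nz: "\<And>n z. Im z > 0 \<Longrightarrow> F n z \<noteq> 0" and z0: "Im z0 > 0" "G z0 = 0" and z: "Im z > 0"
  shows "G z = 0"
proof (rule ccontr)
  assume Gz: "G z \<noteq> 0"
  let ?S = "{z. Im z > 0}"
  have "G z0 \<noteq> 0"
  proof (rule Hurwitz_no_zeros[of ?S F G])
    show "open ?S" "connected ?S"
      by (auto simp: open_halfspace_Im_gt convex_halfspace_Im_gt intro: convex_connected)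
    show "\<not> G constant_on ?S"
    proof
      assume "G constant_on ?S"
      then obtain c where "\<And>x. Im x > 0 \<Longrightarrow> G x = c" unfolding constant_on_def by auto
      then show False using z0 z Gz by metis
    qed
  qed (use assms in \<open>auto intro: holomorphic_on_subset\<close>)
  then show False using z0 by simp
qed

text \<open>With bounded degree, coefficientwise convergence is uniform on compact sets and
  Hurwitz's theorem applies: a zero of Q in the upper half-plane would make Q vanish on all of
  it.\<close>

lemma real_rooted_limit:
  assumes "\<And>N. P N = 0 \<or> real_rooted (P N)" "\<And>N. degree (P N) \<le> D"
    and lim: "\<And>k. (\<lambda>N. coeff (P N) k) \<longlonglongrightarrow> coeff Q k"
  shows "Q = 0 \<or> real_rooted Q"
proof (rule disjCI)
  assume "\<not> real_rooted Q"
  then obtain z0 where z0: "Im z0 > 0" "ev z0 Q = 0" unfolding real_rooted_def by blast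
  show "Q = 0"
  proof (rule ccontr)
    assume Q: "Q \<noteq> 0"
    then have "\<forall>\<^sub>F N in sequentially. coeff (P N) (degree Q) \<noteq> 0"
      using tendsto_imp_eventually_ne[OF lim] by simp
    then obtain N0 where "\<And>N. N \<ge> N0 \<Longrightarrow> coeff (P N) (degree Q) \<noteq> 0"
      by (auto simp: eventually_sequentially)
    then have "P (N + N0) \<noteq> 0" for N by (metis coeff_0 le_add2)
    then have rr: "real_rooted (P (N + N0))" for N using assms(1) by blast
    have "degree Q \<le> D"
    proof (rule degree_le, intro allI impI)
      fix k assume "k > D"
      then have "coeff (P N) k = 0" for N using assms(2)[of N] by (intro coeff_eq_0) auto
      then show "coeff Q k = 0" using lim[of k] by (simp add: LIMSEQ_const_iff)
    qed
    then have ul: "uniform_limit K (\<lambda>N z. ev z (P (N + N0))) (\<lambda>z. ev z Q) sequentially" if "compact K" for K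
      using LIMSEQ_ignore_initial_segment[OF lim] assms(2) that by (intro ev_uniform_limit[of _ D])
    have zero: "ev z Q = 0" if z: "Im z > 0" for z
      by (rule nonvanishing_limit[OF _ _ ul _ z0 z])
        (use rr in \<open>auto simp: real_rooted_def intro!: holomorphic_intros\<close>)
    have "infinite ((\<lambda>n. \<i> * of_nat (Suc n)) ` UNIV :: complex set)"
      by (rule range_inj_infinite) (auto simp: inj_on_def)
    moreover have "(\<lambda>n. \<i> * of_nat (Suc n)) ` UNIV \<subseteq> {z. ev z Q = 0}" using zero by auto
    ultimately show False using finite_ev_roots[OF Q] finite_subset by blast
  qed
qed

lemma coeff_mult_tendsto:
  assumes "\<And>k. (\<lambda>N. coeff (A N) k) \<longlonglongrightarrow> coeff A' k" "\<And>k. (\<lambda>N. coeff (B N) k) \<longlonglongrightarrow> coeff B' k"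
  shows "(\<lambda>N. coeff (A N * B N) k) \<longlonglongrightarrow> coeff (A' * B' :: real poly) k"
  unfolding coeff_mult by (intro tendsto_intros assms)

lemma sep_1: "sep 1 x y"
  by (auto simp: sep_def)

lemma psep_1: "psep 1 \<xi> I"
  by (simp add: psep_def sep_1)

text \<open>Moves an m-fold zero from 0 to - \<open>\<epsilon>\<close>, since
  \<open>val_rp_nonzero\<close> requires constant terms. The disjoint sum of index sets joins the
  new zeros to the old ones.\<close>

lemma shift_origin_zeros:
  assumes "\<epsilon> > 0"
  shows "[:\<epsilon>, 1:] ^ m * rp 0 \<xi> {..<n::nat} =
    smult (\<epsilon> ^ m) (rp 0 (case_sum \<xi> (\<lambda>_::nat. - 1 / \<epsilon>)) ({..<n} <+> {..<m}))"
proof -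
  have "[:\<epsilon>, 1:] = smult \<epsilon> [:1, - (- 1 / \<epsilon>):]" using assms by simp
  then have "[:\<epsilon>, 1:] ^ m = smult (\<epsilon> ^ m) (\<Prod>i<m. [:1, - (- 1 / \<epsilon>):])"
    by (simp only: smult_power prod_constant card_lessThan)
  then show ?thesis unfolding rp_def
    by (simp add: prod.Plus mult.commute)
qed

text \<open>Zeros at the origin are moved slightly to the left, which keeps them admissible in both
  factors. The convolution then has no zero in the upper half-plane, and the degrees stay bounded on
  the way back. The limit may be 0, as for factors with disjoint supports.\<close>

lemma real_rooted_star:
  assumes P: "real_rooted P" "P \<noteq> 0" and K: "real_rooted K" "K \<noteq> 0" "same_sign (coeff K)"
  shows "star 1 P K = 0 \<or> real_rooted (star 1 P K)"
proof -
  obtain c m and n :: nat and \<xi> where P: "c \<noteq> 0" "P = smult c (rp m \<xi> {..<n})"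
    using real_rooted_factor[OF P(2,1)] by blast
  obtain d l and n' :: nat and \<eta> where K': "d \<noteq> 0" "K = smult d (rp l \<eta> {..<n'})"
    using real_rooted_factor[OF K(2,1)] by blast
  have neg: "\<eta> i \<le> 0" if "i < n'" for i
    using same_sign_rp_nonpos[of d l \<eta> "{..<n'}" i] K(3) K' that by auto
  define e where "e = (\<lambda>N. inverse (real (Suc N)))"
  have e: "e N > 0" for N by (simp add: e_def)
  have e0: "e \<longlonglongrightarrow> 0" unfolding e_def by (rule LIMSEQ_inverse_real_of_nat)
  define PN where "PN = (\<lambda>m (\<xi> :: nat \<Rightarrow> real) n N. [:e N, 1:] ^ m * rp 0 \<xi> {..<n::nat})"
  have lin: "(\<lambda>N. coeff [:e N, 1:] k) \<longlonglongrightarrow> coeff [:0, 1:] k" for k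
    using e0 by (cases k) (auto simp: coeff_pCons split: nat.splits)
  have pow: "(\<lambda>N. coeff ([:e N, 1:] ^ m) k) \<longlonglongrightarrow> coeff ([:0, 1:] ^ m) k" for m k
  proof (induction m arbitrary: k)
    case (Suc m)
    show ?case unfolding power_Suc by (rule coeff_mult_tendsto[OF lin Suc])
  qed simp
  have mon: "[:0, 1:] ^ m = (monom 1 m :: real poly)" for m
    by (induction m) (simp_all add: monom_0 monom_Suc one_pCons)
  have lim: "(\<lambda>N. coeff (PN m \<xi> n N) k) \<longlonglongrightarrow> coeff (rp m \<xi> {..<n}) k" for m \<xi> n k
    using coeff_mult_tendsto[OF pow[of m] tendsto_const, of "rp 0 \<xi> {..<n}" k]
    by (simp add: PN_def mon rp_def)
  have "star 1 (rp m \<xi> {..<n}) (rp l \<eta> {..<n'}) = 0 \<or> real_rooted (star 1 (rp m \<xi> {..<n}) (rp l \<eta> {..<n'}))"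
  proof (rule real_rooted_limit)
    fix N
    have "real_rooted (star 1 (PN m \<xi> n N) (PN l \<eta> n' N))"
      unfolding real_rooted_def
    proof (intro allI impI)
      fix z :: complex assume z: "Im z > 0"
      have "val 1 z (rp 0 (case_sum \<xi> (\<lambda>_::nat. - 1 / e N)) ({..<n} <+> {..<m}))
          (rp 0 (case_sum \<eta> (\<lambda>_::nat. - 1 / e N)) ({..<n'} <+> {..<l})) \<noteq> 0"
        using z neg e[of N] by (intro val_rp_nonzero psep_1) (auto simp: divide_nonpos_pos)
      then show "ev z (star 1 (PN m \<xi> n N) (PN l \<eta> n' N)) \<noteq> 0"
        unfolding PN_def shift_origin_zeros[OF e] using e[of N] by simp
    qed
    then show "star 1 (PN m \<xi> n N) (PN l \<eta> n' N) = 0 \<or> real_rooted (star 1 (PN m \<xi> n N) (PN l \<eta> n' N))" ..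
  next
    fix N
    have "degree (star 1 (PN m \<xi> n N) (PN l \<eta> n' N)) \<le> degree (PN m \<xi> n N)"
      by (rule degree_le) (simp add: coeff_eq_0)
    also have "\<dots> \<le> degree ([:e N, 1:] ^ m) + degree (rp 0 \<xi> {..<n})"
      unfolding PN_def by (rule degree_mult_le)
    also have "\<dots> \<le> m + degree (rp 0 \<xi> {..<n})"
      using degree_power_le[of "[:e N, 1:]" m] by simp
    finally show "degree (star 1 (PN m \<xi> n N) (PN l \<eta> n' N)) \<le> m + degree (rp 0 \<xi> {..<n})" .
  next
    fix k
    show "(\<lambda>N. coeff (star 1 (PN m \<xi> n N) (PN l \<eta> n' N)) k) \<longlonglongrightarrow>
        coeff (star 1 (rp m \<xi> {..<n}) (rp l \<eta> {..<n'})) k"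
      unfolding coeff_star by (intro tendsto_intros lim)
  qed
  then show ?thesis
    unfolding P K' using P(1) K'(1) by (auto simp: real_rooted_def)
qed

text \<open>\<open>(1 + z / N) ^ N\<close>\<close>

definition exp_poly :: "nat \<Rightarrow> real poly" where
  "exp_poly N = rp 0 (\<lambda>_. - (1 / real N)) {..<N}"

lemma coeff_exp_poly: "coeff (exp_poly N) k = real (N choose k) / real N ^ k"
proof (cases "k \<le> N")
  case True
  then show ?thesis
    using coeff_linear_poly_power[of k N 1 "1 / real N"]
    by (simp add: exp_poly_def rp_def power_divide)
next
  case False
  have "degree (exp_poly N) \<le> N * 1"
    unfolding exp_poly_def rp_def using degree_power_le[of "[:1, 1 / real N:]" N]
    by (auto intro: order_trans)
  then show ?thesis using False by (simp add: coeff_eq_0)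
qed

lemma degree_exp_poly: "degree (exp_poly N) \<le> N"
  by (rule degree_le) (simp add: coeff_exp_poly)

lemma coeff_exp_poly_nonneg: "coeff (exp_poly N) k \<ge> 0"
  by (simp add: coeff_exp_poly)

lemma coeff_exp_poly_le: "fact k * coeff (exp_poly N) k \<le> 1"
proof -
  have "coeff (exp_poly N) k \<le> (\<Sum>i<N. \<bar>- (1 / real N)\<bar>) ^ k / fact k"
    unfolding exp_poly_def by (rule order_trans[OF abs_ge_self coeff_rp_bound])
  also have "\<dots> \<le> 1 / fact k"
    by (intro divide_right_mono power_le_one) auto
  finally show ?thesis by (simp add: field_simps)
qed

lemma coeff_exp_poly_tendsto: "(\<lambda>N. fact k * coeff (exp_poly N) k) \<longlonglongrightarrow> 1"
proof (induction k)
  case 0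
  show ?case by (simp add: exp_poly_def)
next
  case (Suc k)
  have rec: "fact (Suc k) * coeff (exp_poly N) (Suc k) =
      (fact k * coeff (exp_poly N) k) * (1 - real k * inverse (real N))" if N: "N > 0" for N
  proof (cases "k \<le> N")
    case True
    have "Suc k * (N choose Suc k) = (N - k) * (N choose k)"
      using binomial_absorption[of k N] binomial_absorb_comp[of N k] by simp
    then have *: "real (Suc k) * real (N choose Suc k) = (real N - real k) * real (N choose k)"
      using True by (metis of_nat_mult of_nat_diff)
    have "fact (Suc k) * coeff (exp_poly N) (Suc k) =
        fact k * (real (Suc k) * real (N choose Suc k)) / real N ^ Suc k"
      by (simp add: coeff_exp_poly)
    also have "\<dots> = (fact k * coeff (exp_poly N) k) * (1 - real k * inverse (real N))"
      unfolding * using N by (simp add: coeff_exp_poly field_simps)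
    finally show ?thesis .
  next
    case False
    then have "N < k" "N < Suc k" by simp_all
    then show ?thesis by (simp add: coeff_exp_poly binomial_eq_0 del: binomial_Suc_Suc)
  qed
  have "(\<lambda>N. (fact k * coeff (exp_poly N) k) * (1 - real k * inverse (real N))) \<longlonglongrightarrow> 1 * (1 - real k * 0)"
    by (intro tendsto_intros Suc lim_inverse_n)
  then have "(\<lambda>N. (fact k * coeff (exp_poly N) k) * (1 - real k * inverse (real N))) \<longlonglongrightarrow> 1" by simp
  moreover have "\<forall>\<^sub>F N in sequentially. fact (Suc k) * coeff (exp_poly N) (Suc k) =
      (fact k * coeff (exp_poly N) k) * (1 - real k * inverse (real N))"
    using eventually_gt_at_top[of 0] by (rule eventually_mono) (rule rec)
  ultimately show ?case using tendsto_cong by fast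
qed

lemma real_rooted_exp_poly: "real_rooted (exp_poly N)" "exp_poly N \<noteq> 0" "same_sign (coeff (exp_poly N))"
  using real_rooted_rp[of 1 "{..<N}" 0 "\<lambda>_. - (1 / real N)"] coeff_exp_poly_nonneg
  by (auto simp: exp_poly_def same_sign_def rp_def)

text \<open>The Jensen polynomials of the series h, equal to its convolution at q = 1 with (1 +
  z/N)^N.\<close>

definition jensen :: "(nat \<Rightarrow> real) \<Rightarrow> nat \<Rightarrow> real poly" where
  "jensen h N = cmult_poly (\<lambda>k. fact k * h k) (exp_poly N)"

lemma coeff_jensen: "coeff (jensen h N) k = h k * (fact k * coeff (exp_poly N) k)"
  by (simp add: jensen_def)

lemma jensen_tendsto: "(\<lambda>N. coeff (jensen h N) k) \<longlonglongrightarrow> h k"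
  unfolding coeff_jensen using tendsto_mult[OF tendsto_const coeff_exp_poly_tendsto, of "h k" k] by simp

text \<open>Convolution with \<open>exp_poly N\<close> cuts every degree down to N, so the limit
  theorem for bounded degree applies although the degrees of \<open>P n\<close> may be
  unbounded.\<close>

lemma jensen_real_rooted:
  assumes "\<And>n. P n = 0 \<or> real_rooted (P n)" "\<And>k. (\<lambda>n. coeff (P n) k) \<longlonglongrightarrow> h k"
  shows "jensen h N = 0 \<or> real_rooted (jensen h N)"
proof (rule real_rooted_limit)
  show "star 1 (P n) (exp_poly N) = 0 \<or> real_rooted (star 1 (P n) (exp_poly N))" for n
    using assms(1)[of n] real_rooted_star real_rooted_exp_poly by (cases "P n = 0") auto
  show "degree (star 1 (P n) (exp_poly N)) \<le> N" for n
    using degree_exp_poly[of N] by (intro degree_le) (auto simp: coeff_eq_0)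
  show "(\<lambda>n. coeff (star 1 (P n) (exp_poly N)) k) \<longlonglongrightarrow> coeff (jensen h N) k" for k
  proof -
    have "(\<lambda>n. cw 1 k * coeff (P n) k * coeff (exp_poly N) k) \<longlonglongrightarrow> cw 1 k * h k * coeff (exp_poly N) k"
      by (intro tendsto_intros assms)
    then show ?thesis by (simp add: coeff_jensen cw_one mult_ac)
  qed
qed

section \<open>Closures of real-rooted polynomials in terms of coefficients\<close>

definition roots_in :: "complex set \<Rightarrow> real poly \<Rightarrow> bool" where
  "roots_in A p \<longleftrightarrow> p = 0 \<or> (\<forall>z. ev z p = 0 \<longrightarrow> z \<in> A)"

lemma real_poly_zeros_in_altdef: "real_poly_zeros_in A = {(\<lambda>z. ev z p) |p. roots_in A p}"
  unfolding real_poly_zeros_in_def roots_in_def ev_def by blast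

lemma roots_in_Reals: "roots_in \<real> p \<longleftrightarrow> p = 0 \<or> real_rooted p"
proof
  assume "roots_in \<real> p"
  then show "p = 0 \<or> real_rooted p"
    unfolding roots_in_def real_rooted_def by (metis complex_is_Real_iff less_irrefl)
next
  assume "p = 0 \<or> real_rooted p"
  then show "roots_in \<real> p"
    unfolding roots_in_def using real_rooted_imp_real complex_is_Real_iff by blast
qed

lemma roots_in_nonpos_Reals: "roots_in \<real>\<^sub>\<le>\<^sub>0 p \<longleftrightarrow> roots_in \<real> p \<and> same_sign (coeff p)"
proof
  assume p: "roots_in \<real>\<^sub>\<le>\<^sub>0 p"
  then have real: "roots_in \<real> p" unfolding roots_in_def by (auto simp: nonpos_Reals_def)
  show "roots_in \<real> p \<and> same_sign (coeff p)"
  proof (cases "p = 0")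
    case False
    then have "real_rooted p" using real by (simp add: roots_in_Reals)
    then obtain c m and n :: nat and \<xi> where f: "p = smult c (rp m \<xi> {..<n})" "\<forall>i<n. \<xi> i \<noteq> 0"
      using real_rooted_factor[OF False] by blast
    have "\<xi> i \<le> 0" if i: "i < n" for i
    proof -
      have "poly (rp m \<xi> {..<n}) (1 / \<xi> i) = 0"
        unfolding rp_def using i f(2) by (auto simp: poly_prod intro!: bexI[of _ i])
      then have "ev (of_real (1 / \<xi> i)) p = 0" unfolding f(1) ev_of_real by simp
      then have "of_real (1 / \<xi> i) \<in> (\<real>\<^sub>\<le>\<^sub>0 :: complex set)" using p False unfolding roots_in_def by blast
      then show ?thesis by (simp del: of_real_divide)
    qed
    then have "coeff (rp m \<xi> {..<n}) k \<ge> 0" for k by (intro coeff_rp_nonneg) auto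
    then have "same_sign (coeff p)"
      unfolding same_sign_def f(1) by (cases "c \<ge> 0") (auto simp: mult_nonpos_nonneg)
    then show ?thesis using real by simp
  qed (simp add: roots_in_def same_sign_def)
next
  assume p: "roots_in \<real> p \<and> same_sign (coeff p)"
  show "roots_in \<real>\<^sub>\<le>\<^sub>0 p"
    unfolding roots_in_def
  proof (cases "p = 0")
    case nz: False
    show "p = 0 \<or> (\<forall>z. ev z p = 0 \<longrightarrow> z \<in> \<real>\<^sub>\<le>\<^sub>0)"
    proof (intro disjI2 allI impI)
    fix z assume z: "ev z p = 0"
    then have "z \<in> \<real>" using p nz unfolding roots_in_def by blast
    then obtain x where x: "z = of_real x" by (rule Reals_cases)
    then have "poly p x = 0" using z by (simp add: ev_of_real)
    then have "x \<le> 0" using same_sign_poly_pos[of p x] p nz by (cases "x > 0") auto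
    then show "z \<in> \<real>\<^sub>\<le>\<^sub>0" using x by simp
    qed
  qed simp
qed

lemma fps_nth_taylor_ev: "fps_nth (taylor (\<lambda>z. ev z p)) k = of_real (coeff p k)"
proof -
  have "(\<lambda>k. of_real (coeff p k) * z ^ k) sums ev z p" for z
    unfolding ev_altdef[OF order_refl] by (intro sums_finite) (auto simp: coeff_eq_0)
  from taylor_of_power_series(2)[OF this] show ?thesis by (simp add: fps_of_real_seq_def)
qed

text \<open>Polynomials close to F on growing discs form a sequence; convergence on the unit disc
  already carries over to all derivatives at 0, and real coefficients have real limits.\<close>

lemma compact_closure_approx:
  assumes F: "F \<in> compact_closure (real_poly_zeros_in A)"
  shows "\<exists>h P. taylor F = fps_of_real_seq h \<and> (\<forall>n. roots_in A (P n)) \<and>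
    (\<forall>k. (\<lambda>n. coeff (P n) k) \<longlonglongrightarrow> h k) \<and> (\<forall>z. (\<lambda>k. of_real (h k) * z ^ k) sums F z)"
proof -
  have holo: "F holomorphic_on UNIV"
    and ap: "\<And>K e. compact K \<Longrightarrow> e > 0 \<Longrightarrow> \<exists>G\<in>real_poly_zeros_in A. \<forall>z\<in>K. dist (G z) (F z) < e"
    using F unfolding compact_closure_def by auto
  have "\<exists>p. roots_in A p \<and> (\<forall>z\<in>cball 0 (real n). dist (ev z p) (F z) < inverse (real (Suc n)))" for n
    using ap[of "cball 0 (real n)" "inverse (real (Suc n))"] unfolding real_poly_zeros_in_altdef by auto
  then obtain P where P: "\<And>n. roots_in A (P n)"
    "\<And>n z. z \<in> cball 0 (real n) \<Longrightarrow> dist (ev z (P n)) (F z) < inverse (real (Suc n))"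
    by metis
  have ul: "uniform_limit (ball 0 1) (\<lambda>n z. ev z (P n)) F sequentially"
  proof (rule uniform_limitI)
    fix e :: real assume e: "e > 0"
    have "\<forall>\<^sub>F n in sequentially. inverse (real (Suc n)) < e"
      using order_tendstoD(2)[OF LIMSEQ_inverse_real_of_nat e] .
    then show "\<forall>\<^sub>F n in sequentially. \<forall>z\<in>ball 0 1. dist (ev z (P n)) (F z) < e"
      using eventually_ge_at_top[of 1]
    proof eventually_elim
      case (elim n)
      show ?case
      proof
        fix z :: complex assume "z \<in> ball 0 1"
        then have "norm z \<le> real n" using elim(2) by simp
        then show "dist (ev z (P n)) (F z) < e" using P(2)[of z n] elim(1) by simp
      qed
    qed
  qed
  have lim: "(\<lambda>n. of_real (coeff (P n) k)) \<longlonglongrightarrow> fps_nth (taylor F) k" for k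
  proof -
    have "(\<lambda>n. (deriv ^^ k) (\<lambda>z. ev z (P n)) 0) \<longlonglongrightarrow> (deriv ^^ k) F 0"
      by (rule higher_deriv_complex_uniform_limit[where A = "ball 0 1"])
        (auto intro!: ul always_eventually holomorphic_intros)
    then have "(\<lambda>n. (deriv ^^ k) (\<lambda>z. ev z (P n)) 0 / fact k) \<longlonglongrightarrow> (deriv ^^ k) F 0 / fact k"
      by (intro tendsto_intros) auto
    then show ?thesis using fps_nth_taylor_ev[of _ k] by (simp add: fps_expansion_def)
  qed
  define h where "h = (\<lambda>k. Re (fps_nth (taylor F) k))"
  have h: "(\<lambda>n. coeff (P n) k) \<longlonglongrightarrow> h k" for k
    unfolding h_def using tendsto_Re[OF lim[of k]] by simp
  have "fps_nth (taylor F) k = of_real (h k)" for k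
    using LIMSEQ_unique[OF lim[of k] tendsto_of_real[OF h[of k]]] .
  then have "taylor F = fps_of_real_seq h" by (intro fps_ext) (simp add: fps_of_real_seq_def)
  moreover have "(\<lambda>k. of_real (h k) * z ^ k) sums F z" for z
    using power_series_of_taylor[OF holo, of z] calculation by (simp add: fps_of_real_seq_def)
  ultimately show ?thesis using P(1) h by blast
qed

text \<open>The converse of \<open>jensen_real_rooted\<close> for series that converge everywhere:
  the multipliers k! \<open>coeff (exp_poly N) k\<close> lie between 0 and 1 and tend to 1, so
  Tannery's theorem makes the Jensen polynomials converge uniformly on discs.\<close>

lemma jensen_compact_closure:
  assumes summ: "\<And>x. x \<ge> 0 \<Longrightarrow> summable (\<lambda>k. \<bar>h k\<bar> * x ^ k)" and jen: "\<And>N. roots_in A (jensen h N)"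
  shows "fps_of_real_seq h \<in> taylor ` compact_closure (real_poly_zeros_in A)"
proof -
  define F where "F = (\<lambda>z::complex. \<Sum>k. of_real (h k) * z ^ k)"
  have ser: "(\<lambda>k. of_real (h k) * z ^ k) sums F z" for z
  proof -
    have "summable (\<lambda>k. norm (of_real (h k) * z ^ k))"
      using summ[of "norm z"] by (simp add: norm_mult norm_power)
    then show ?thesis unfolding F_def by (rule summable_sums[OF summable_norm_cancel])
  qed
  have "F \<in> compact_closure (real_poly_zeros_in A)"
    unfolding compact_closure_def
  proof (intro CollectI conjI allI impI)
    show "F holomorphic_on UNIV" by (rule taylor_of_power_series(1)[OF ser])
    fix K :: "complex set" and e :: real assume Ke: "compact K \<and> e > 0"
    obtain R0 where R0: "\<And>z. z \<in> K \<Longrightarrow> norm z \<le> R0"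
      using compact_imp_bounded[of K] Ke unfolding bounded_iff by blast
    define R where "R = max R0 0"
    have R: "R \<ge> 0" "\<And>z. z \<in> K \<Longrightarrow> norm z \<le> R" using R0 by (simp_all add: R_def le_max_iff_disj)
    define t where "t = (\<lambda>N k. 1 - fact k * coeff (exp_poly N) k)"
    have t: "0 \<le> t N k" "t N k \<le> 1" for N k
      using coeff_exp_poly_le[of k N] coeff_exp_poly_nonneg[of N k] by (auto simp: t_def)
    have bd: "norm (\<bar>h k\<bar> * R ^ k * t N k) \<le> \<bar>h k\<bar> * R ^ k" for k N
      using t[of N k] R by (simp add: abs_mult mult_left_le)
    have tl: "(\<lambda>N. \<bar>h k\<bar> * R ^ k * t N k) \<longlonglongrightarrow> \<bar>h k\<bar> * R ^ k * (1 - 1)" for k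
      unfolding t_def by (intro tendsto_intros coeff_exp_poly_tendsto)
    have "\<forall>\<^sub>F (k, N) in sequentially \<times>\<^sub>F sequentially. norm (\<bar>h k\<bar> * R ^ k * t N k) \<le> \<bar>h k\<bar> * R ^ k"
      using bd by (intro always_eventually) auto
    from tannerys_theorem[where a = "\<lambda>k N. \<bar>h k\<bar> * R ^ k * t N k" and F = sequentially, OF tl this summ[OF R(1)]]
    have "(\<lambda>N. \<Sum>k. \<bar>h k\<bar> * R ^ k * t N k) \<longlonglongrightarrow> 0" by simp
    then have "\<forall>\<^sub>F N in sequentially. (\<Sum>k. \<bar>h k\<bar> * R ^ k * t N k) < e"
      using order_tendstoD(2) Ke by blast
    then obtain N where N: "(\<Sum>k. \<bar>h k\<bar> * R ^ k * t N k) < e"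
      by (auto simp: eventually_sequentially)
    have "dist (ev z (jensen h N)) (F z) < e" if z: "z \<in> K" for z
    proof -
      have "(\<lambda>k. of_real (coeff (jensen h N) k) * z ^ k) sums ev z (jensen h N)"
        unfolding ev_altdef[OF order_refl] by (intro sums_finite) (auto simp: coeff_eq_0)
      from sums_diff[OF ser[of z] this]
      have s: "(\<lambda>k. of_real (h k * t N k) * z ^ k) sums (F z - ev z (jensen h N))"
        by (simp add: coeff_jensen t_def algebra_simps)
      have le: "norm (of_real (h k * t N k) * z ^ k) \<le> \<bar>h k\<bar> * R ^ k * t N k" for k
      proof -
        have "norm (of_real (h k * t N k) * z ^ k) = (\<bar>h k\<bar> * t N k) * norm z ^ k"
          using t[of N k] by (simp add: norm_mult norm_power abs_mult)
        also have "\<dots> \<le> (\<bar>h k\<bar> * t N k) * R ^ k"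
          using t[of N k] R(2)[OF z] by (intro mult_left_mono power_mono) auto
        finally show ?thesis by (simp add: mult_ac)
      qed
      have sm: "summable (\<lambda>k. \<bar>h k\<bar> * R ^ k * t N k)"
        by (rule summable_comparison_test'[OF summ[OF R(1)], of 0]) (rule bd)
      have "norm (F z - ev z (jensen h N)) \<le> (\<Sum>k. \<bar>h k\<bar> * R ^ k * t N k)"
        unfolding sums_unique[OF s] by (rule norm_suminf_le[OF le sm])
      then show ?thesis using N by (simp add: dist_norm norm_minus_commute)
    qed
    then show "\<exists>G\<in>real_poly_zeros_in A. \<forall>z\<in>K. dist (G z) (F z) < e"
      unfolding real_poly_zeros_in_altdef using jen[of N]
      by (intro bexI[of _ "\<lambda>z. ev z (jensen h N)"]) auto
  qed
  then show ?thesis using taylor_of_power_series(2)[OF ser] by (metis imageI)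
qed

text \<open>The inequality applied at the first non-zero index bounds all later terms by powers of
  one ratio. At q = 1 this keeps the convolution an entire function.\<close>

lemma geometric_growth:
  fixes f :: "nat \<Rightarrow> real"
  assumes "\<And>i n. \<bar>f i\<bar> ^ n * \<bar>f (i + n + 1)\<bar> \<le> \<bar>f (i + 1)\<bar> ^ (n + 1)"
  obtains C M where "C \<ge> 0" "M \<ge> 1" "\<And>k. \<bar>f k\<bar> \<le> C * M ^ k"
proof (cases "\<exists>i. f i \<noteq> 0")
  case True
  define i where "i = (LEAST i. f i \<noteq> 0)"
  have i: "f i \<noteq> 0" "\<And>j. j < i \<Longrightarrow> f j = 0"
    unfolding i_def using LeastI_ex[OF True] not_less_Least by blast+
  define M where "M = 1 + \<bar>f (i + 1)\<bar> / \<bar>f i\<bar>"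
  define C where "C = \<bar>f i\<bar> + \<bar>f (i + 1)\<bar>"
  have M: "M \<ge> 1" by (simp add: M_def)
  have C: "C \<ge> 0" by (simp add: C_def)
  have "\<bar>f k\<bar> \<le> C * M ^ k" for k
  proof -
    consider "k < i" | "k = i" | n where "k = i + n + 1"
      using less_iff_Suc_add[of i k] by (metis add.commute linorder_neqE_nat add_Suc_right Suc_eq_plus1)
    then show ?thesis
    proof cases
      case 1
      then show ?thesis using i(2) M C by simp
    next
      case 2
      have "\<bar>f i\<bar> * 1 \<le> C * M ^ k" using M C by (intro mult_mono) (auto simp: C_def)
      then show ?thesis using 2 by simp
    next
      case 3
      have "\<bar>f k\<bar> * \<bar>f i\<bar> ^ n \<le> \<bar>f (i + 1)\<bar> ^ (n + 1)" using assms[of i n] 3 by (simp add: mult.commute)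
      then have "\<bar>f k\<bar> \<le> \<bar>f (i + 1)\<bar> * (\<bar>f (i + 1)\<bar> / \<bar>f i\<bar>) ^ n"
        using i(1) by (simp add: power_divide field_simps)
      also have "\<dots> \<le> C * M ^ n"
        using C by (intro mult_mono power_mono) (auto simp: C_def M_def)
      also have "\<dots> \<le> C * M ^ k"
        using 3 M C by (intro mult_left_mono power_increasing) auto
      finally show ?thesis .
    qed
  qed
  then show thesis using that M C by blast
next
  case False
  then show thesis using that[of 0 1] by simp
qed

subsection \<open>The classes of power series\<close>

lemma fps_of_real_seq_nth [simp]: "fps_nth (fps_of_real_seq a) k = of_real (a k)"
  by (simp add: fps_of_real_seq_def)

lemma fps_of_real_seq_eq_iff [simp]: "fps_of_real_seq a = fps_of_real_seq b \<longleftrightarrow> a = b"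
  by (auto simp: fps_eq_iff fun_eq_iff)

lemma hadamard_fps_of_real_seq:
  "hadamard (fps_of_real_seq a) (fps_of_real_seq b) = fps_of_real_seq (\<lambda>k. a k * b k)"
  by (simp add: hadamard_def fps_eq_iff)

lemma hadamard_nth [simp]: "fps_nth (hadamard f g) k = fps_nth f k * fps_nth g k"
  by (simp add: hadamard_def)

lemma R_class_less_1: "q < 1 \<Longrightarrow> R_class q = taylor ` sep_entire q"
  by (simp add: R_class_def)

lemma N_class_less_1: "q < 1 \<Longrightarrow> N_class q = taylor ` sep_entire_nonpos q"
  by (simp add: N_class_def)

lemma R_class_1: "R_class 1 = taylor ` compact_closure (real_poly_zeros_in \<real>)"
  by (simp add: R_class_def)

lemma N_class_1: "N_class 1 = taylor ` compact_closure (real_poly_zeros_in \<real>\<^sub>\<le>\<^sub>0)"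
  by (simp add: N_class_def)

lemma R_class_sep_seq:
  assumes "0 < q" "q < 1"
  shows "fps_of_real_seq a \<in> R_class q \<longleftrightarrow> sep_seq q a"
proof
  assume "fps_of_real_seq a \<in> R_class q"
  then obtain F where F: "F \<in> sep_entire q" "fps_of_real_seq a = taylor F"
    using R_class_less_1[OF assms(2)] by auto
  show "sep_seq q a"
    by (rule sep_entire_seq[OF assms F(1)]) (use F(2) in simp)
next
  assume a: "sep_seq q a"
  show "fps_of_real_seq a \<in> R_class q"
    unfolding R_class_less_1[OF assms(2)]
    by (rule sep_seq_entire[OF assms a], erule subst, erule imageI)
qed

lemma R_class_real:
  assumes "0 < q" "q \<le> 1" "f \<in> R_class q"
  obtains a where "f = fps_of_real_seq a"
proof (cases "q = 1")
  case True
  then obtain F where "F \<in> compact_closure (real_poly_zeros_in \<real>)" "f = taylor F"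
    using assms(3) by (auto simp: R_class_1)
  then show thesis using that compact_closure_approx[of F] by blast
next
  case False
  then have q1: "q < 1" using assms by simp
  obtain F where F: "F \<in> sep_entire q" "f = taylor F"
    using assms(3) q1 by (auto simp: R_class_less_1)
  show thesis by (rule sep_entire_seq[OF assms(1) q1 F(1)]) (use that F(2) in blast)
qed

lemma N_class_subset: "N_class q \<subseteq> R_class q"
proof -
  have "real_poly_zeros_in \<real>\<^sub>\<le>\<^sub>0 \<subseteq> real_poly_zeros_in \<real>"
    unfolding real_poly_zeros_in_altdef using roots_in_nonpos_Reals by blast
  then have "compact_closure (real_poly_zeros_in \<real>\<^sub>\<le>\<^sub>0) \<subseteq> compact_closure (real_poly_zeros_in \<real>)"
    unfolding compact_closure_def by blast
  then show ?thesis
    unfolding N_class_def R_class_def sep_entire_nonpos_def by auto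
qed

lemma entire_abs_summable:
  assumes "\<And>z :: complex. (\<lambda>k. of_real (h k) * z ^ k) sums F z" "x \<ge> 0"
  shows "summable (\<lambda>k. \<bar>h k\<bar> * x ^ k)"
proof -
  have "summable (\<lambda>k. norm (of_real (h k) * (of_real x :: complex) ^ k))"
    by (rule powser_insidea[OF sums_summable[OF assms(1)[of "of_real (x + 1)"]]])
      (use assms(2) in \<open>simp add: norm_of_real del: of_real_add\<close>)
  then show ?thesis using assms(2) by (simp add: norm_mult norm_power)
qed

lemma R_class_1_jensen:
  assumes "fps_of_real_seq a \<in> R_class 1"
  shows "jensen a N = 0 \<or> real_rooted (jensen a N)" and "x \<ge> 0 \<Longrightarrow> summable (\<lambda>k. \<bar>a k\<bar> * x ^ k)"
proof -
  obtain F where F: "F \<in> compact_closure (real_poly_zeros_in \<real>)" "fps_of_real_seq a = taylor F"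
    using assms by (auto simp: R_class_1)
  obtain h P where h: "taylor F = fps_of_real_seq h" "\<And>n. roots_in \<real> (P n)"
    "\<And>k. (\<lambda>n. coeff (P n) k) \<longlonglongrightarrow> h k" "\<And>z. (\<lambda>k. of_real (h k) * z ^ k) sums F z"
    using compact_closure_approx[OF F(1)] by blast
  have ah: "a = h" using F(2) h(1) by simp
  show "jensen a N = 0 \<or> real_rooted (jensen a N)"
    unfolding ah using h by (intro jensen_real_rooted[of P]) (auto simp: roots_in_Reals)
  show "summable (\<lambda>k. \<bar>a k\<bar> * x ^ k)" if "x \<ge> 0"
    unfolding ah using entire_abs_summable[OF h(4) that] .
qed

lemma R_class_1I:
  assumes "\<And>x. x \<ge> 0 \<Longrightarrow> summable (\<lambda>k. \<bar>h k\<bar> * x ^ k)" "\<And>N. jensen h N = 0 \<or> real_rooted (jensen h N)"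
  shows "fps_of_real_seq h \<in> R_class 1"
  unfolding R_class_1 by (rule jensen_compact_closure) (use assms in \<open>simp_all add: roots_in_Reals\<close>)

text \<open>The last property fixes the order of vanishing at the origin, which
  \<open>sep_seq_limit\<close> asks of approximants.\<close>

lemma R_class_approx:
  assumes q: "0 < q" "q \<le> 1" and a: "fps_of_real_seq a \<in> R_class q"
  obtains P where "\<And>n. sep_poly q (P n)" "\<And>k. (\<lambda>n. coeff (P n) k) \<longlonglongrightarrow> a k"
    "\<And>k n. (\<forall>j\<le>k. a j = 0) \<Longrightarrow> coeff (P n) k = 0"
proof (cases "q = 1")
  case True
  have "sep_poly q (jensen a n)" for n
    using R_class_1_jensen(1)[of a n] a True real_rooted_imp_sep_poly_1[of "jensen a n"] sep_poly_0[of q]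
    by (cases "jensen a n = 0") auto
  then show thesis using that[of "jensen a"] jensen_tendsto by (auto simp: coeff_jensen)
next
  case False
  then have q1: "q < 1" using q by simp
  then have "sep_seq q a" using a R_class_sep_seq q by blast
  then obtain c m \<xi> where \<xi>: "canon q \<xi>" "\<And>k. (\<lambda>N. coeff (smult c (rp m \<xi> {..<N})) k) \<longlonglongrightarrow> a k"
    unfolding sep_seq_def by blast
  have am: "a m = c" using \<xi>(2)[of m] by (simp add: coeff_rp[of m] LIMSEQ_const_iff)
  show thesis
  proof (rule that[of "\<lambda>N. smult c (rp m \<xi> {..<N})"])
    show "sep_poly q (smult c (rp m \<xi> {..<n}))" for n
      using sep_poly_rp[OF q] canon_psep[OF \<xi>(1)] by blast
    show "coeff (smult c (rp m \<xi> {..<n})) k = 0" if "\<forall>j\<le>k. a j = 0" for k n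
      using that am by (cases "k < m") (auto simp: coeff_rp[of m])
  qed (rule \<xi>(2))
qed

lemma neg_poly_1:
  assumes "roots_in \<real>\<^sub>\<le>\<^sub>0 p" shows "neg_poly 1 p"
proof (cases "p = 0")
  case True
  then show ?thesis unfolding neg_poly_def canon_def
    by (intro exI[of _ 0] exI[of _ "\<lambda>_. 0"]) auto
next
  case False
  then have rr: "real_rooted p" and ss: "same_sign (coeff p)"
    using assms by (simp_all add: roots_in_nonpos_Reals roots_in_Reals)
  obtain c m and n :: nat and \<xi> where f: "c \<noteq> 0" "p = smult c (rp m \<xi> {..<n})"
    "\<forall>i\<ge>n. \<xi> i = 0" "\<forall>i j. i < j \<longrightarrow> \<bar>\<xi> j\<bar> \<le> \<bar>\<xi> i\<bar>"
    using real_rooted_factor[OF False rr] by blast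
  have "\<xi> i \<le> 0" for i
    using same_sign_rp_nonpos[of c m \<xi> "{..<n}" i] ss f by (cases "i < n") auto
  moreover have "canon 1 \<xi>" using f(4) by (simp add: canon_def)
  ultimately show ?thesis unfolding neg_poly_def using f(2) by blast
qed

lemma N_class_neg_seq:
  assumes q: "0 < q" "q < 1" and b: "fps_of_real_seq b \<in> N_class q"
  shows "neg_seq q b"
proof -
  obtain F where F: "F \<in> sep_entire_nonpos q" "fps_of_real_seq b = taylor F"
    using b q by (auto simp: N_class_less_1)
  have F': "F \<in> sep_entire q" using F(1) by (simp add: sep_entire_nonpos_def)
  show ?thesis by (rule sep_entire_seq[OF q F']) (use F in simp)
qed

lemma N_class_approx:
  assumes q: "0 < q" "q \<le> 1" and b: "fps_of_real_seq b \<in> N_class q"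
  obtains K where "\<And>n. neg_poly q (K n)" "\<And>k. (\<lambda>n. coeff (K n) k) \<longlonglongrightarrow> b k"
proof (cases "q = 1")
  case True
  obtain F where F: "F \<in> compact_closure (real_poly_zeros_in \<real>\<^sub>\<le>\<^sub>0)" "fps_of_real_seq b = taylor F"
    using b True by (auto simp: N_class_1)
  obtain h P where h: "taylor F = fps_of_real_seq h" "\<And>n. roots_in \<real>\<^sub>\<le>\<^sub>0 (P n)"
    "\<And>k. (\<lambda>n. coeff (P n) k) \<longlonglongrightarrow> h k"
    using compact_closure_approx[OF F(1)] by blast
  have "b = h" using F(2) h(1) by simp
  then show thesis using that[of P] h neg_poly_1 True by blast
next
  case False
  then have q1: "q < 1" using q by simp
  have "neg_seq q b" by (rule N_class_neg_seq[OF q(1) q1 b])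
  then obtain d l \<eta> where "canon q \<eta>" "\<forall>i. \<eta> i \<le> 0"
    "\<And>k. (\<lambda>N. coeff (smult d (rp l \<eta> {..<N})) k) \<longlonglongrightarrow> b k"
    unfolding neg_seq_def by blast
  then show thesis using that[of "\<lambda>N. smult d (rp l \<eta> {..<N})"] unfolding neg_poly_def by blast
qed

lemma N_class_power_bound:
  assumes q: "0 < q" "q \<le> 1" and b: "fps_of_real_seq b \<in> N_class q"
  shows "\<bar>cw q i * b i\<bar> ^ n * \<bar>cw q (i + n + 1) * b (i + n + 1)\<bar> \<le> \<bar>cw q (i + 1) * b (i + 1)\<bar> ^ (n + 1)"
proof -
  obtain K where K: "\<And>n. neg_poly q (K n)" "\<And>k. (\<lambda>n. coeff (K n) k) \<longlonglongrightarrow> b k"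
    by (rule N_class_approx[OF q b]) blast
  show ?thesis
  proof (rule LIMSEQ_le)
    show "(\<lambda>N. \<bar>cw q i * coeff (K N) i\<bar> ^ n * \<bar>cw q (i + n + 1) * coeff (K N) (i + n + 1)\<bar>) \<longlonglongrightarrow>
        \<bar>cw q i * b i\<bar> ^ n * \<bar>cw q (i + n + 1) * b (i + n + 1)\<bar>"
      by (intro tendsto_intros K(2))
    show "(\<lambda>N. \<bar>cw q (i + 1) * coeff (K N) (i + 1)\<bar> ^ (n + 1)) \<longlonglongrightarrow> \<bar>cw q (i + 1) * b (i + 1)\<bar> ^ (n + 1)"
      by (intro tendsto_intros K(2))
  qed (use neg_poly_power_bound[OF q K(1)] in blast)
qed

lemma N_class_same_sign:
  assumes q: "0 < q" "q \<le> 1" and b: "fps_of_real_seq b \<in> N_class q"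
  shows "same_sign b"
proof -
  obtain K where K: "\<And>n. neg_poly q (K n)" "\<And>k. (\<lambda>n. coeff (K n) k) \<longlonglongrightarrow> b k"
    using N_class_approx[OF q b] by metis
  then show ?thesis using same_sign_limit[of "\<lambda>n. coeff (K n)"] neg_poly_same_sign by blast
qed

lemma N_classI:
  assumes q: "0 < q" "q \<le> 1" and h: "fps_of_real_seq h \<in> R_class q" "same_sign h"
  shows "fps_of_real_seq h \<in> N_class q"
proof (cases "q = 1")
  case True
  have "same_sign (coeff (jensen h N))" for N
  proof -
    have "fact k * coeff (exp_poly N) k \<ge> 0" for k by (simp add: coeff_exp_poly_nonneg)
    then show ?thesis using h(2) unfolding same_sign_def coeff_jensen
      by (auto intro: mult_nonneg_nonneg mult_nonpos_nonneg)
  qed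
  then show ?thesis
    using R_class_1_jensen[of h] h True unfolding N_class_1
    by (auto simp: N_class_1 roots_in_nonpos_Reals roots_in_Reals intro!: jensen_compact_closure)
next
  case False
  then have q1: "q < 1" using q by simp
  have "sep_seq q h" using R_class_sep_seq[OF q(1) q1] h(1) by simp
  then show ?thesis
    unfolding N_class_less_1[OF q1] using sep_seq_same_sign_entire[OF q(1) q1] h(2) by simp
qed

text \<open>At q = 1 the convolutions of the approximating polynomials converge coefficientwise
  only. That suffices for real-rooted Jensen polynomials of the limit, and everywhere convergence
  follows from the geometric growth of \<open>cw q k * b k\<close>.\<close>

theorem R_class_convolution:
  assumes q: "0 < q" "q \<le> 1" and a: "fps_of_real_seq a \<in> R_class q" and b: "fps_of_real_seq b \<in> N_class q"
  shows "fps_of_real_seq (\<lambda>k. cw q k * a k * b k) \<in> R_class q"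
proof (cases "q = 1")
  case False
  then have q1: "q < 1" using q by simp
  show ?thesis
    using sep_seq_star[OF q(1) q1 _ N_class_neg_seq[OF q(1) q1 b]] a
    unfolding R_class_sep_seq[OF q(1) q1] by simp
next
  case True
  define h where "h = (\<lambda>k. cw q k * a k * b k)"
  obtain F where F: "F \<in> compact_closure (real_poly_zeros_in \<real>)" "fps_of_real_seq a = taylor F"
    using a True by (auto simp: R_class_1)
  obtain a' P where P: "taylor F = fps_of_real_seq a'" "\<And>n. roots_in \<real> (P n)"
    "\<And>k. (\<lambda>n. coeff (P n) k) \<longlonglongrightarrow> a' k"
    using compact_closure_approx[OF F(1)] by blast
  have a': "a' = a" using F(2) P(1) by simp
  obtain G where G: "G \<in> compact_closure (real_poly_zeros_in \<real>\<^sub>\<le>\<^sub>0)" "fps_of_real_seq b = taylor G"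
    using b True by (auto simp: N_class_1)
  obtain b' K where K: "taylor G = fps_of_real_seq b'" "\<And>n. roots_in \<real>\<^sub>\<le>\<^sub>0 (K n)"
    "\<And>k. (\<lambda>n. coeff (K n) k) \<longlonglongrightarrow> b' k"
    using compact_closure_approx[OF G(1)] by blast
  have b': "b' = b" using G(2) K(1) by simp
  have star: "star 1 (P n) (K n) = 0 \<or> real_rooted (star 1 (P n) (K n))" for n
    using P(2)[of n] K(2)[of n] real_rooted_star[of "P n" "K n"]
    unfolding roots_in_nonpos_Reals roots_in_Reals by (cases "P n = 0"; cases "K n = 0") auto
  have lim: "(\<lambda>n. coeff (star 1 (P n) (K n)) k) \<longlonglongrightarrow> h k" for k
    unfolding coeff_star h_def True using P(3) K(3) unfolding a' b' by (intro tendsto_intros)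
  have jen: "jensen h N = 0 \<or> real_rooted (jensen h N)" for N
    by (rule jensen_real_rooted[OF star lim])
  obtain C M where CM: "C \<ge> 0" "M \<ge> 1" "\<And>k. \<bar>cw q k * b k\<bar> \<le> C * M ^ k"
    using geometric_growth[of "\<lambda>k. cw q k * b k", OF N_class_power_bound[OF q b]] by metis
  have "summable (\<lambda>k. \<bar>h k\<bar> * x ^ k)" if x: "x \<ge> 0" for x
  proof (rule summable_comparison_test'[of "\<lambda>k. C * (\<bar>a k\<bar> * (M * x) ^ k)" 0])
    show "summable (\<lambda>k. C * (\<bar>a k\<bar> * (M * x) ^ k))"
      using R_class_1_jensen(2)[of a "M * x"] a True x CM(2) by (intro summable_mult) auto
    fix k
    have "norm (\<bar>h k\<bar> * x ^ k) = \<bar>a k\<bar> * x ^ k * \<bar>cw q k * b k\<bar>"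
      using x by (simp add: h_def abs_mult)
    also have "\<dots> \<le> \<bar>a k\<bar> * x ^ k * (C * M ^ k)"
      using x by (intro mult_left_mono CM(3)) auto
    finally show "norm (\<bar>h k\<bar> * x ^ k) \<le> C * (\<bar>a k\<bar> * (M * x) ^ k)"
      by (simp add: power_mult_distrib mult_ac)
  qed
  then show ?thesis using R_class_1I[OF _ jen] True by (simp add: h_def)
qed

lemma same_sign_mult:
  assumes "same_sign a" "same_sign b" shows "same_sign (\<lambda>k. a k * b k)"
  using assms unfolding same_sign_def
  by (elim disjE) (simp_all add: mult_nonneg_nonpos mult_nonpos_nonneg mult_nonpos_nonpos)

lemma same_sign_pos_mult:
  assumes "\<And>k. c k > 0" shows "same_sign (\<lambda>k. c k * a k) \<longleftrightarrow> same_sign a"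
proof -
  have "(c k * a k \<ge> 0) = (a k \<ge> 0)" "(c k * a k \<le> 0) = (a k \<le> 0)" for k
    using assms[of k] by (simp_all add: zero_le_mult_iff mult_le_0_iff)
  then show ?thesis by (simp add: same_sign_def)
qed

theorem N_class_convolution:
  assumes q: "0 < q" "q \<le> 1" and a: "fps_of_real_seq a \<in> N_class q" and b: "fps_of_real_seq b \<in> N_class q"
  shows "fps_of_real_seq (\<lambda>k. cw q k * a k * b k) \<in> N_class q"
proof (rule N_classI[OF q])
  show "fps_of_real_seq (\<lambda>k. cw q k * a k * b k) \<in> R_class q"
    using R_class_convolution[OF q] N_class_subset a b by blast
  show "same_sign (\<lambda>k. cw q k * a k * b k)"
    using same_sign_mult[OF N_class_same_sign[OF q a] N_class_same_sign[OF q b]]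
      same_sign_pos_mult[of "cw q" "\<lambda>k. a k * b k"] cw_pos[OF q] by (simp add: mult.assoc)
qed

section \<open>The series \<open>R_inf q\<close> and the description of preclasses and
  multipliers\<close>

lemma R_inf_coeffs:
  assumes q: "0 < q" "q \<le> 1"
  shows "R_inf q = fps_of_real_seq (\<lambda>k. 1 / cw q k)"
proof (cases "q = 1")
  case True
  have "(\<lambda>k. of_real (1 / cw 1 k) * z ^ k) sums exp z" for z :: complex
    using exp_converges[of z] by (simp add: cw_one scaleR_conv_of_real divide_inverse)
  from taylor_of_power_series(2)[OF this] show ?thesis using True by (simp add: R_inf_def)
next
  case False
  then have q1: "q < 1" using q by simp
  have summ: "summable (\<lambda>i. \<bar>geom q i\<bar>)" using canon_summable[OF canon_geom q(1) q1] q by auto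
  have lim: "(\<lambda>N. coeff (smult 1 (rp 0 (geom q) {..<N})) k) \<longlonglongrightarrow> 1 / cw q k" for k
    using coeff_geom_tendsto[OF q(1) q1] by simp
  have "(\<lambda>k. of_real (1 / cw q k) * z ^ k) sums (\<Prod>j. 1 + of_real q ^ j * z)" for z :: complex
    using prodinf_power_series(2)[OF summ lim, of z] by (simp add: geom_def)
  from taylor_of_power_series(2)[OF this] show ?thesis using False by (simp add: R_inf_def)
qed

lemma R_inf_N_class:
  assumes q: "0 < q" "q \<le> 1"
  shows "R_inf q \<in> N_class q"
proof -
  have R: "fps_of_real_seq (\<lambda>k. 1 / cw q k) \<in> R_class q"
  proof (cases "q = 1")
    case True
    have jen: "jensen (\<lambda>k. 1 / cw 1 k) N = exp_poly N" for N
      by (rule poly_eqI) (simp add: coeff_jensen cw_one)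
    have "summable (\<lambda>k. \<bar>1 / cw 1 k\<bar> * x ^ k)" for x :: real
      using summable_exp[of x] by (simp add: cw_one divide_inverse)
    then show ?thesis using True real_rooted_exp_poly by (auto intro!: R_class_1I simp: jen)
  next
    case False
    then have q1: "q < 1" using q by simp
    have "sep_seq q (\<lambda>k. 1 / cw q k)"
      by (rule sep_seqI[of q "geom q" 1 0]) (use canon_geom q coeff_geom_tendsto[OF q(1) q1] in auto)
    then show ?thesis using R_class_sep_seq[OF q(1) q1] by blast
  qed
  have "1 / cw q k \<ge> 0" for k using cw_pos[OF q, of k] by simp
  then have "same_sign (\<lambda>k. 1 / cw q k)" by (simp add: same_sign_def)
  then show ?thesis using N_classI[OF q R] R_inf_coeffs[OF q] by simp
qed

lemma fps_deg_R_inf: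
  assumes q: "0 < q" "q \<le> 1"
  shows "fps_deg (R_inf q) = \<infinity>"
proof -
  have "{k. fps_nth (R_inf q) k \<noteq> 0} = UNIV"
    using cw_pos[OF q] by (simp add: R_inf_coeffs[OF q] less_imp_neq[symmetric])
  then have "fps_deg (R_inf q) = (SUP k. ereal (real k))" by (simp add: fps_deg_def)
  also have "\<dots> = \<infinity>" by (rule SUP_nat_Infty)
  finally show ?thesis .
qed

text \<open>No coefficient of \<open>R_inf q\<close> vanishes, so Hadamard multiplication by it is
  inverted by the weights \<open>cw q\<close>. Hadamard products with such an f are convolutions
  with b.\<close>

lemma pre_class_char:
  assumes q: "0 < q" "q \<le> 1" and X: "X \<subseteq> R_class q"
  shows "f \<in> pre_class X (R_inf q) \<longleftrightarrow> (\<exists>b. f = fps_of_real_seq (\<lambda>k. cw q k * b k) \<and> fps_of_real_seq b \<in> X)"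
proof
  assume "f \<in> pre_class X (R_inf q)"
  then have f: "hadamard f (R_inf q) \<in> X" by (simp add: pre_class_def)
  then obtain b where b: "hadamard f (R_inf q) = fps_of_real_seq b" using R_class_real[OF q] X by blast
  have "fps_nth f k = of_real (cw q k * b k)" for k
  proof -
    have "fps_nth (hadamard f (R_inf q)) k = of_real (b k)" unfolding b by simp
    then have "fps_nth f k * of_real (1 / cw q k) = of_real (b k)" unfolding R_inf_coeffs[OF q] by simp
    then show ?thesis using cw_pos[OF q, of k] by (simp add: field_simps)
  qed
  then have "f = fps_of_real_seq (\<lambda>k. cw q k * b k)" by (intro fps_ext) simp
  then show "\<exists>b. f = fps_of_real_seq (\<lambda>k. cw q k * b k) \<and> fps_of_real_seq b \<in> X" using b f by auto
next
  assume "\<exists>b. f = fps_of_real_seq (\<lambda>k. cw q k * b k) \<and> fps_of_real_seq b \<in> X"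
  then obtain b where b: "f = fps_of_real_seq (\<lambda>k. cw q k * b k)" "fps_of_real_seq b \<in> X" by blast
  have "hadamard f (R_inf q) = fps_of_real_seq b"
    unfolding b R_inf_coeffs[OF q] hadamard_fps_of_real_seq
    using cw_pos[OF q] by (simp add: less_imp_neq[symmetric])
  then show "f \<in> pre_class X (R_inf q)"
    using b fps_deg_R_inf[OF q] by (simp add: pre_class_def)
qed

lemma multipliers_char:
  assumes q: "0 < q" "q \<le> 1" and "R_inf q \<in> X"
  shows "g \<in> multipliers X \<longleftrightarrow> (\<forall>f\<in>X. hadamard f g \<in> X)"
proof -
  have "(SUP h\<in>X. fps_deg h) \<ge> fps_deg (R_inf q)" by (rule SUP_upper) fact
  then have "(SUP h\<in>X. fps_deg h) = \<infinity>" using fps_deg_R_inf[OF q] by simp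
  then show ?thesis by (simp add: multipliers_def)
qed

section \<open>Reflection, and the polynomials in the classes\<close>

lemma coeff_rp_uminus:
  "finite I \<Longrightarrow> coeff (rp m (\<lambda>i. - \<xi> i) I) k = (- 1) ^ m * (- 1) ^ k * coeff (rp m \<xi> I) k"
proof (induction I arbitrary: k rule: finite_induct)
  case empty
  then show ?case by (auto simp: rp_def simp flip: power_add)
next
  case (insert i I)
  have 1: "coeff (rp m \<xi> (insert i I)) k =
      coeff (rp m \<xi> I) k - \<xi> i * (case k of 0 \<Rightarrow> 0 | Suc j \<Rightarrow> coeff (rp m \<xi> I) j)" for \<xi> :: "'a \<Rightarrow> real"
    using insert.hyps by (simp add: rp_insert coeff_pCons split: nat.split)
  show ?case unfolding 1 by (cases k) (simp_all add: insert.IH algebra_simps)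
qed

lemma R_class_reflect:
  assumes q: "0 < q" "q \<le> 1" and a: "fps_of_real_seq a \<in> R_class q"
  shows "fps_of_real_seq (\<lambda>k. (- 1) ^ k * a k) \<in> R_class q"
proof (cases "q = 1")
  case True
  have jen: "jensen (\<lambda>k. (- 1) ^ k * a k) N = cmult_poly (\<lambda>k. (- 1) ^ k) (jensen a N)" for N
    by (rule poly_eqI) (simp add: coeff_jensen)
  have "jensen (\<lambda>k. (- 1) ^ k * a k) N = 0 \<or> real_rooted (jensen (\<lambda>k. (- 1) ^ k * a k) N)" for N
  proof (cases "jensen a N = 0")
    case True
    then show ?thesis by (intro disjI1 poly_eqI) (simp add: jen)
  next
    case False
    then have rr: "real_rooted (jensen a N)" using R_class_1_jensen(1)[of a N] a \<open>q = 1\<close> by simp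
    have "ev z (jensen (\<lambda>k. (- 1) ^ k * a k) N) \<noteq> 0" if "Im z > 0" for z
    proof
      assume "ev z (jensen (\<lambda>k. (- 1) ^ k * a k) N) = 0"
      then have "ev (of_real (- 1) * z) (jensen a N) = 0" unfolding jen ev_cmult_power .
      then have "Im (of_real (- 1) * z) = 0" by (rule real_rooted_imp_real[OF rr])
      then show False using that by simp
    qed
    then show ?thesis by (simp add: real_rooted_def)
  qed
  moreover have "summable (\<lambda>k. \<bar>(- 1) ^ k * a k\<bar> * x ^ k)" if "x \<ge> 0" for x
    using R_class_1_jensen(2)[of a x] a True that by (simp add: abs_mult power_abs)
  ultimately show ?thesis using True by (simp add: R_class_1I)
next
  case False
  then have q1: "q < 1" using q by simp
  have "sep_seq q a" using R_class_sep_seq[OF q(1) q1] a by simp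
  then obtain c m \<xi> where \<xi>: "canon q \<xi>" "\<And>k. (\<lambda>N. coeff (smult c (rp m \<xi> {..<N})) k) \<longlonglongrightarrow> a k"
    unfolding sep_seq_def by blast
  have "canon q (\<lambda>i. - \<xi> i)" using \<xi>(1) by (simp add: canon_def)
  moreover have "(\<lambda>N. coeff (smult ((- 1) ^ m * c) (rp m (\<lambda>i. - \<xi> i) {..<N})) k) \<longlonglongrightarrow> (- 1) ^ k * a k" for k
  proof -
    have "coeff (smult ((- 1) ^ m * c) (rp m (\<lambda>i. - \<xi> i) {..<N})) k =
        (- 1) ^ k * coeff (smult c (rp m \<xi> {..<N})) k" for N :: nat
      by (simp add: coeff_rp_uminus flip: mult.assoc)
    then show ?thesis by (simp only: tendsto_mult_left[OF \<xi>(2)])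
  qed
  ultimately have "sep_seq q (\<lambda>k. (- 1) ^ k * a k)" by (rule sep_seqI)
  then show ?thesis using R_class_sep_seq[OF q(1) q1] by simp
qed

lemma poly_in_R_class:
  assumes q: "0 < q" "q \<le> 1" and P: "sep_poly q P"
  shows "fps_of_real_seq (coeff P) \<in> R_class q"
proof -
  obtain c m and n :: nat and \<xi> where \<xi>: "P = smult c (rp m \<xi> {..<n})" "canon q \<xi>" "\<And>i. i \<ge> n \<Longrightarrow> \<xi> i = 0"
    using P unfolding sep_poly_def by blast
  show ?thesis
  proof (cases "q = 1")
    case True
    have "roots_in \<real> P"
      unfolding roots_in_Reals \<xi>(1) using real_rooted_rp[of c "{..<n}" m \<xi>] by auto
    then have "(\<lambda>z. ev z P) \<in> real_poly_zeros_in \<real>"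
      unfolding real_poly_zeros_in_altdef by blast
    then have "(\<lambda>z. ev z P) \<in> compact_closure (real_poly_zeros_in \<real>)"
      unfolding compact_closure_def using dist_self by (force intro: holomorphic_intros)
    moreover have "taylor (\<lambda>z. ev z P) = fps_of_real_seq (coeff P)"
      by (rule fps_ext) (simp add: fps_nth_taylor_ev)
    ultimately show ?thesis unfolding True R_class_1 by force
  next
    case False
    then have q1: "q < 1" using q by simp
    have "(\<lambda>N. coeff (smult c (rp m \<xi> {..<N})) k) \<longlonglongrightarrow> coeff P k" for k
    proof (rule tendsto_eventually, rule eventually_sequentiallyI)
      fix N :: nat assume "N \<ge> n"
      then show "coeff (smult c (rp m \<xi> {..<N})) k = coeff P k"
        using rp_eventually_const[of n \<xi> N m] \<xi>(1,3) by simp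
    qed
    then have "sep_seq q (coeff P)" by (rule sep_seqI[OF \<xi>(2)])
    then show ?thesis using R_class_sep_seq[OF q(1) q1] by simp
  qed
qed

lemma R_class_poly_real_rooted:
  assumes q: "0 < q" "q \<le> 1" and Q: "fps_of_real_seq (coeff Q) \<in> R_class q"
  shows "Q = 0 \<or> real_rooted Q"
proof (cases "q = 1")
  case True
  show ?thesis
  proof (rule real_rooted_limit[of "jensen (coeff Q)" "degree Q"])
    show "jensen (coeff Q) N = 0 \<or> real_rooted (jensen (coeff Q) N)" for N
      using R_class_1_jensen(1) Q True by simp
    show "degree (jensen (coeff Q) N) \<le> degree Q" for N
      by (rule degree_le) (simp add: coeff_jensen coeff_eq_0)
  qed (rule jensen_tendsto)
next
  case False
  then have q1: "q < 1" using q by simp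
  have Qs: "sep_seq q (coeff Q)" using R_class_sep_seq[OF q(1) q1] Q by simp
  show ?thesis
  proof (rule sep_seq_entire[OF q(1) q1 Qs])
    fix F :: "complex \<Rightarrow> complex" assume F: "\<And>z. (\<lambda>k. of_real (coeff Q k) * z ^ k) sums F z"
      "\<And>z. F z = 0 \<Longrightarrow> F = (\<lambda>_. 0) \<or> z \<in> \<real>"
    have Fev: "F z = ev z Q" for z
    proof -
      have "(\<lambda>k. of_real (coeff Q k) * z ^ k) sums ev z Q"
        unfolding ev_altdef[OF order_refl]
        by (rule sums_finite) (auto simp: coeff_eq_0 not_le)
      then show ?thesis using F(1)[of z] sums_unique2 by blast
    qed
    show ?thesis
    proof (cases "Q = 0")
      case False
      have "F \<noteq> (\<lambda>_. 0)"
      proof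
        assume "F = (\<lambda>_. 0)"
        then have "{z. ev z Q = 0} = UNIV" using Fev by (auto simp: fun_eq_iff)
        then show False using finite_ev_roots[OF False] infinite_UNIV_char_0[where 'a = complex] by simp
      qed
      then have "ev z Q \<noteq> 0" if "Im z > 0" for z
        using F(2)[of z] that Fev by (auto elim!: Reals_cases)
      then show ?thesis by (simp add: real_rooted_def)
    qed simp
  qed
qed

lemma coeff_rp_top:
  "coeff (rp 0 \<xi> {..<n :: nat}) n = (\<Prod>i<n. - \<xi> i)" "k > n \<Longrightarrow> coeff (rp 0 \<xi> {..<n}) k = 0"
proof -
  have "coeff (rp 0 \<xi> {..<n}) n = (\<Prod>i<n. - \<xi> i) \<and> (\<forall>k>n. coeff (rp 0 \<xi> {..<n}) k = 0)"
  proof (induction n)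
    case (Suc n)
    have "coeff (rp 0 \<xi> {..<Suc n}) k = 0" if "k > Suc n" for k
      using that Suc.IH by (cases k) (simp_all add: coeff_rp_Suc)
    then show ?case using Suc.IH by (simp add: coeff_rp_Suc)
  qed simp
  then show "coeff (rp 0 \<xi> {..<n :: nat}) n = (\<Prod>i<n. - \<xi> i)" "k > n \<Longrightarrow> coeff (rp 0 \<xi> {..<n}) k = 0"
    by simp_all
qed

text \<open>The non-zero roots are the j-th roots of - A / B. One lies in the upper half-plane, at
  angle pi / j or 2 pi / j, unless j = 2 and - A / B is positive.\<close>

lemma real_rooted_two_terms:
  assumes Q: "\<And>k. coeff Q k = (if k = m then A else if k = m + j then B else 0)"
    and rr: "real_rooted Q" and AB: "A \<noteq> 0" "B \<noteq> 0" "j \<ge> 2"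
  shows "j = 2 \<and> A * B < 0"
proof -
  define \<rho> where "\<rho> = - (A / B)"
  have ev: "ev z Q = z ^ m * (of_real A + of_real B * z ^ j)" for z
  proof -
    have "Q = monom A m + monom B (m + j)"
      using AB(3) by (intro poly_eqI) (auto simp: Q)
    then show ?thesis by (simp add: algebra_simps power_add)
  qed
  have no_root: False if \<theta>: "0 < \<theta>" "\<theta> < pi" and cis: "of_real \<bar>\<rho>\<bar> * cis (real j * \<theta>) = of_real \<rho>" for \<theta>
  proof -
    define z where "z = of_real (root j \<bar>\<rho>\<bar>) * cis \<theta>"
    have "\<rho> \<noteq> 0" using AB by (simp add: \<rho>_def)
    then have "Im z > 0" using \<theta> AB(3) by (simp add: z_def sin_gt_zero)
    moreover have "of_real (root j \<bar>\<rho>\<bar>) ^ j = complex_of_real \<bar>\<rho>\<bar>"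
      using AB(3) by (simp add: real_root_pow_pos2 flip: of_real_power)
    then have "z ^ j = of_real \<rho>"
      using cis by (simp only: z_def power_mult_distrib Complex.DeMoivre)
    then have "ev z Q = 0" using AB by (simp add: ev \<rho>_def)
    ultimately show False using rr by (simp add: real_rooted_def)
  qed
  have j0: "real j > 0" using AB(3) by simp
  have "\<not> \<rho> < 0"
  proof
    assume "\<rho> < 0"
    then show False using no_root[of "pi / real j"] AB(3) j0 by (simp add: divide_less_eq)
  qed
  then have \<rho>: "\<rho> > 0" using AB by (simp add: \<rho>_def less_le)
  then have "A * B < 0" using AB by (auto simp: \<rho>_def divide_less_0_iff mult_less_0_iff)
  moreover have "\<not> j \<ge> 3"
  proof
    assume "j \<ge> 3"
    then show False using no_root[of "2 * pi / real j"] \<rho> j0 by (simp add: divide_less_eq)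
  qed
  ultimately show ?thesis using AB(3) by simp
qed

text \<open>The second hypothesis makes the support an interval, the first gives equal signs at
  distance two within it. The signs are therefore determined by the first two non-zero
  terms.\<close>

lemma same_sign_alternative:
  fixes u :: "nat \<Rightarrow> real"
  assumes A: "\<And>m. u m * u (m + 2) \<ge> 0"
    and B: "\<And>m j. j \<ge> 2 \<Longrightarrow> u m \<noteq> 0 \<Longrightarrow> u (m + j) \<noteq> 0 \<Longrightarrow> \<exists>i. m < i \<and> i < m + j \<and> u i \<noteq> 0"
  shows "same_sign u \<or> same_sign (\<lambda>k. (- 1) ^ k * u k)"
proof (cases "\<forall>k. u k = 0")
  case True
  then show ?thesis by (simp add: same_sign_def)
next
  case False
  define l where "l = (LEAST k. u k \<noteq> 0)"
  have l: "u l \<noteq> 0" unfolding l_def using False by (metis (mono_tags, lifting) LeastI)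
  have below: "u k = 0" if "k < l" for k using not_less_Least[of k "\<lambda>k. u k \<noteq> 0"] that unfolding l_def by blast
  have interval: "u j \<noteq> 0" if "l \<le> j" "j \<le> k" "u k \<noteq> 0" for j k
  proof
    assume j: "u j = 0"
    \<comment> \<open>\<open>Max S\<close> and \<open>Min T\<close> are the non-zero positions
      nearest to the supposed gap at j, with nothing non-zero between them.\<close>
    define S T where "S = {i \<in> {l..j}. u i \<noteq> 0}" and "T = {i \<in> {j..k}. u i \<noteq> 0}"
    have S: "finite S" "S \<noteq> {}" and T: "finite T" "T \<noteq> {}" using that l by (auto simp: S_def T_def)
    have p: "Max S \<in> S" and r: "Min T \<in> T" using Max_in[OF S] Min_in[OF T] by auto
    have lt: "Max S < j" "j < Min T" using p r j by (auto simp: S_def T_def le_less)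
    have "Max S + (Min T - Max S) = Min T" "Min T - Max S \<ge> 2" "u (Max S) \<noteq> 0" "u (Min T) \<noteq> 0"
      using p r lt unfolding S_def[symmetric] T_def[symmetric] by (auto simp: S_def T_def)
    then obtain i where i: "Max S < i" "i < Min T" "u i \<noteq> 0"
      using B[of "Min T - Max S" "Max S"] by auto
    show False
    proof (cases "i \<le> j")
      case True
      then have "i \<in> S" using i p by (auto simp: S_def)
      then show False using Max_ge[OF S(1)] i(1) by force
    next
      case False
      then have "i \<in> T" using i r by (auto simp: T_def)
      then show False using Min_le[OF T(1)] i(2) by force
    qed
  qed
  \<comment> \<open>Chosen so that the first two terms of \<open>s ^ k * u k\<close> from l on do
    not differ in sign; from there the sign propagates in steps of two.\<close>
  define s :: real where "s = (if u l * u (Suc l) \<ge> 0 then 1 else - 1)"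
  have s2: "s * s = 1" by (simp add: s_def)
  have s2': "s * (s * x) = x" for x using s2 by (simp flip: mult.assoc)
  define v where "v k = s ^ k * u k" for k
  have v0: "v k = 0 \<longleftrightarrow> u k = 0" for k by (simp add: v_def s_def)
  have vA: "v m * v (m + 2) \<ge> 0" for m
  proof -
    have "v m * v (m + 2) = (s ^ m * s ^ m) * (u m * u (m + 2))" by (simp add: v_def mult_ac s2')
    also have "\<dots> = u m * u (m + 2)" by (simp add: s2 flip: power_mult_distrib)
    finally show ?thesis using A by simp
  qed
  have first: "v l * v (Suc l) \<ge> 0"
  proof -
    have "v l * v (Suc l) = (s ^ l * s ^ l) * (s * (u l * u (Suc l)))" by (simp add: v_def mult_ac)
    also have "\<dots> = s * (u l * u (Suc l))" by (simp add: s2 flip: power_mult_distrib)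
    finally show ?thesis by (simp add: s_def)
  qed
  have vl: "v l * v k \<ge> 0" for k
  proof (induction k rule: less_induct)
    case (less k)
    consider "k < l" | "k = l" | "k = Suc l" | n where "k = n + 2" "l \<le> n"
      by (metis Suc_leI add_2_eq_Suc' le_Suc_ex le_eq_less_or_eq less_imp_Suc_add linorder_neqE_nat add_Suc_right le_add1)
    then show ?case
    proof cases
      case 4
      show ?thesis
      proof (cases "v k = 0")
        case False
        then have "v n \<noteq> 0" using interval[of n k] 4 v0 by simp
        have "v l * v n \<ge> 0" "v n * v k \<ge> 0" using less[of n] vA[of n] 4 by simp_all
        then have "(v l * v k) * (v n)\<^sup>2 \<ge> 0"
          using mult_nonneg_nonneg[of "v l * v n" "v n * v k"] by (simp add: power2_eq_square mult_ac)
        then show ?thesis using \<open>v n \<noteq> 0\<close> by (simp add: zero_le_mult_iff)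
      qed simp
    qed (use below first in \<open>auto simp: v_def\<close>)
  qed
  have "v l \<noteq> 0" using l v0 by simp
  then have "same_sign v"
    using vl unfolding same_sign_def zero_le_mult_iff by (cases "v l > 0") (auto simp: not_less)
  then show ?thesis unfolding v_def s_def by (auto split: if_splits)
qed

subsection \<open>Multipliers and log-concavity\<close>

lemma fps_of_real_seq_reflect:
  "fps_compose (fps_of_real_seq a) (- fps_X) = fps_of_real_seq (\<lambda>k. (- 1) ^ k * a k)"
  unfolding fps_compose_uminus' by (rule fps_ext) simp

lemma R_inf_R_class: "0 < q \<Longrightarrow> q \<le> 1 \<Longrightarrow> R_inf q \<in> R_class q"
  using R_inf_N_class N_class_subset by blast

lemmas PR_class_char = pre_class_char[OF _ _ subset_refl, folded PR_class_def]
  and PN_class_char = pre_class_char[OF _ _ N_class_subset, folded PN_class_def]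

text \<open>The test polynomials have separated zeros and end coefficients of known sign. Where u
  has a gap, the multiplier kills all inner terms, so the image has two terms and must still be
  real-rooted.\<close>

lemma multiplier_sign:
  assumes q: "0 < q" "q \<le> 1"
    and u: "\<And>a. fps_of_real_seq a \<in> R_class q \<Longrightarrow> fps_of_real_seq (\<lambda>k. a k * u k) \<in> R_class q"
  shows "same_sign u \<or> same_sign (\<lambda>k. (- 1) ^ k * u k)"
proof -
  have two_terms: "j = 2 \<and> (u m * u (m + j)) * d < 0"
    if P: "sep_poly q P" "\<And>k. u k \<noteq> 0 \<Longrightarrow> coeff P k = (if k = m then 1 else if k = m + j then d else 0)"
      and nz: "u m \<noteq> 0" "u (m + j) \<noteq> 0" "d \<noteq> 0" "j \<ge> 2" for P m j d
  proof -
    define Q where "Q = cmult_poly u P"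
    have "fps_of_real_seq (\<lambda>k. coeff P k * u k) \<in> R_class q"
      by (rule u) (rule poly_in_R_class[OF q P(1)])
    moreover have "(\<lambda>k. coeff P k * u k) = coeff Q" by (auto simp: Q_def mult.commute)
    ultimately have Q: "Q = 0 \<or> real_rooted Q" using R_class_poly_real_rooted[OF q] by simp
    have cQ: "coeff Q k = (if k = m then u m else if k = m + j then u (m + j) * d else 0)" for k
      using P(2)[of k] by (cases "u k = 0") (auto simp: Q_def)
    then have "Q \<noteq> 0" using nz(1) by (metis coeff_0)
    then have "real_rooted Q" using Q by simp
    then have "j = 2 \<and> u m * (u (m + j) * d) < 0" by (rule real_rooted_two_terms[OF cQ]) (use nz in auto)
    then show ?thesis unfolding mult.assoc .
  qed
  have A: "u m * u (m + 2) \<ge> 0" for m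
  proof (rule ccontr)
    assume neg: "\<not> u m * u (m + 2) \<ge> 0"
    define \<xi> :: "nat \<Rightarrow> real" where "\<xi> i = (if i = 0 then 1 else - 1)" for i
    have "sep_poly q (smult 1 (rp m \<xi> {..<2}))"
      by (rule sep_poly_rp[OF q]) (auto simp: psep_def sep_def \<xi>_def)
    moreover have "rp m \<xi> {..<2} = monom 1 m * [:1, 0, -1:]"
      by (simp add: rp_def \<xi>_def lessThan_Suc eval_nat_numeral)
    then have "coeff (smult 1 (rp m \<xi> {..<2})) k = (if k = m then 1 else if k = m + 2 then - 1 else 0)" for k
      by (auto simp: coeff_monom_mult coeff_pCons split: nat.split)
    ultimately have "2 = (2 :: nat) \<and> (u m * u (m + 2)) * (- 1) < 0"
      by (intro two_terms[of "smult 1 (rp m \<xi> {..<2})"]) (use neg in \<open>auto simp del: add_2_eq_Suc'\<close>)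
    then show False using neg by simp
  qed
  have B: "\<exists>i. m < i \<and> i < m + j \<and> u i \<noteq> 0" if nz: "j \<ge> 2" "u m \<noteq> 0" "u (m + j) \<noteq> 0" for m j
  proof (rule ccontr)
    \<comment> \<open>Both end coefficients of the truncated product are positive. Real-rootedness
      then requires a gap of length two with a sign change, which \<open>A\<close> has
      excluded.\<close>
    assume gap: "\<nexists>i. m < i \<and> i < m + j \<and> u i \<noteq> 0"
    define d where "d = (\<Prod>i<j. - geom q i)"
    have d: "d > 0" unfolding d_def using q by (intro prod_pos) (simp add: geom_def)
    have "sep_poly q (smult 1 (rp m (geom q) {..<j}))"
      by (rule sep_poly_rp[OF q]) (auto intro: canon_psep canon_geom q)
    moreover have "coeff (smult 1 (rp m (geom q) {..<j})) k = (if k = m then 1 else if k = m + j then d else 0)"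
      if "u k \<noteq> 0" for k
    proof -
      have "\<not> (m < k \<and> k < m + j)" using gap that by blast
      then consider "k < m" | "k = m" | "k = m + j" | "k > m + j" by linarith
      then show ?thesis
        using nz(1) by cases (simp_all add: coeff_rp[of m] coeff_rp_top d_def)
    qed
    ultimately have "j = 2" "(u m * u (m + j)) * d < 0"
      using two_terms[of "smult 1 (rp m (geom q) {..<j})" m j d] nz d by auto
    then show False using A[of m] d by (auto simp: mult_less_0_iff zero_le_mult_iff)
  qed
  show ?thesis by (rule same_sign_alternative[OF A B])
qed

text \<open>Testing a multiplier on \<open>R_inf q\<close> itself shows that it comes from some b in
  the class. Its signs then place b, or its reflection, in the class with non-positive zeros; the
  converse is the convolution theorem combined with reflection.\<close>

theorem multipliers_R_class:
  assumes q: "0 < q" "q \<le> 1"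
  shows "multipliers (R_class q) = plus_minus (PN_class q)"
proof (intro equalityI subsetI)
  fix g assume "g \<in> multipliers (R_class q)"
  then have g: "hadamard f g \<in> R_class q" if "f \<in> R_class q" for f
    using multipliers_char[OF q R_inf_R_class[OF q]] that by blast
  have "hadamard g (R_inf q) = hadamard (R_inf q) g" by (simp add: hadamard_def mult.commute)
  then have "g \<in> PR_class q"
    using g[OF R_inf_R_class[OF q]] fps_deg_R_inf[OF q] by (simp add: PR_class_def pre_class_def)
  then obtain b where b: "g = fps_of_real_seq (\<lambda>k. cw q k * b k)" "fps_of_real_seq b \<in> R_class q"
    using PR_class_char[OF q] by blast
  have "fps_of_real_seq (\<lambda>k. a k * (cw q k * b k)) \<in> R_class q" if "fps_of_real_seq a \<in> R_class q" for a
    using g[OF that] by (simp only: b(1) hadamard_fps_of_real_seq)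
  then have "same_sign (\<lambda>k. cw q k * b k) \<or> same_sign (\<lambda>k. (- 1) ^ k * (cw q k * b k))"
    by (rule multiplier_sign[OF q])
  then consider "same_sign b" | "same_sign (\<lambda>k. (- 1) ^ k * b k)"
    using same_sign_pos_mult[of "cw q"] cw_pos[OF q] by (simp only: mult.left_commute) blast
  then show "g \<in> plus_minus (PN_class q)"
  proof cases
    case 1
    then have "g \<in> PN_class q" using N_classI[OF q b(2)] b(1) PN_class_char[OF q] by blast
    then show ?thesis by (simp add: plus_minus_def)
  next
    case 2
    define f where "f = fps_of_real_seq (\<lambda>k. cw q k * ((- 1) ^ k * b k))"
    have "f \<in> PN_class q"
      unfolding PN_class_char[OF q] f_def using N_classI[OF q R_class_reflect[OF q b(2)] 2]
      by (intro exI[of _ "\<lambda>k. (- 1) ^ k * b k"] conjI refl)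
    moreover have "g = fps_compose f (- fps_X)"
      unfolding f_def fps_of_real_seq_reflect b(1) by (simp add: mult.left_commute flip: mult.assoc power_mult_distrib)
    ultimately show ?thesis by (simp add: plus_minus_def)
  qed
next
  fix g assume g: "g \<in> plus_minus (PN_class q)"
  have mult: "hadamard (fps_of_real_seq a) (fps_of_real_seq (\<lambda>k. cw q k * b k)) \<in> R_class q"
    if "fps_of_real_seq a \<in> R_class q" "fps_of_real_seq b \<in> N_class q" for a b
    using R_class_convolution[OF q that] by (simp add: hadamard_fps_of_real_seq mult_ac)
  obtain b where b: "fps_of_real_seq b \<in> N_class q" "g = fps_of_real_seq (\<lambda>k. cw q k * b k) \<or>
      g = fps_of_real_seq (\<lambda>k. (- 1) ^ k * (cw q k * b k))"
    using g unfolding plus_minus_def by (auto simp: PN_class_char[OF q] fps_of_real_seq_reflect)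
  have "hadamard f g \<in> R_class q" if f: "f \<in> R_class q" for f
  proof -
    obtain a where a: "f = fps_of_real_seq a" using R_class_real[OF q f] .
    have m: "hadamard (fps_of_real_seq a) (fps_of_real_seq (\<lambda>k. cw q k * b k)) \<in> R_class q"
      by (rule mult[OF _ b(1)]) (use f a in simp)
    show ?thesis
      using b(2) m R_class_reflect[OF q, of "\<lambda>k. a k * (cw q k * b k)"]
      by (auto simp: a hadamard_fps_of_real_seq mult.left_commute)
  qed
  then show "g \<in> multipliers (R_class q)" using multipliers_char[OF q R_inf_R_class[OF q]] by blast
qed

theorem multipliers_N_class:
  assumes q: "0 < q" "q \<le> 1"
  shows "multipliers (N_class q) = PN_class q"
proof (intro equalityI subsetI)
  fix g assume "g \<in> multipliers (N_class q)"
  then have "hadamard (R_inf q) g \<in> N_class q"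
    using multipliers_char[OF q R_inf_N_class[OF q]] R_inf_N_class[OF q] by blast
  moreover have "hadamard g (R_inf q) = hadamard (R_inf q) g" by (simp add: hadamard_def mult.commute)
  ultimately show "g \<in> PN_class q"
    using fps_deg_R_inf[OF q] by (simp add: PN_class_def pre_class_def)
next
  fix g assume "g \<in> PN_class q"
  then obtain b where b: "g = fps_of_real_seq (\<lambda>k. cw q k * b k)" "fps_of_real_seq b \<in> N_class q"
    using PN_class_char[OF q] by blast
  have "hadamard f g \<in> N_class q" if f: "f \<in> N_class q" for f
  proof -
    have "f \<in> R_class q" using f N_class_subset by blast
    then obtain a where a: "f = fps_of_real_seq a" using R_class_real[OF q] by blast
    show ?thesis using N_class_convolution[OF q _ b(2), of a] f
      by (simp add: a b(1) hadamard_fps_of_real_seq mult_ac)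
  qed
  then show "g \<in> multipliers (N_class q)" using multipliers_char[OF q R_inf_N_class[OF q]] by blast
qed

text \<open>Multiplication by positive weights does not move the first non-zero coefficient, so the
  order of vanishing is the same for a, for h and for suitable approximants.\<close>

lemma R_class_transfer:
  assumes q: "0 < r" "r < q" "q \<le> 1" and a: "fps_of_real_seq a \<in> R_class q"
  shows "fps_of_real_seq (\<lambda>k. cw q k / cw r k * a k) \<in> R_class r"
proof -
  have q0: "0 < q" "r < 1" "r \<le> 1" using q by auto
  obtain P where P: "\<And>n. sep_poly q (P n)" "\<And>k. (\<lambda>n. coeff (P n) k) \<longlonglongrightarrow> a k"
    "\<And>k n. (\<forall>j\<le>k. a j = 0) \<Longrightarrow> coeff (P n) k = 0"
    by (rule R_class_approx[OF q0(1) q(3) a]) blast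
  define h where "h = (\<lambda>k. cw q k / cw r k * a k)"
  have h0: "h k = 0 \<longleftrightarrow> a k = 0" for k
    using cw_pos[OF q0(1) q(3), of k] cw_pos[OF q(1) q0(3), of k] by (simp add: h_def)
  have "sep_seq r h"
  proof (cases "\<forall>k. h k = 0")
    case True
    then have "h = (\<lambda>_. 0)" by auto
    then show ?thesis using sep_seq_0 by simp
  next
    case False
    define p where "p = (LEAST k. h k \<noteq> 0)"
    have p: "h p \<noteq> 0" unfolding p_def using False by (metis (mono_tags, lifting) LeastI)
    have below: "a k = 0" if "k < p" for k
      using not_less_Least[of k "\<lambda>k. h k \<noteq> 0"] that h0 unfolding p_def by blast
    show ?thesis
    proof (rule sep_seq_limit[OF q(1) q0(2)])
      show "sep_poly r (cmult_poly (\<lambda>k. cw q k / cw r k) (P n))" for n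
        by (rule sep_poly_transfer[OF q P(1)])
      show "(\<lambda>n. coeff (cmult_poly (\<lambda>k. cw q k / cw r k) (P n)) k) \<longlonglongrightarrow> h k" for k
        unfolding coeff_cmult_poly h_def by (rule tendsto_mult_left[OF P(2)])
      show "coeff (cmult_poly (\<lambda>k. cw q k / cw r k) (P n)) k = 0" if "k < p" for n k
        using P(3)[of k n] below that by simp
    qed (rule p)
  qed
  then show ?thesis unfolding R_class_sep_seq[OF q(1) q0(2)] h_def .
qed

lemma PR_class_mono:
  assumes q: "0 < r" "r < q" "q \<le> 1"
  shows "PR_class q \<subseteq> PR_class r" "PN_class q \<subseteq> PN_class r"
proof -
  have q0: "0 < q" "r \<le> 1" using q by auto
  have eq: "cw q k * b k = cw r k * (cw q k / cw r k * b k)" for b k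
    using cw_pos[OF q(1) q0(2), of k] by simp
  show "PR_class q \<subseteq> PR_class r"
  proof
    fix f assume "f \<in> PR_class q"
    then obtain b where b: "f = fps_of_real_seq (\<lambda>k. cw q k * b k)" "fps_of_real_seq b \<in> R_class q"
      using PR_class_char[OF q0(1) q(3)] by blast
    show "f \<in> PR_class r" unfolding PR_class_char[OF q(1) q0(2)]
      by (rule exI, rule conjI[OF _ R_class_transfer[OF q b(2)]]) (simp only: b(1) flip: eq)
  qed
  show "PN_class q \<subseteq> PN_class r"
  proof
    fix f assume "f \<in> PN_class q"
    then obtain b where b: "f = fps_of_real_seq (\<lambda>k. cw q k * b k)" "fps_of_real_seq b \<in> N_class q"
      using PN_class_char[OF q0(1) q(3)] by blast
    have R: "fps_of_real_seq (\<lambda>k. cw q k / cw r k * b k) \<in> R_class r"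
      using R_class_transfer[OF q] b(2) N_class_subset by blast
    have "cw q k / cw r k > 0" for k using cw_pos[OF q0(1) q(3), of k] cw_pos[OF q(1) q0(2), of k] by simp
    then have "same_sign (\<lambda>k. cw q k / cw r k * b k)"
      using same_sign_pos_mult[of "\<lambda>k. cw q k / cw r k"] N_class_same_sign[OF q0(1) q(3) b(2)] by simp
    from N_classI[OF q(1) q0(2) R this]
    show "f \<in> PN_class r" unfolding PN_class_char[OF q(1) q0(2)]
      by (intro exI conjI) (simp_all only: b(1) flip: eq)
  qed
qed

section \<open>Newton's inequalities and log-concavity of the preclasses\<close>

lemma R_class_newton:
  assumes q: "0 < q" "q \<le> 1" and b: "fps_of_real_seq b \<in> R_class q"
  shows "prev_coeff (\<lambda>k. cw q k * b k) k * (cw q (k + 1) * b (k + 1)) \<le> (cw q k * b k)\<^sup>2"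
proof (cases k)
  case (Suc j)
  obtain P where P: "\<And>n. sep_poly q (P n)" "\<And>k. (\<lambda>n. coeff (P n) k) \<longlonglongrightarrow> b k"
    by (rule R_class_approx[OF q b]) blast
  have "cw q j * b j * (cw q (j + 2) * b (j + 2)) \<le> (cw q (Suc j) * b (Suc j))\<^sup>2"
    by (rule LIMSEQ_le[where X = "\<lambda>n. cw q j * coeff (P n) j * (cw q (j + 2) * coeff (P n) (j + 2))" and
        Y = "\<lambda>n. (cw q (Suc j) * coeff (P n) (Suc j))\<^sup>2"])
      (use sep_poly_newton[OF q P(1)] in \<open>auto intro!: tendsto_intros P(2)\<close>)
  then show ?thesis using Suc by (simp add: prev_coeff_def)
qed (simp add: prev_coeff_def)

lemma PR_class_LC_bar:
  assumes q: "0 < q" "q \<le> 1"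
  shows "PR_class q \<subseteq> LC_bar"
proof
  fix f assume "f \<in> PR_class q"
  then obtain b where b: "f = fps_of_real_seq (\<lambda>k. cw q k * b k)" "fps_of_real_seq b \<in> R_class q"
    using PR_class_char[OF q] by blast
  show "f \<in> LC_bar" unfolding LC_bar_def b(1) using R_class_newton[OF q b(2)] by blast
qed

lemma coeff_closure_limit:
  assumes S: "\<And>n. fps_of_real_seq (v n) \<in> S" and lim: "\<And>k. (\<lambda>n. v n k) \<longlonglongrightarrow> u k"
  shows "fps_of_real_seq u \<in> coeff_closure S"
proof -
  have "(\<lambda>n. fps_nth (fps_of_real_seq (v n))) \<longlonglongrightarrow> fps_nth (fps_of_real_seq u)"
    using limitin_componentwise[of "\<lambda>_. euclidean" UNIV "\<lambda>n. fps_nth (fps_of_real_seq (v n))"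
        "fps_nth (fps_of_real_seq u)" sequentially]
    by (simp add: euclidean_product_topology tendsto_of_real lim)
  then have "fps_nth (fps_of_real_seq u) \<in> closure (fps_nth ` S)"
    by (rule Lim_in_closed_set[rotated 3]) (auto intro!: always_eventually closure_subset[THEN subsetD] S)
  then show ?thesis by (simp add: coeff_closure_def)
qed

text \<open>The weights \<open>\<theta> ^ k\<^sup>2\<close> with \<open>\<theta> < 1\<close> turn log-concavity into strict log-concavity.\<close>

lemma PN_class_LC_plus_bar:
  assumes q: "0 < q" "q \<le> 1"
  shows "PN_class q \<subseteq> LC_plus_bar"
proof
  fix f assume "f \<in> PN_class q"
  then obtain b where b: "f = fps_of_real_seq (\<lambda>k. cw q k * b k)" "fps_of_real_seq b \<in> N_class q"
    using PN_class_char[OF q] by blast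
  define u where "u = (\<lambda>k. cw q k * b k)"
  have sign: "same_sign u"
    unfolding u_def using same_sign_pos_mult[of "cw q" b] cw_pos[OF q] N_class_same_sign[OF q b(2)] by simp
  have newton: "prev_coeff u k * u (k + 1) \<le> (u k)\<^sup>2" for k
    unfolding u_def using R_class_newton[OF q] b(2) N_class_subset by blast
  \<comment> \<open>Log-concavity alone could degenerate to 0 > 0 inside a gap of the support; the
    power bound rules this out wherever strictness is demanded.\<close>
  have no_gap: "u k \<noteq> 0" if "u l \<noteq> 0" "l \<le> k" "u m \<noteq> 0" "k \<le> m" for l k m
    using power_bound_zero[of u l k m] N_class_power_bound[OF q b(2)] that unfolding u_def by blast
  define v where "v \<theta> k = \<theta> ^ k\<^sup>2 * u k" for \<theta> :: real and k
  have strict: "fps_of_real_seq (v \<theta>) \<in> LC_plus" if \<theta>: "0 < \<theta>" "\<theta> < 1" for \<theta>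
  proof -
    have "same_sign (v \<theta>)"
      unfolding v_def using same_sign_pos_mult[of "\<lambda>k. \<theta> ^ k\<^sup>2" u] \<theta>(1) sign by simp
    moreover have "(v \<theta> k)\<^sup>2 > prev_coeff (v \<theta>) k * v \<theta> (k + 1)"
      if "l \<le> k" "v \<theta> l \<noteq> 0" "m \<ge> k" "v \<theta> m \<noteq> 0" for k l m
    proof -
      have uk: "u k \<noteq> 0" using no_gap[of l k m] that \<theta>(1) by (simp add: v_def)
      show ?thesis
      proof (cases k)
        case 0
        then show ?thesis using uk by (simp add: prev_coeff_def v_def)
      next
        case (Suc j)
        \<comment> \<open>The exponents of the two neighbours add up to 2 more than twice the middle
          one, and the surplus factor of \<open>\<theta>\<close> squared makes the inequality
          strict.\<close>
        have "prev_coeff (v \<theta>) k * v \<theta> (k + 1) = \<theta> ^ (2 * k\<^sup>2 + 2) * (prev_coeff u k * u (k + 1))"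
        proof -
          have "j\<^sup>2 + (j + 2)\<^sup>2 = 2 * k\<^sup>2 + 2" unfolding Suc by (simp add: power2_eq_square algebra_simps)
          then have "\<theta> ^ j\<^sup>2 * \<theta> ^ (j + 2)\<^sup>2 = \<theta> ^ (2 * k\<^sup>2 + 2)" by (simp flip: power_add)
          then show ?thesis unfolding v_def prev_coeff_def Suc by (simp add: mult_ac)
        qed
        also have "\<dots> \<le> \<theta> ^ (2 * k\<^sup>2 + 2) * (u k)\<^sup>2"
          using newton \<theta>(1) by (intro mult_left_mono) auto
        also have "\<dots> < \<theta> ^ (2 * k\<^sup>2) * (u k)\<^sup>2"
          using uk \<theta> by (intro mult_strict_right_mono power_strict_decreasing) auto
        also have "\<dots> = (v \<theta> k)\<^sup>2" by (simp add: v_def power_mult_distrib flip: power_mult) (simp add: mult.commute)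
        finally show ?thesis .
      qed
    qed
    ultimately show ?thesis unfolding LC_plus_def same_sign_def by blast
  qed
  have "fps_of_real_seq u \<in> coeff_closure LC_plus"
  proof (rule coeff_closure_limit)
    show "fps_of_real_seq (v (1 - 1 / real (n + 2))) \<in> LC_plus" for n
      by (rule strict) (simp_all add: field_simps)
    have "(\<lambda>n. 1 - 1 / real (n + 2)) \<longlonglongrightarrow> 1 - 0"
      by (intro tendsto_diff tendsto_const LIMSEQ_ignore_initial_segment[OF lim_1_over_n])
    then have "(\<lambda>n. v (1 - 1 / real (n + 2)) k) \<longlonglongrightarrow> (1 - 0) ^ k\<^sup>2 * u k" for k
      unfolding v_def by (rule tendsto_mult_right[OF tendsto_power])
    then show "(\<lambda>n. v (1 - 1 / real (n + 2)) k) \<longlonglongrightarrow> u k" for k by simp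
  qed
  then show "f \<in> LC_plus_bar" by (simp add: LC_plus_bar_def b(1) u_def)
qed

theorem theorem5:
  fixes q :: real
  assumes "0 < q" and "q \<le> 1"
  shows
    "multipliers (R_class q) = plus_minus (PN_class q) \<and>
     multipliers (N_class q) = PN_class q \<and>
     (\<forall>r f. 0 < r \<and> r < q \<longrightarrow>
        (f \<in> PR_class q \<longrightarrow> f \<in> PR_class r) \<and> (f \<in> PN_class q \<longrightarrow> f \<in> PN_class r)) \<and>
     (\<Union>s\<in>{0<..1}. PR_class s) \<subseteq> LC_bar \<and>
     (\<Union>s\<in>{0<..1}. PN_class s) \<subseteq> LC_plus_bar"
proof (intro conjI allI impI UN_least)
  show "f \<in> PR_class r" if "0 < r \<and> r < q" "f \<in> PR_class q" for r f
    using PR_class_mono(1)[OF _ _ assms(2)] that by blast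
  show "f \<in> PN_class r" if "0 < r \<and> r < q" "f \<in> PN_class q" for r f
    using PR_class_mono(2)[OF _ _ assms(2)] that by blast
qed (simp_all add: assms multipliers_R_class multipliers_N_class PR_class_LC_bar PN_class_LC_plus_bar)

end
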